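(* Let $n\geq1$, let $F:[0,+\infty)\rightarrow\mathbb R$ be a continuous function bounded from below satisfying $\lim_{+\infty}F=+\infty$, and let $\omega\subset\mathbb R^n$ be a measurable set. The evolution system $(E_F)$ associated with $F$ and $\omega$ is rapidly stabilizable from $\omega$ if and only if $\omega$ is thick.
   Context: $L^2(\mathbb R^n)$ is the space of complex-valued square-integrable functions, $\mathcal L(L^2(\mathbb R^n))$ the bounded linear operators on it, and $\mathbf 1_\omega$ the characteristic function of $\omega$, also viewed as a multiplication operator. For a continuous function $F:[0,+\infty)\to\mathbb R$ bounded from below, $F(|D_x|)$ is the Fourier multiplier with symbol $F(|\xi|)$, where $|\cdot|$ is the Euclidean norm, with domain $\{u\in L^2(\mathbb R^n): F(|D_x|)u\in L^2(\mathbb R^n)\}$. For $B\in\mathcal L(L^2(\mathbb R^n))$, $(e^{-t(F(|D_x|)+B)})_{t\geq0}$ denotes the strongly continuous semigroup generated by $-(F(|D_x|)+B)$ (it exists by bounded perturbation theory). The control system $(E_F)$ is $$\partial_tf(t,x)+F(|D_x|)f(t,x)=h(t,x)\mathbf 1_\omega(x),\quad t>0,\ x\in\mathbb R^n,\qquad f(0,\cdot)=f_0\in L^2(\mathbb R^n).$$ Stabilizability: $(E_F)$ is exponentially stabilizable from $\omega$ at rate $\alpha>0$ if there exist $M_\alpha\geq1$ and a feedback $K_\alpha\in\mathcal L(L^2(\mathbb R^n))$ such that $\Vert e^{-t(F(|D_x|)+\mathbf 1_\omega K_\alpha)}\Vert_{\mathcal L(L^2(\mathbb R^n))}\le M_\alpha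 e^{-\alpha t}$ for all $t\geq0$. It is rapidly stabilizable from $\omega$ if it is exponentially stabilizable from $\omega$ at every rate $\alpha>0$. Thickness: given $\gamma\in(0,1)$ and $L>0$, a set $\omega\subset\mathbb R^n$ is $\gamma$-thick at scale $L$ if it is measurable and $\operatorname{Leb}(\omega\cap(x+[0,L]^n))\geq\gamma L^n$ for all $x\in\mathbb R^n$, where $\operatorname{Leb}$ is Lebesgue measure. It is thick if it is $\gamma$-thick at scale $L$ for some $\gamma\in(0,1)$ and $L>0$. *)

theory Defs
  imports "HOL-Analysis.Analysis"
begin

section \<open>The Hilbert space of complex-valued square-integrable functions\<close>

definition square_integrable :: "('a::euclidean_space \<Rightarrow> complex) \<Rightarrow> bool" where
  "square_integrable f \<longleftrightarrow>
     f \<in> borel_measurable lebesgue \<and> integrable lebesgue (\<lambda>x. (cmod (f x))\<^sup>2)"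

lemma square_integrable_measurable [measurable_dest]:
  "square_integrable f \<Longrightarrow> f \<in> borel_measurable lebesgue"
  by (simp add: square_integrable_def)

lemma square_integrable_zero [simp]: "square_integrable (\<lambda>_. 0)"
  by (simp add: square_integrable_def)

lemma square_integrable_mult_bounded:
  assumes f: "square_integrable f" and g: "g \<in> borel_measurable lebesgue"
    and bound: "\<And>x. cmod (g x) \<le> C"
  shows "square_integrable (\<lambda>x. g x * f x)"
proof -
  have [measurable]: "f \<in> borel_measurable lebesgue" "g \<in> borel_measurable lebesgue"
    using f g by (auto simp: square_integrable_def)
  have "integrable lebesgue (\<lambda>x. C\<^sup>2 * (cmod (f x))\<^sup>2)"
    using f by (simp add: square_integrable_def)
  then have "integrable lebesgue (\<lambda>x. (cmod (g x * f x))\<^sup>2)"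
  proof (rule Bochner_Integration.integrable_bound)
    show "AE x in lebesgue. norm ((cmod (g x * f x))\<^sup>2) \<le> norm (C\<^sup>2 * (cmod (f x))\<^sup>2)"
      using bound
      by (intro AE_I2) (auto simp: norm_mult power_mult_distrib intro!: mult_right_mono power_mono)
  qed simp
  then show ?thesis
    by (simp add: square_integrable_def)
qed

lemma square_integrable_cmult: "square_integrable f \<Longrightarrow> square_integrable (\<lambda>x. c * f x)"
  by (rule square_integrable_mult_bounded[where C = "cmod c"]) auto

lemma square_integrable_add:
  assumes "square_integrable f" "square_integrable g"
  shows "square_integrable (\<lambda>x. f x + g x)"
proof -
  have [measurable]: "f \<in> borel_measurable lebesgue" "g \<in> borel_measurable lebesgue"
    using assms by (auto simp: square_integrable_def)
  have "integrable lebesgue (\<lambda>x. 2 * (cmod (f x))\<^sup>2 + 2 * (cmod (g x))\<^sup>2)"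
    using assms by (simp add: square_integrable_def)
  then have "integrable lebesgue (\<lambda>x. (cmod (f x + g x))\<^sup>2)"
  proof (rule Bochner_Integration.integrable_bound)
    have "(cmod (f x + g x))\<^sup>2 \<le> 2 * (cmod (f x))\<^sup>2 + 2 * (cmod (g x))\<^sup>2" for x
    proof -
      have "(cmod (f x + g x))\<^sup>2 \<le> (cmod (f x) + cmod (g x))\<^sup>2"
        by (intro power_mono norm_triangle_ineq) auto
      also have "\<dots> \<le> 2 * (cmod (f x))\<^sup>2 + 2 * (cmod (g x))\<^sup>2"
        using sum_squares_bound[of "cmod (f x)" "cmod (g x)"] by (simp add: power2_sum)
      finally show ?thesis .
    qed
    then show "AE x in lebesgue. norm ((cmod (f x + g x))\<^sup>2)
        \<le> norm (2 * (cmod (f x))\<^sup>2 + 2 * (cmod (g x))\<^sup>2)"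
      by (intro AE_I2) auto
  qed simp
  then show ?thesis
    by (simp add: square_integrable_def)
qed

lemma square_integrable_mult_cnj:
  assumes "square_integrable f" "square_integrable g"
  shows "integrable lebesgue (\<lambda>x. f x * cnj (g x))"
proof -
  have [measurable]: "f \<in> borel_measurable lebesgue" "g \<in> borel_measurable lebesgue"
    using assms by (auto simp: square_integrable_def)
  have [measurable]: "(\<lambda>x. cnj (g x)) \<in> borel_measurable lebesgue"
    by (intro borel_measurable_continuous_on[where f = cnj] continuous_intros) auto
  have "integrable lebesgue (\<lambda>x. (cmod (f x))\<^sup>2 + (cmod (g x))\<^sup>2)"
    using assms by (simp add: square_integrable_def)
  then show ?thesis
  proof (rule Bochner_Integration.integrable_bound)
    have "cmod (f x) * cmod (g x) \<le> (cmod (f x))\<^sup>2 + (cmod (g x))\<^sup>2" for x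
    proof -
      have "0 \<le> cmod (f x) * cmod (g x)"
        by simp
      then show ?thesis
        using sum_squares_bound[of "cmod (f x)" "cmod (g x)"] by linarith
    qed
    then show "AE x in lebesgue. norm (f x * cnj (g x))
        \<le> norm ((cmod (f x))\<^sup>2 + (cmod (g x))\<^sup>2)"
      by (intro AE_I2) (auto simp: norm_mult)
  qed simp
qed

quotient_type (overloaded) 'a L2 = "'a::euclidean_space \<Rightarrow> complex" / partial:
  "\<lambda>f g. square_integrable f \<and> square_integrable g \<and> (AE x in lebesgue. f x = g x)"
proof (rule part_equivpI)
  show "\<exists>f::'a \<Rightarrow> complex. square_integrable f \<and> square_integrable f \<and> (AE x in lebesgue. f x = f x)"
    by (rule exI[of _ "\<lambda>_. 0"]) simp
next
  show "symp (\<lambda>f g::'a \<Rightarrow> complex.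
      square_integrable f \<and> square_integrable g \<and> (AE x in lebesgue. f x = g x))"
    by (auto simp: symp_def elim: AE_mp)
next
  show "transp (\<lambda>f g::'a \<Rightarrow> complex.
      square_integrable f \<and> square_integrable g \<and> (AE x in lebesgue. f x = g x))"
    unfolding transp_def by (auto elim!: AE_mp)
qed

text \<open>The class of a function; functions that are not square-integrable are sent to \<open>0\<close>.\<close>

lift_definition L2_of :: "('a::euclidean_space \<Rightarrow> complex) \<Rightarrow> 'a L2" is
  "\<lambda>f. if square_integrable f then f else (\<lambda>_. 0)"
  by auto

text \<open>Some representative, determined only almost everywhere.\<close>

definition L2_fun :: "'a::euclidean_space L2 \<Rightarrow> 'a \<Rightarrow> complex" where
  "L2_fun u = rep_L2 u"

lemma square_integrable_L2_fun [simp]: "square_integrable (L2_fun u)"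
  unfolding L2_fun_def using Quotient3_rep_reflp[OF Quotient3_L2, of u] by simp

lemma L2_of_L2_fun [simp]: "L2_of (L2_fun u) = u"
  using square_integrable_L2_fun[of u] Quotient3_abs_rep[OF Quotient3_L2, of u]
  by (simp add: L2_of_def L2_fun_def)

lemma L2_fun_L2_of:
  assumes "square_integrable f"
  shows "AE x in lebesgue. L2_fun (L2_of f) x = f x"
  using assms rep_abs_rsp_left[OF Quotient3_L2, of f f]
  by (simp add: L2_of_def L2_fun_def)

instantiation L2 :: (euclidean_space) real_inner
begin

lift_definition zero_L2 :: "'a L2" is "\<lambda>_. 0"
  by simp

lift_definition plus_L2 :: "'a L2 \<Rightarrow> 'a L2 \<Rightarrow> 'a L2" is "\<lambda>f g x. f x + g x"
  by (auto intro: square_integrable_add)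

lift_definition uminus_L2 :: "'a L2 \<Rightarrow> 'a L2" is "\<lambda>f x. - f x"
  using square_integrable_cmult[of _ "-1"] by auto

definition minus_L2 :: "'a L2 \<Rightarrow> 'a L2 \<Rightarrow> 'a L2" where
  "minus_L2 u v = u + - v"

lift_definition scaleR_L2 :: "real \<Rightarrow> 'a L2 \<Rightarrow> 'a L2" is "\<lambda>r f x. complex_of_real r * f x"
  by (auto intro: square_integrable_cmult)

lift_definition inner_L2 :: "'a L2 \<Rightarrow> 'a L2 \<Rightarrow> real" is
  "\<lambda>f g. Re (\<integral>x. f x * cnj (g x) \<partial>lebesgue)"
proof -
  fix f f' g g' :: "'a \<Rightarrow> complex"
  assume "square_integrable f \<and> square_integrable f' \<and> (AE x in lebesgue. f x = f' x)"
    "square_integrable g \<and> square_integrable g' \<and> (AE x in lebesgue. g x = g' x)"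
  then show "Re (\<integral>x. f x * cnj (g x) \<partial>lebesgue) = Re (\<integral>x. f' x * cnj (g' x) \<partial>lebesgue)"
    by (intro arg_cong[of _ _ Re] integral_cong_AE borel_measurable_integrable
        square_integrable_mult_cnj) auto
qed

definition norm_L2 :: "'a L2 \<Rightarrow> real" where
  "norm_L2 u = sqrt (inner u u)"

definition sgn_L2 :: "'a L2 \<Rightarrow> 'a L2" where
  "sgn_L2 u = scaleR (inverse (norm u)) u"

definition dist_L2 :: "'a L2 \<Rightarrow> 'a L2 \<Rightarrow> real" where
  "dist_L2 u v = norm (u - v)"

definition uniformity_L2 :: "('a L2 \<times> 'a L2) filter" where
  "uniformity_L2 = (INF e\<in>{0<..}. principal {(u, v). dist u v < e})"

definition open_L2 :: "'a L2 set \<Rightarrow> bool" where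
  "open_L2 U \<longleftrightarrow> (\<forall>u\<in>U. \<forall>\<^sub>F (u', v) in uniformity. u' = u \<longrightarrow> v \<in> U)"

instance
proof
  fix u v w :: "'a L2" and a b :: real
  show "u + v + w = u + (v + w)"
    by transfer (auto simp: add.assoc intro!: square_integrable_add)
  show "u + v = v + u"
    by transfer (auto simp: add.commute intro!: square_integrable_add)
  show "0 + u = u"
    by transfer auto
  show "- u + u = 0"
    by transfer auto
  show "u - v = u + - v"
    by (rule minus_L2_def)
  show "a *\<^sub>R (u + v) = a *\<^sub>R u + a *\<^sub>R v"
    by transfer (auto simp: distrib_left intro!: square_integrable_add square_integrable_cmult)
  show "(a + b) *\<^sub>R u = a *\<^sub>R u + b *\<^sub>R u"
  proof transfer
    fix a b and f :: "'a \<Rightarrow> complex"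
    assume "square_integrable f \<and> square_integrable f \<and> (AE x in lebesgue. f x = f x)"
    then show "square_integrable (\<lambda>x. complex_of_real (a + b) * f x) \<and>
       square_integrable (\<lambda>x. complex_of_real a * f x + complex_of_real b * f x) \<and>
       (AE x in lebesgue. complex_of_real (a + b) * f x
          = complex_of_real a * f x + complex_of_real b * f x)"
      using square_integrable_add[OF square_integrable_cmult[of f "complex_of_real a"]
          square_integrable_cmult[of f "complex_of_real b"]]
      by (auto simp: distrib_right)
  qed
  show "a *\<^sub>R b *\<^sub>R u = (a * b) *\<^sub>R u"
  proof transfer
    fix a b and f :: "'a \<Rightarrow> complex"
    assume "square_integrable f \<and> square_integrable f \<and> (AE x in lebesgue. f x = f x)"
    then show "square_integrable (\<lambda>x. complex_of_real a * (complex_of_real b * f x)) \<and>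
       square_integrable (\<lambda>x. complex_of_real (a * b) * f x) \<and>
       (AE x in lebesgue. complex_of_real a * (complex_of_real b * f x)
          = complex_of_real (a * b) * f x)"
      using square_integrable_cmult[of f "complex_of_real a * complex_of_real b"]
      by (auto simp: mult.assoc)
  qed
  show "1 *\<^sub>R u = u"
    by transfer auto
  show "sgn u = scaleR (inverse (norm u)) u"
    by (rule sgn_L2_def)
  show "dist u v = norm (u - v)"
    by (rule dist_L2_def)
  show "(uniformity :: ('a L2 \<times> 'a L2) filter) = (INF e\<in>{0<..}. principal {(u, v). dist u v < e})"
    by (rule uniformity_L2_def)
  show "open U \<longleftrightarrow> (\<forall>u\<in>U. \<forall>\<^sub>F (u', v) in uniformity. u' = u \<longrightarrow> v \<in> U)" for U :: "'a L2 set"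
    by (rule open_L2_def)
  show "inner u v = inner v u"
  proof transfer
    fix f g :: "'a \<Rightarrow> complex"
    have "(\<integral>x. g x * cnj (f x) \<partial>lebesgue) = (\<integral>x. cnj (f x * cnj (g x)) \<partial>lebesgue)"
      by (simp add: mult.commute)
    also have "\<dots> = cnj (\<integral>x. f x * cnj (g x) \<partial>lebesgue)"
      by (rule Bochner_Integration.integral_cnj)
    finally show "Re (\<integral>x. f x * cnj (g x) \<partial>lebesgue) = Re (\<integral>x. g x * cnj (f x) \<partial>lebesgue)"
      by simp
  qed
  show "inner (u + v) w = inner u w + inner v w"
    by transfer (auto simp: distrib_right square_integrable_mult_cnj)
  show "inner (a *\<^sub>R u) v = a * inner u v"
    by transfer (auto simp: mult.assoc)
  have inner_self: "Re (\<integral>x. f x * cnj (f x) \<partial>lebesgue) = (\<integral>x. (cmod (f x))\<^sup>2 \<partial>lebesgue)"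
    for f :: "'a \<Rightarrow> complex"
    by (simp only: complex_norm_square[symmetric] integral_complex_of_real Re_complex_of_real)
  show "0 \<le> inner u u"
    by transfer (simp only: inner_self, simp)
  show "inner u u = 0 \<longleftrightarrow> u = 0"
  proof transfer
    fix f :: "'a \<Rightarrow> complex"
    assume "square_integrable f \<and> square_integrable f \<and> (AE x in lebesgue. f x = f x)"
    then have f: "square_integrable f"
      by simp
    then have "(\<integral>x. (cmod (f x))\<^sup>2 \<partial>lebesgue) = 0 \<longleftrightarrow> (AE x in lebesgue. (cmod (f x))\<^sup>2 = 0)"
      by (intro integral_nonneg_eq_0_iff_AE) (auto simp: square_integrable_def)
    with f show "(Re (\<integral>x. f x * cnj (f x) \<partial>lebesgue) = 0) =
        (square_integrable f \<and> square_integrable (\<lambda>_::'a. 0) \<and> (AE x in lebesgue. f x = 0))"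
      by (simp only: inner_self) simp
  qed
  show "norm u = sqrt (inner u u)"
    by (rule norm_L2_def)
qed

end

lemma norm_L2_eq: "norm u = sqrt (\<integral>x. (cmod (L2_fun u x))\<^sup>2 \<partial>lebesgue)"
  by (simp only: norm_L2_def inner_L2.rep_eq L2_fun_def complex_norm_square[symmetric]
      integral_complex_of_real Re_complex_of_real)

definition scaleC_L2 :: "complex \<Rightarrow> 'a::euclidean_space L2 \<Rightarrow> 'a L2" where
  "scaleC_L2 c u = L2_of (\<lambda>x. c * L2_fun u x)"

definition indicator_L2 :: "'a set \<Rightarrow> 'a::euclidean_space L2 \<Rightarrow> 'a L2" where
  "indicator_L2 \<omega> u = L2_of (\<lambda>x. indicator \<omega> x * L2_fun u x)"

text \<open>The library's \<^const>\<open>bounded_linear\<close> is only real-linear.\<close>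

definition bounded_clinear_L2 :: "('a::euclidean_space L2 \<Rightarrow> 'a L2) \<Rightarrow> bool" where
  "bounded_clinear_L2 B \<longleftrightarrow>
     bounded_linear B \<and> (\<forall>c u. B (scaleC_L2 c u) = scaleC_L2 c (B u))"


section \<open>Fourier transform and radial Fourier multipliers\<close>

text \<open>
  The Fourier--Plancherel transform, with the convention
  \<open>\<integral> exp (- \<i> x \<bullet> \<xi>) u x dx\<close>, obtained as the limit in \<open>L\<^sup>2\<close> of the transforms of the
  truncations of \<open>u\<close> to balls (which are integrable). By Plancherel's theorem the limit
  exists and the transform is bijective, so \<open>inv fourier_L2\<close> below is its genuine inverse.
\<close>

definition fourier_L2 :: "'a::euclidean_space L2 \<Rightarrow> 'a L2" where
  "fourier_L2 u = Lim at_top (\<lambda>R::real. L2_of (\<lambda>\<xi>.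
     LINT x:cball 0 R|lebesgue. exp (- \<i> * complex_of_real (x \<bullet> \<xi>)) * L2_fun u x))"

definition multiplier_dom :: "(real \<Rightarrow> real) \<Rightarrow> 'a::euclidean_space L2 set" where
  "multiplier_dom F =
     {u. square_integrable (\<lambda>\<xi>. complex_of_real (F (norm \<xi>)) * L2_fun (fourier_L2 u) \<xi>)}"

definition multiplier :: "(real \<Rightarrow> real) \<Rightarrow> 'a::euclidean_space L2 \<Rightarrow> 'a L2" where
  "multiplier F u =
     inv fourier_L2 (L2_of (\<lambda>\<xi>. complex_of_real (F (norm \<xi>)) * L2_fun (fourier_L2 u) \<xi>))"


section \<open>Strongly continuous semigroups\<close>

text \<open>Only the values of \<open>T\<close> at nonnegative times are relevant.\<close>

definition strongly_continuous_semigroup ::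
    "(real \<Rightarrow> 'a::euclidean_space L2 \<Rightarrow> 'a L2) \<Rightarrow> bool" where
  "strongly_continuous_semigroup T \<longleftrightarrow>
     (\<forall>t\<ge>0. bounded_clinear_L2 (T t)) \<and>
     (\<forall>u. T 0 u = u) \<and>
     (\<forall>s\<ge>0. \<forall>t\<ge>0. \<forall>u. T (s + t) u = T s (T t u)) \<and>
     (\<forall>u. ((\<lambda>t. T t u) \<longlongrightarrow> u) (at_right 0))"

text \<open>
  The semigroup \<open>T\<close> is generated by the operator \<open>A\<close> with domain \<open>D\<close>;
  the values of \<open>A\<close> outside \<open>D\<close> are irrelevant.
\<close>

definition generates_semigroup ::
    "'a::euclidean_space L2 set \<Rightarrow> ('a L2 \<Rightarrow> 'a L2) \<Rightarrow> (real \<Rightarrow> 'a L2 \<Rightarrow> 'a L2) \<Rightarrow> bool" where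
  "generates_semigroup D A T \<longleftrightarrow>
     strongly_continuous_semigroup T \<and>
     D = {u. \<exists>v. ((\<lambda>t. (T t u - u) /\<^sub>R t) \<longlongrightarrow> v) (at_right 0)} \<and>
     (\<forall>u\<in>D. ((\<lambda>t. (T t u - u) /\<^sub>R t) \<longlongrightarrow> A u) (at_right 0))"


section \<open>Stabilizability and thickness\<close>

text \<open>
  The system is \<open>\<partial>\<^sub>t f + F(|D|) f = \<one>\<^bsub>\<omega>\<^esub> h\<close>, closed by the feedback \<open>h = - K f\<close>.
  A semigroup is determined by its generator, so \<open>T\<close> below can only be the semigroup
  \<open>exp (- t (F(|D|) + \<one>\<^bsub>\<omega>\<^esub> K))\<close> of the closed-loop system. It always exists, since
  \<open>\<one>\<^bsub>\<omega>\<^esub> K\<close> is a bounded perturbation.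
\<close>

definition exponentially_stabilizable ::
    "(real \<Rightarrow> real) \<Rightarrow> 'a::euclidean_space set \<Rightarrow> real \<Rightarrow> bool" where
  "exponentially_stabilizable F \<omega> \<alpha> \<longleftrightarrow>
     (\<exists>M\<ge>1. \<exists>K. bounded_clinear_L2 K \<and>
       (\<exists>T. generates_semigroup (multiplier_dom F)
              (\<lambda>u. - (multiplier F u + indicator_L2 \<omega> (K u))) T \<and>
            (\<forall>t\<ge>0. onorm (T t) \<le> M * exp (- \<alpha> * t))))"

definition rapidly_stabilizable ::
    "(real \<Rightarrow> real) \<Rightarrow> 'a::euclidean_space set \<Rightarrow> bool" where
  "rapidly_stabilizable F \<omega> \<longleftrightarrow> (\<forall>\<alpha>>0. exponentially_stabilizable F \<omega> \<alpha>)"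

definition thick_at_scale :: "real \<Rightarrow> real \<Rightarrow> (real ^ 'n) set \<Rightarrow> bool" where
  "thick_at_scale \<gamma> L \<omega> \<longleftrightarrow>
     \<omega> \<in> sets lebesgue \<and>
     (\<forall>x. measure lebesgue (\<omega> \<inter> (+) x ` {y. \<forall>i. y $ i \<in> {0..L}}) \<ge> \<gamma> * L ^ CARD('n))"

definition thick :: "(real ^ 'n) set \<Rightarrow> bool" where
  "thick \<omega> \<longleftrightarrow> (\<exists>\<gamma>\<in>{0<..<1}. \<exists>L>0. thick_at_scale \<gamma> L \<omega>)"

end

theory Submission
  imports Defs "HOL-Probability.Characteristic_Functions"
begin

text \<open>
  Thickness suffices. Fix the rate \<open>\<alpha>\<close>. Since \<open>F\<close> tends to infinity, only the frequencies in a
  ball \<open>{|\<xi>| \<le> \<Lambda>}\<close> decay too slowly; let \<open>P\<close> be the spectral projection onto them and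
  \<open>Q = 1 - P\<close>. The analytic input is the spectral inequality
  \<open>c |u| \<le> |1\<^bsub>\<omega>\<^esub> u|\<close> for \<open>u = P u\<close> (\<open>spectral_inequality\<close>). It makes \<open>P 1\<^bsub>\<omega>\<^esub> P\<close>
  invertible on the range of \<open>P\<close>, so there is a bounded \<open>K\<close> with
  \<open>P 1\<^bsub>\<omega>\<^esub> K = (\<alpha> - F(|D|)) P\<close>. With this feedback the low frequencies evolve by
  \<open>exp (- t \<alpha>)\<close> exactly, and they only drive the high ones. The closed-loop generator is thus
  block triangular, and the operator \<open>N = (F(|D|) - \<alpha>)\<^sup>-\<^sup>1 Q 1\<^bsub>\<omega>\<^esub> K\<close> decouples the blocks:
  conjugation by \<open>1 + N\<close> turns the generator into a Fourier multiplier with symbol at most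
  \<open>- \<alpha>\<close>, so that the closed-loop semigroup is explicit
  (\<open>stabilizable_if_spectral_inequality\<close>).

  The spectral inequality is reduced to one dimension. A smooth function on a segment is, up to an
  error of size \<open>L\<^sup>m / m!\<close> times its derivatives of order \<open>m\<close> and \<open>m + 1\<close>, controlled by its
  values on any subset of given measure, by Lagrange interpolation at well separated nodes of that
  subset (\<open>remez_taylor_inequality\<close>). For a band-limited function the \<open>m\<close>-th directional
  derivative costs only \<open>\<Lambda>\<^sup>m\<close> in norm by Plancherel's theorem, so for large \<open>m\<close> the error is
  absorbed globally. Applied along all segments parallel to one axis, this allows \<open>\<omega>\<close> to be
  replaced by the set of points from which \<open>\<omega>\<close> is seen with positive density along that axis.
  If \<open>\<omega>\<close> is thick, going through all axes exhausts the whole space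
  (\<open>observable_from_box_mass\<close>).

  Thickness is necessary. Let \<open>\<alpha> > F 0\<close>, and let the Fourier transform of \<open>g\<close> live where
  \<open>F\<close> is close to \<open>F 0\<close>. The function \<open>exp (t F 0) \<langle>T t g, g\<rangle>\<close> starts at
  \<open>|g|\<^sup>2\<close>, tends to \<open>0\<close>, and its derivative consists of a small term and of a term carrying
  the factor \<open>|1\<^bsub>\<omega>\<^esub> g|\<close>. Integration gives \<open>|g| \<le> C |1\<^bsub>\<omega>\<^esub> g|\<close>
  (\<open>weak_observability\<close>). All translates of one such function satisfy this bound, each carries
  most of its mass in a cube of fixed size, and it is bounded; hence \<open>\<omega>\<close> has a fixed positive
  amount of measure in each cube (\<open>thick_if_weak_observability\<close>).

  Both directions rest on the Fourier transform being a multiple of a unitary operator. Plancherel's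
  theorem is proved by Gaussian regularisation, and the transform is extended to the completion
  \<open>L\<^sup>2\<close>, where surjectivity follows from the fact that the transform and its adjoint are both
  isometric up to the same factor.
\<close>

section \<open>The Hilbert space of square-integrable functions\<close>

lemma borel_measurable_cnj [measurable (raw)]:
  "f \<in> borel_measurable M \<Longrightarrow> (\<lambda>x. cnj (f x)) \<in> borel_measurable M"
  by (intro borel_measurable_continuous_on[where f = cnj] continuous_intros) auto

lemma L2_of_cong_AE:
  assumes "square_integrable f" "square_integrable g" "AE x in lebesgue. f x = g x"
  shows "L2_of f = L2_of g"
  using assms by transfer auto

lemma L2_fun_measurable [measurable]: "L2_fun u \<in> borel_measurable lebesgue"
  using square_integrable_L2_fun square_integrable_def by blast

lemma square_integrable_cong_AE:
  assumes "square_integrable f" "g \<in> borel_measurable lebesgue" "AE x in lebesgue. f x = g x"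
  shows "square_integrable g"
proof -
  have [measurable]: "f \<in> borel_measurable lebesgue" using assms by (simp add: square_integrable_def)
  note [measurable] = assms(2)
  have "integrable lebesgue (\<lambda>x. (cmod (f x))\<^sup>2) = integrable lebesgue (\<lambda>x. (cmod (g x))\<^sup>2)"
    using assms(3) by (intro integrable_cong_AE) (auto elim!: eventually_mono)
  then show ?thesis using assms by (simp add: square_integrable_def)
qed

lemma square_integrable_uminus: "square_integrable f \<Longrightarrow> square_integrable (\<lambda>x. - f x)"
  using square_integrable_cmult[of f "-1"] by simp

lemma square_integrable_diff:
  "square_integrable f \<Longrightarrow> square_integrable g \<Longrightarrow> square_integrable (\<lambda>x. f x - g x)"
  using square_integrable_add[of f "\<lambda>x. - g x"] square_integrable_uminus[of g] by simp

lemma L2_of_add: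
  "square_integrable f \<Longrightarrow> square_integrable g \<Longrightarrow> L2_of (\<lambda>x. f x + g x) = L2_of f + L2_of g"
  by transfer (auto intro: square_integrable_add)

lemma L2_of_uminus: "square_integrable f \<Longrightarrow> L2_of (\<lambda>x. - f x) = - L2_of f"
  by transfer (auto intro: square_integrable_uminus)

lemma L2_of_diff:
  "square_integrable f \<Longrightarrow> square_integrable g \<Longrightarrow> L2_of (\<lambda>x. f x - g x) = L2_of f - L2_of g"
  using L2_of_add[of f "\<lambda>x. - g x"] L2_of_uminus[of g] square_integrable_uminus[of g] by simp

lemma L2_of_scaleR:
  "square_integrable f \<Longrightarrow> L2_of (\<lambda>x. complex_of_real r * f x) = r *\<^sub>R L2_of f"
  by transfer (auto intro: square_integrable_cmult)

lemma L2_of_zero [simp]: "L2_of (\<lambda>_. 0) = 0"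
  by transfer auto

lemma L2_fun_add: "AE x in lebesgue. L2_fun (u + v) x = L2_fun u x + L2_fun v x"
  using L2_fun_L2_of[OF square_integrable_add[OF square_integrable_L2_fun[of u] square_integrable_L2_fun[of v]]]
  by (simp add: L2_of_add)

lemma norm_L2_of: "square_integrable f \<Longrightarrow> (norm (L2_of f))\<^sup>2 = (\<integral>x. (cmod (f x))\<^sup>2 \<partial>lebesgue)"
proof -
  assume f: "square_integrable f"
  then have [measurable]: "f \<in> borel_measurable lebesgue" by (simp add: square_integrable_def)
  have "(\<integral>x. (cmod (L2_fun (L2_of f) x))\<^sup>2 \<partial>lebesgue) = (\<integral>x. (cmod (f x))\<^sup>2 \<partial>lebesgue)"
    using L2_fun_L2_of[OF f] by (intro integral_cong_AE) auto
  then show ?thesis by (simp add: norm_L2_eq)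
qed

lemma norm_L2_of_nn:
  "square_integrable f \<Longrightarrow> ennreal ((norm (L2_of f))\<^sup>2) = (\<integral>\<^sup>+x. ennreal ((cmod (f x))\<^sup>2) \<partial>lebesgue)"
  by (subst nn_integral_eq_integral) (auto simp: norm_L2_of square_integrable_def)

lemma square_integrable_iff_nn:
  "square_integrable f \<longleftrightarrow> f \<in> borel_measurable lebesgue \<and> (\<integral>\<^sup>+x. ennreal ((cmod (f x))\<^sup>2) \<partial>lebesgue) < \<infinity>"
  unfolding square_integrable_def integrable_iff_bounded by auto

lemma square_integrableI_nn:
  assumes "f \<in> borel_measurable lebesgue" "(\<integral>\<^sup>+x. ennreal ((cmod (f x))\<^sup>2) \<partial>lebesgue) \<le> ennreal (B\<^sup>2)" "0 \<le> B"
  shows "square_integrable f" "norm (L2_of f) \<le> B"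
proof -
  show f: "square_integrable f"
    using assms by (auto simp: square_integrable_iff_nn less_top[symmetric] top_unique)
  have "ennreal ((norm (L2_of f))\<^sup>2) \<le> ennreal (B\<^sup>2)" using norm_L2_of_nn[OF f] assms by simp
  then have "(norm (L2_of f))\<^sup>2 \<le> B\<^sup>2" by (simp add: ennreal_le_iff)
  then show "norm (L2_of f) \<le> B" using assms(3) power2_le_imp_le by blast
qed

lemma square_integrable_mono:
  assumes "square_integrable g" "f \<in> borel_measurable lebesgue"
    "AE x in lebesgue. cmod (f x) \<le> cmod (g x)"
  shows "square_integrable f" "norm (L2_of f) \<le> norm (L2_of g)"
proof -
  have "(\<integral>\<^sup>+x. ennreal ((cmod (f x))\<^sup>2) \<partial>lebesgue) \<le> (\<integral>\<^sup>+x. ennreal ((cmod (g x))\<^sup>2) \<partial>lebesgue)"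
    using assms(3) by (intro nn_integral_mono_AE) (auto elim!: eventually_mono intro!: ennreal_leI power_mono)
  then have *: "(\<integral>\<^sup>+x. ennreal ((cmod (f x))\<^sup>2) \<partial>lebesgue) \<le> ennreal ((norm (L2_of g))\<^sup>2)"
    using norm_L2_of_nn[OF assms(1)] by simp
  show "square_integrable f" "norm (L2_of f) \<le> norm (L2_of g)"
    using square_integrableI_nn[OF assms(2) *] by auto
qed

lemma inner_L2_of:
  assumes "square_integrable f" "square_integrable g"
  shows "inner (L2_of f) (L2_of g) = Re (\<integral>x. f x * cnj (g x) \<partial>lebesgue)"
proof -
  have [measurable]: "f \<in> borel_measurable lebesgue" "g \<in> borel_measurable lebesgue"
    using assms by (auto simp: square_integrable_def)
  have "inner (L2_of f) (L2_of g) = Re (\<integral>x. L2_fun (L2_of f) x * cnj (L2_fun (L2_of g) x) \<partial>lebesgue)"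
    by (simp add: inner_L2.rep_eq L2_fun_def)
  also have "(\<integral>x. L2_fun (L2_of f) x * cnj (L2_fun (L2_of g) x) \<partial>lebesgue) = (\<integral>x. f x * cnj (g x) \<partial>lebesgue)"
    using L2_fun_L2_of[OF assms(1)] L2_fun_L2_of[OF assms(2)]
    by (intro integral_cong_AE) auto
  finally show ?thesis .
qed

lemma L2_Fatou:
  assumes s: "\<And>n. square_integrable (s n)" and g [measurable]: "g \<in> borel_measurable lebesgue"
    and lim: "AE x in lebesgue. (\<lambda>n. s n x) \<longlonglongrightarrow> g x"
    and B: "\<forall>\<^sub>F n in sequentially. norm (L2_of (s n)) \<le> B"
  shows "square_integrable g" "norm (L2_of g) \<le> B"
proof -
  have [measurable]: "s n \<in> borel_measurable lebesgue" for n
    using s by (simp add: square_integrable_def)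
  have B0: "0 \<le> B" using B
    by (meson eventually_sequentially norm_ge_zero order_trans order_refl)
  have "(\<integral>\<^sup>+x. ennreal ((cmod (g x))\<^sup>2) \<partial>lebesgue)
      = (\<integral>\<^sup>+x. liminf (\<lambda>n. ennreal ((cmod (s n x))\<^sup>2)) \<partial>lebesgue)"
    using lim
  proof (intro nn_integral_cong_AE, elim eventually_mono)
    fix x assume "(\<lambda>n. s n x) \<longlonglongrightarrow> g x"
    then have "(\<lambda>n. ennreal ((cmod (s n x))\<^sup>2)) \<longlonglongrightarrow> ennreal ((cmod (g x))\<^sup>2)"
      by (intro tendsto_intros)
    then show "ennreal ((cmod (g x))\<^sup>2) = liminf (\<lambda>n. ennreal ((cmod (s n x))\<^sup>2))"
      by (metis lim_imp_Liminf trivial_limit_sequentially)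
  qed
  also have "\<dots> \<le> liminf (\<lambda>n. \<integral>\<^sup>+x. ennreal ((cmod (s n x))\<^sup>2) \<partial>lebesgue)"
    by (intro nn_integral_liminf) auto
  also have "\<dots> \<le> limsup (\<lambda>n. \<integral>\<^sup>+x. ennreal ((cmod (s n x))\<^sup>2) \<partial>lebesgue)"
    by (rule Liminf_le_Limsup) simp
  also have "\<dots> \<le> ennreal (B\<^sup>2)"
    using B by (intro Limsup_bounded) (auto elim!: eventually_mono simp flip: norm_L2_of_nn[OF s] intro!: ennreal_leI power_mono)
  finally have *: "(\<integral>\<^sup>+x. ennreal ((cmod (g x))\<^sup>2) \<partial>lebesgue) \<le> ennreal (B\<^sup>2)" .
  show "square_integrable g" "norm (L2_of g) \<le> B"
    using square_integrableI_nn[OF g * B0] by auto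
qed

lemma L2_dominated_convergence:
  assumes s: "\<And>n. s n \<in> borel_measurable lebesgue" and w: "square_integrable w"
    and lim: "AE x in lebesgue. (\<lambda>n. s n x) \<longlonglongrightarrow> 0"
    and bd: "\<And>n. AE x in lebesgue. cmod (s n x) \<le> cmod (w x)"
  shows "(\<lambda>n. L2_of (s n)) \<longlonglongrightarrow> 0"
proof -
  note [measurable] = s
  have [measurable]: "w \<in> borel_measurable lebesgue" using w by (simp add: square_integrable_def)
  have sq: "square_integrable (s n)" for n using square_integrable_mono(1)[OF w s bd] .
  have "(\<lambda>n. \<integral>x. (cmod (s n x))\<^sup>2 \<partial>lebesgue) \<longlonglongrightarrow> (\<integral>x. 0 \<partial>(lebesgue::'a measure))"
  proof (rule integral_dominated_convergence)
    show "integrable lebesgue (\<lambda>x. (cmod (w x))\<^sup>2)" using w by (simp add: square_integrable_def)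
    show "AE x in lebesgue. (\<lambda>n. (cmod (s n x))\<^sup>2) \<longlonglongrightarrow> 0"
      using lim by eventually_elim (auto intro!: tendsto_eq_intros)
    show "AE x in lebesgue. norm ((cmod (s n x))\<^sup>2) \<le> (cmod (w x))\<^sup>2" for n
      using bd[of n] by eventually_elim (auto intro!: power_mono)
  qed auto
  then have "(\<lambda>n. (norm (L2_of (s n)))\<^sup>2) \<longlonglongrightarrow> 0" by (simp add: norm_L2_of[OF sq])
  then have "(\<lambda>n. sqrt ((norm (L2_of (s n)))\<^sup>2)) \<longlonglongrightarrow> sqrt 0" by (intro tendsto_intros)
  then show ?thesis by (simp add: tendsto_norm_zero_iff)
qed

text \<open>
  Riesz and Fischer. Along a subsequence with \<open>|f\<^bsub>k+1\<^esub> - f\<^sub>k| \<le> 2\<^sup>-\<^sup>k\<close> the weighted sum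
  \<open>\<Sum>\<^sub>k 2\<^sup>k |f\<^bsub>k+1\<^esub>(x) - f\<^sub>k(x)|\<^sup>2\<close> has a finite integral, hence is finite almost everywhere;
  the increments then decay geometrically, so the subsequence converges pointwise, and Fatou's lemma
  upgrades this to convergence in norm.
\<close>

instance L2 :: (euclidean_space) complete_space
proof
  fix X :: "nat \<Rightarrow> 'a L2"
  assume "Cauchy X"
  then have "\<exists>N. \<forall>m\<ge>N. \<forall>n\<ge>N. dist (X m) (X n) < (1/2)^k" for k :: nat
    by (simp add: Cauchy_def)
  then obtain N where N: "\<And>k m n. m \<ge> N k \<Longrightarrow> n \<ge> N k \<Longrightarrow> dist (X m) (X n) < (1/2)^k"
    by metis
  (* The maximum makes the index r k late enough for all of the first k + 1 tolerances. *)
  define r where "r k = Max (N ` {..k})" for k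
  have rN: "N k \<le> r l" if "k \<le> l" for k l
    unfolding r_def using that by (intro Max_ge) auto
  define f where "f k = L2_fun (X (r k))" for k
  have f_sq [simp]: "square_integrable (f k)" for k by (simp add: f_def)
  have [measurable]: "f k \<in> borel_measurable lebesgue" for k by (simp add: f_def)
  have diff: "norm (L2_of (\<lambda>x. f l x - f k x)) \<le> (1/2)^k" if "k \<le> l" for k l
    using N[OF rN rN, of k l k] that by (simp add: L2_of_diff f_def dist_norm less_imp_le)
  define d where "d k x = f (Suc k) x - f k x" for k x
  have d_sq: "square_integrable (d k)" for k unfolding d_def[abs_def] by (intro square_integrable_diff) auto
  have [measurable]: "d k \<in> borel_measurable lebesgue" for k unfolding d_def[abs_def] by measurable
  have dk: "(\<integral>\<^sup>+x. ennreal (2^k * (cmod (d k x))\<^sup>2) \<partial>lebesgue) \<le> ennreal ((1/2)^k)" for k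
  proof -
    have "norm (L2_of (d k)) \<le> (1/2)^k" using diff[of k "Suc k"] by (simp add: d_def[abs_def])
    then have "(norm (L2_of (d k)))\<^sup>2 \<le> ((1/2)^k)\<^sup>2" by (intro power_mono) auto
    then have "2^k * (norm (L2_of (d k)))\<^sup>2 \<le> (1/2)^k"
      by (simp add: power2_eq_square power_one_over field_simps)
    then have "ennreal (2^k) * ennreal ((norm (L2_of (d k)))\<^sup>2) \<le> ennreal ((1/2)^k)"
      by (simp add: ennreal_mult[symmetric] ennreal_le_iff)
    then show ?thesis
      by (simp add: ennreal_mult norm_L2_of_nn[OF d_sq] nn_integral_cmult)
  qed
  have "(\<integral>\<^sup>+x. (\<Sum>k. ennreal (2^k * (cmod (d k x))\<^sup>2)) \<partial>lebesgue)
      = (\<Sum>k. \<integral>\<^sup>+x. ennreal (2^k * (cmod (d k x))\<^sup>2) \<partial>lebesgue)"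
    by (intro nn_integral_suminf) auto
  also have "\<dots> \<le> (\<Sum>k. ennreal ((1/2)^k))" by (intro suminf_le dk) auto
  also have "\<dots> = ennreal (\<Sum>k. (1/2)^k)" by (rule suminf_ennreal2) (auto intro!: summable_geometric)
  also have "\<dots> < \<infinity>" by simp
  finally have "AE x in lebesgue. (\<Sum>k. ennreal (2^k * (cmod (d k x))\<^sup>2)) \<noteq> \<infinity>"
    by (intro nn_integral_PInf_AE) auto
  then have conv: "AE x in lebesgue. convergent (\<lambda>k. f k x)"
  proof eventually_elim
    fix x assume "(\<Sum>k. ennreal (2^k * (cmod (d k x))\<^sup>2)) \<noteq> \<infinity>"
    define C where "C = enn2real (\<Sum>k. ennreal (2^k * (cmod (d k x))\<^sup>2))"
    have C: "0 \<le> C" "(\<Sum>k. ennreal (2^k * (cmod (d k x))\<^sup>2)) = ennreal C"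
      using \<open>(\<Sum>k. ennreal (2^k * (cmod (d k x))\<^sup>2)) \<noteq> \<infinity>\<close>
      by (simp_all add: C_def less_top)
    have "ennreal (2^k * (cmod (d k x))\<^sup>2) \<le> ennreal C" for k
      using sum_le_suminf[of "\<lambda>k. ennreal (2^k * (cmod (d k x))\<^sup>2)" "{k}"] C by simp
    then have "2^k * (cmod (d k x))\<^sup>2 \<le> C" for k using C by (simp add: ennreal_le_iff)
    then have "(cmod (d k x))\<^sup>2 \<le> C * (1/2)^k" for k by (simp add: power_one_over field_simps)
    then have "cmod (d k x) \<le> sqrt (C * (1/2)^k)" for k using real_le_rsqrt by blast
    then have "cmod (d k x) \<le> sqrt C * (sqrt (1/2))^k" for k
      by (simp add: real_sqrt_mult real_sqrt_power)
    moreover have "summable (\<lambda>k. sqrt C * (sqrt (1/2))^k)"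
      by (intro summable_mult summable_geometric) simp
    ultimately have "summable (\<lambda>k. d k x)" by (rule summable_comparison_test'[rotated])
    then have "convergent (\<lambda>n. f 0 x + (\<Sum>k<n. d k x))"
      by (intro convergent_add convergent_const) (simp add: summable_iff_convergent)
    moreover have "f 0 x + (\<Sum>k<n. d k x) = f n x" for n
      unfolding d_def by (subst sum_lessThan_telescope) simp
    ultimately show "convergent (\<lambda>k. f k x)" by simp
  qed
  define g where "g x = lim (\<lambda>k. f k x)" for x
  have g_meas [measurable]: "g \<in> borel_measurable lebesgue" unfolding g_def[abs_def] by measurable
  have glim: "AE x in lebesgue. (\<lambda>k. f k x) \<longlonglongrightarrow> g x"
    using conv by eventually_elim (simp add: g_def convergent_LIMSEQ_iff)
  have gk: "square_integrable (\<lambda>x. g x - f k x)" "norm (L2_of (\<lambda>x. g x - f k x)) \<le> (1/2)^k" for k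
  proof -
    have "AE x in lebesgue. (\<lambda>l. f l x - f k x) \<longlonglongrightarrow> g x - f k x"
      using glim by eventually_elim (intro tendsto_intros)
    note lim = this
    have sq: "square_integrable (\<lambda>x. f l x - f k x)" for l by (intro square_integrable_diff f_sq)
    have ev: "\<forall>\<^sub>F l in sequentially. norm (L2_of (\<lambda>x. f l x - f k x)) \<le> (1/2)^k"
      using diff[of k] unfolding eventually_sequentially by blast
    have m: "(\<lambda>x. g x - f k x) \<in> borel_measurable lebesgue" by measurable
    show "square_integrable (\<lambda>x. g x - f k x)" "norm (L2_of (\<lambda>x. g x - f k x)) \<le> (1/2)^k"
      using L2_Fatou[OF sq m lim ev] by blast+
  qed
  have g_sq: "square_integrable g" using square_integrable_add[OF gk(1) f_sq, of 0 0] by simp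
  have *: "norm (L2_of g - X (r k)) \<le> (1/2)^k" for k
    using gk(2)[of k] by (simp add: L2_of_diff g_sq) (simp add: f_def)
  have "X \<longlonglongrightarrow> L2_of g"
  proof (rule metric_LIMSEQ_I)
    fix e :: real assume "e > 0"
    then obtain k where k: "(1/2)^k < e / 2" using real_arch_pow_inv[of "e/2" "1/2"] by auto
    have "dist (X n) (L2_of g) < e" if "n \<ge> N k" for n
    proof -
      have "dist (X n) (L2_of g) \<le> dist (X n) (X (r k)) + dist (X (r k)) (L2_of g)" by (rule dist_triangle)
      also have "\<dots> < (1/2)^k + (1/2)^k"
        using N[OF that rN[of k k]] *[of k] by (simp add: dist_norm norm_minus_commute)
      finally show ?thesis using k by simp
    qed
    then show "\<exists>no. \<forall>n\<ge>no. dist (X n) (L2_of g) < e" by blast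
  qed
  then show "convergent X" by (auto simp: convergent_def)
qed

instance L2 :: (euclidean_space) banach ..

definition Mul :: "('a::euclidean_space \<Rightarrow> complex) \<Rightarrow> 'a L2 \<Rightarrow> 'a L2" where
  "Mul m u = L2_of (\<lambda>x. m x * L2_fun u x)"

lemma scaleC_L2_Mul: "scaleC_L2 c = Mul (\<lambda>_. c)"
  by (auto simp: scaleC_L2_def Mul_def)

lemma indicator_L2_Mul: "indicator_L2 \<omega> = Mul (indicator \<omega>)"
  by (auto simp: indicator_L2_def Mul_def)

text \<open>
  Boundedness is required everywhere, not just almost everywhere: all symbols below are concrete
  functions, and this keeps the algebra of multiplication operators free of exceptional sets.
\<close>

definition bounded_symbol :: "('a::euclidean_space \<Rightarrow> complex) \<Rightarrow> bool" where
  "bounded_symbol m \<longleftrightarrow> m \<in> borel_measurable lebesgue \<and> (\<exists>C. \<forall>x. cmod (m x) \<le> C)"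

lemma bounded_symbol_measurable [measurable_dest]: "bounded_symbol m \<Longrightarrow> m \<in> borel_measurable lebesgue"
  by (simp add: bounded_symbol_def)

lemma bounded_symbol_const [simp]: "bounded_symbol (\<lambda>_. c)"
  by (auto simp: bounded_symbol_def)

lemma bounded_symbol_indicator [simp]: "A \<in> sets lebesgue \<Longrightarrow> bounded_symbol (indicator A)"
  by (auto simp: bounded_symbol_def indicator_def intro!: exI[of _ 1])

lemma bounded_symbol_mult: "bounded_symbol m \<Longrightarrow> bounded_symbol m' \<Longrightarrow> bounded_symbol (\<lambda>x. m x * m' x)"
  unfolding bounded_symbol_def
proof safe
  fix C C' assume "\<forall>x. cmod (m x) \<le> C" "\<forall>x. cmod (m' x) \<le> C'"
  then show "\<exists>C. \<forall>x. cmod (m x * m' x) \<le> C"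
    by (intro exI[of _ "C * C'"]) (auto simp: norm_mult intro!: mult_mono intro: order_trans[OF norm_ge_zero])
qed auto

lemma square_integrable_Mul:
  "bounded_symbol m \<Longrightarrow> square_integrable f \<Longrightarrow> square_integrable (\<lambda>x. m x * f x)"
  unfolding bounded_symbol_def by (blast intro: square_integrable_mult_bounded)

lemma Mul_L2_of:
  assumes "bounded_symbol m" "square_integrable f"
  shows "Mul m (L2_of f) = L2_of (\<lambda>x. m x * f x)"
  unfolding Mul_def using assms L2_fun_L2_of[OF assms(2)]
  by (intro L2_of_cong_AE square_integrable_Mul) auto

lemma L2_fun_Mul:
  assumes "bounded_symbol m"
  shows "AE x in lebesgue. L2_fun (Mul m u) x = m x * L2_fun u x"
  unfolding Mul_def by (intro L2_fun_L2_of square_integrable_Mul assms) simp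

lemma Mul_add: "bounded_symbol m \<Longrightarrow> Mul m (u + v) = Mul m u + Mul m v"
  using Mul_L2_of[of m "\<lambda>x. L2_fun u x + L2_fun v x"]
  by (simp add: L2_of_add square_integrable_add distrib_left square_integrable_Mul Mul_def)

lemma Mul_scaleR: "bounded_symbol m \<Longrightarrow> Mul m (r *\<^sub>R u) = r *\<^sub>R Mul m u"
  using Mul_L2_of[of m "\<lambda>x. complex_of_real r * L2_fun u x"]
  by (simp add: L2_of_scaleR square_integrable_cmult mult.left_commute square_integrable_Mul Mul_def)

lemma Mul_Mul: "bounded_symbol m \<Longrightarrow> bounded_symbol m' \<Longrightarrow> Mul m (Mul m' u) = Mul (\<lambda>x. m x * m' x) u"
  using Mul_L2_of[of m "\<lambda>x. m' x * L2_fun u x"]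
  by (simp add: Mul_def square_integrable_Mul mult.assoc)

lemma Mul_commute: "bounded_symbol m \<Longrightarrow> bounded_symbol m' \<Longrightarrow> Mul m (Mul m' u) = Mul m' (Mul m u)"
  by (simp add: Mul_Mul mult.commute)

lemma norm_Mul_le:
  assumes "bounded_symbol m" "AE x in lebesgue. L2_fun u x \<noteq> 0 \<longrightarrow> cmod (m x) \<le> C" "0 \<le> C"
  shows "norm (Mul m u) \<le> C * norm u"
proof -
  have "AE x in lebesgue. cmod (m x * L2_fun u x) \<le> cmod (complex_of_real C * L2_fun u x)"
    using assms(2)
  proof eventually_elim
    case (elim x)
    then show ?case using assms(3) by (cases "L2_fun u x = 0") (auto simp: norm_mult intro!: mult_right_mono)
  qed
  moreover have "(\<lambda>x. m x * L2_fun u x) \<in> borel_measurable lebesgue"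
    using assms(1) by measurable
  ultimately have "norm (L2_of (\<lambda>x. m x * L2_fun u x)) \<le> norm (L2_of (\<lambda>x. complex_of_real C * L2_fun u x))"
    by (intro square_integrable_mono(2) square_integrable_cmult square_integrable_L2_fun)
  then show ?thesis using assms by (simp add: Mul_def L2_of_scaleR)
qed

lemma bounded_clinear_L2_Mul:
  assumes "bounded_symbol m"
  shows "bounded_clinear_L2 (Mul m)"
proof -
  obtain C where C: "\<And>x. cmod (m x) \<le> C" using assms by (auto simp: bounded_symbol_def)
  have "0 \<le> C" using C[of undefined] norm_ge_zero order_trans by blast
  then have "bounded_linear (Mul m)"
    using norm_Mul_le[OF assms, of _ C] C
    by (intro bounded_linear_intro[where K=C]) (auto simp: Mul_add Mul_scaleR assms mult.commute)
  then show ?thesis using assms by (simp add: bounded_clinear_L2_def scaleC_L2_Mul Mul_commute)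
qed

lemma bounded_linear_Mul: "bounded_symbol m \<Longrightarrow> bounded_linear (Mul m)"
  using bounded_clinear_L2_Mul bounded_clinear_L2_def by blast

lemma inner_Mul:
  assumes "bounded_symbol m"
  shows "inner (Mul m u) v = inner u (Mul (\<lambda>x. cnj (m x)) v)"
proof -
  have m': "bounded_symbol (\<lambda>x. cnj (m x))" using assms by (auto simp: bounded_symbol_def)
  have "inner (Mul m u) (L2_of (L2_fun v)) = inner (L2_of (L2_fun u)) (Mul (\<lambda>x. cnj (m x)) v)"
    unfolding Mul_def using assms m'
    by (subst (1 2) inner_L2_of) (auto simp: square_integrable_Mul mult_ac)
  then show ?thesis by simp
qed

lemma bounded_clinear_L2_compose:
  "bounded_clinear_L2 A \<Longrightarrow> bounded_clinear_L2 B \<Longrightarrow> bounded_clinear_L2 (\<lambda>u. A (B u))"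
  by (auto simp: bounded_clinear_L2_def intro: bounded_linear_compose)

lemma scaleC_L2_add: "scaleC_L2 c (u + v) = scaleC_L2 c u + scaleC_L2 c v"
  by (simp add: scaleC_L2_Mul Mul_add)

lemma scaleC_L2_diff: "scaleC_L2 c (u - v) = scaleC_L2 c u - scaleC_L2 c v"
  using linear_diff[OF bounded_linear.linear[OF bounded_linear_Mul[OF bounded_symbol_const]]]
  by (simp add: scaleC_L2_Mul)

lemma bounded_clinear_L2_add:
  "bounded_clinear_L2 A \<Longrightarrow> bounded_clinear_L2 B \<Longrightarrow> bounded_clinear_L2 (\<lambda>u. A u + B u)"
  by (auto simp: bounded_clinear_L2_def scaleC_L2_add intro: bounded_linear_add)

lemma bounded_clinear_L2_diff:
  "bounded_clinear_L2 A \<Longrightarrow> bounded_clinear_L2 B \<Longrightarrow> bounded_clinear_L2 (\<lambda>u. A u - B u)"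
  by (auto simp: bounded_clinear_L2_def scaleC_L2_diff intro: bounded_linear_sub)

lemma bounded_clinear_L2_id: "bounded_clinear_L2 (\<lambda>u. u)"
  by (auto simp: bounded_clinear_L2_def intro: bounded_linear_ident)

section \<open>Plancherel's theorem\<close>

abbreviation wave :: "'a::euclidean_space \<Rightarrow> 'a \<Rightarrow> complex" where
  "wave x \<xi> \<equiv> exp (- \<i> * complex_of_real (x \<bullet> \<xi>))"

definition FT :: "('a::euclidean_space \<Rightarrow> complex) \<Rightarrow> 'a \<Rightarrow> complex" where
  "FT f \<xi> = (\<integral>x. wave x \<xi> * f x \<partial>lebesgue)"

lemma cmod_exp_minus_i [simp]: "cmod (exp (- (\<i> * complex_of_real t))) = 1"
  by (simp add: norm_exp_eq_Re)

text \<open>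
  Fubini's theorem for the product measure needs Borel functions, whereas elements of \<open>L2\<close> are only
  Lebesgue measurable; this passes from one to the other.
\<close>

lemma borel_representative:
  fixes f :: "'a::euclidean_space \<Rightarrow> complex"
  assumes "f \<in> borel_measurable lebesgue"
  obtains g where "g \<in> borel_measurable borel" "AE x in lebesgue. f x = g x"
proof -
  have "(\<lambda>x. Re (f x)) \<in> borel_measurable (completion lborel)" "(\<lambda>x. Im (f x)) \<in> borel_measurable (completion lborel)"
    using assms by simp_all
  from this[THEN completion_ex_borel_measurable_real] obtain a b where
    ab: "a \<in> borel_measurable borel" "b \<in> borel_measurable borel"
      "AE x in lborel. Re (f x) = a x" "AE x in lborel. Im (f x) = b x" by auto
  note [measurable] = ab(1,2)
  show ?thesis
  proof (rule that[of "\<lambda>x. Complex (a x) (b x)"])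
    have "(\<lambda>x. complex_of_real (a x) + \<i> * complex_of_real (b x)) \<in> borel_measurable borel" by measurable
    then show "(\<lambda>x. Complex (a x) (b x)) \<in> borel_measurable borel" by (simp add: Complex_eq)
    have "AE x in lborel. f x = Complex (a x) (b x)"
      using ab(3,4) by eventually_elim (simp add: complex_eq_iff)
    then show "AE x in lebesgue. f x = Complex (a x) (b x)" by (rule AE_completion)
  qed
qed

lemma lebesgue_measurable_if_borel [simp]:
  "f \<in> borel_measurable borel \<Longrightarrow> f \<in> borel_measurable lebesgue"
  by (rule measurable_completion) simp

lemma integrable_mult_bounded:
  fixes f g :: "'a \<Rightarrow> complex"
  assumes "integrable M f" "g \<in> borel_measurable M" "\<And>x. cmod (g x) \<le> C"
  shows "integrable M (\<lambda>x. g x * f x)"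
proof (rule Bochner_Integration.integrable_bound)
  show "integrable M (\<lambda>x. C * cmod (f x))" using assms(1) by simp
  have "0 \<le> C" using assms(3)[of undefined] norm_ge_zero order_trans by blast
  then show "AE x in M. norm (g x * f x) \<le> norm (C * cmod (f x))"
    using assms(3) by (intro AE_I2) (auto simp: norm_mult intro!: mult_right_mono)
  show "(\<lambda>x. g x * f x) \<in> borel_measurable M"
    using borel_measurable_integrable[OF assms(1)] assms(2) by measurable
qed

lemma character_measurable [measurable]:
  "(\<lambda>x. wave x \<xi>) \<in> borel_measurable borel"
  by (intro borel_measurable_continuous_onI continuous_intros)

lemma integrable_FT_integrand:
  fixes f :: "'a::euclidean_space \<Rightarrow> complex"
  assumes "integrable lebesgue f"
  shows "integrable lebesgue (\<lambda>x. wave x \<xi> * f x)"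
  by (rule integrable_mult_bounded[OF assms, where C=1]) auto

lemma cmod_FT_le: "integrable lebesgue (f :: 'a::euclidean_space \<Rightarrow> complex) \<Longrightarrow> cmod (FT f \<xi>) \<le> (\<integral>x. cmod (f x) \<partial>lebesgue)"
  unfolding FT_def by (rule order_trans[OF integral_norm_bound]) (simp add: norm_mult)

lemma FT_cong_AE:
  fixes f g :: "'a::euclidean_space \<Rightarrow> complex"
  assumes "f \<in> borel_measurable lebesgue" "g \<in> borel_measurable lebesgue" "AE x in lebesgue. f x = g x"
  shows "FT f = FT g"
proof
  fix \<xi> :: 'a
  have [measurable]: "(\<lambda>x. wave x \<xi>) \<in> borel_measurable lebesgue" by simp
  note [measurable] = assms(1,2)
  show "FT f \<xi> = FT g \<xi>"
    unfolding FT_def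
  proof (intro integral_cong_AE)
    show "AE x in lebesgue. wave x \<xi> * f x = wave x \<xi> * g x"
      using assms(3) by eventually_elim simp
  qed measurable
qed

lemma FT_borel: "(f :: 'a::euclidean_space \<Rightarrow> complex) \<in> borel_measurable borel \<Longrightarrow>
  FT f \<xi> = (\<integral>x. wave x \<xi> * f x \<partial>lborel)"
  unfolding FT_def by (rule integral_completion) measurable

lemma FT_measurable_borel:
  fixes f :: "'a::euclidean_space \<Rightarrow> complex"
  assumes [measurable]: "f \<in> borel_measurable borel"
  shows "FT f \<in> borel_measurable borel"
proof -
  have "(\<lambda>\<xi>. \<integral>x. wave x \<xi> * f x \<partial>lborel) \<in> borel_measurable borel"
    by measurable
  then show ?thesis by (simp add: FT_borel[OF assms, abs_def])
qed

lemma FT_measurable [measurable]: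
  fixes f :: "'a::euclidean_space \<Rightarrow> complex"
  assumes "f \<in> borel_measurable lebesgue"
  shows "FT f \<in> borel_measurable borel"
proof -
  obtain g where g: "g \<in> borel_measurable borel" "AE x in lebesgue. f x = g x"
    using borel_representative[OF assms] .
  then have "FT f = FT g" using assms by (intro FT_cong_AE) auto
  then show ?thesis using FT_measurable_borel[OF g(1)] by simp
qed

lemma FT_add: "integrable lebesgue (f :: 'a::euclidean_space \<Rightarrow> complex) \<Longrightarrow> integrable lebesgue g \<Longrightarrow> FT (\<lambda>x. f x + g x) \<xi> = FT f \<xi> + FT g \<xi>"
  using integrable_FT_integrand[of f \<xi>] integrable_FT_integrand[of g \<xi>]
  by (simp add: FT_def distrib_left)

lemma FT_diff: "integrable lebesgue (f :: 'a::euclidean_space \<Rightarrow> complex) \<Longrightarrow> integrable lebesgue g \<Longrightarrow> FT (\<lambda>x. f x - g x) \<xi> = FT f \<xi> - FT g \<xi>"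
  using integrable_FT_integrand[of f \<xi>] integrable_FT_integrand[of g \<xi>]
  by (simp add: FT_def right_diff_distrib)

lemma FT_cmult: "FT (\<lambda>x. c * f x) \<xi> = c * FT f \<xi>"
proof -
  have "wave x \<xi> * (c * f x) = c * (wave x \<xi> * f x)" for x
    by (rule mult.left_commute)
  then show ?thesis unfolding FT_def by (simp only: integral_mult_right_zero)
qed

subsection \<open>Gaussians\<close>

definition gauss :: "'a::euclidean_space \<Rightarrow> real" where
  "gauss x = exp (- (norm x)\<^sup>2 / 2)"

lemma gauss_measurable [measurable]: "gauss \<in> borel_measurable borel"
  unfolding gauss_def[abs_def] by measurable

lemma gauss_pos: "0 < gauss x"
  by (simp add: gauss_def)

lemma gauss_FT_1d:
  shows "integrable lborel (\<lambda>x::real. exp (- \<i> * complex_of_real (x * t)) * complex_of_real (exp (- x\<^sup>2 / 2)))" (is ?I)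
    and "(\<integral>x. exp (- \<i> * complex_of_real (x * t)) * complex_of_real (exp (- x\<^sup>2 / 2)) \<partial>lborel)
      = complex_of_real (sqrt (2 * pi) * exp (- t\<^sup>2 / 2))" (is ?E)
proof -
  have eq: "complex_of_real (exp (- x\<^sup>2 / 2)) = complex_of_real (sqrt (2 * pi)) * complex_of_real (std_normal_density x)" for x
  proof -
    have "exp (- x\<^sup>2 / 2) = sqrt (2 * pi) * std_normal_density x" by (simp add: std_normal_density_def)
    then show ?thesis by (metis of_real_mult)
  qed
  have int: "integrable lborel (\<lambda>x. complex_of_real (std_normal_density x))"
    by (simp add: complex_of_real_integrable_eq)
  have "integrable lborel (\<lambda>x. (complex_of_real (sqrt (2 * pi)) * exp (- \<i> * complex_of_real (x * t))) * complex_of_real (std_normal_density x))"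
    by (rule integrable_mult_bounded[OF int, where C="sqrt (2*pi)"]) (auto simp: norm_mult intro!: borel_measurable_continuous_onI continuous_intros)
  then show ?I unfolding eq by (simp add: mult_ac)
  have "char std_normal_distribution (- t) = (\<integral>x. exp (- \<i> * complex_of_real (x * t)) * complex_of_real (std_normal_density x) \<partial>lborel)"
    unfolding char_def
    by (subst integral_density) (auto simp: scaleR_conv_of_real mult_ac intro!: Bochner_Integration.integral_cong borel_measurable_continuous_onI continuous_intros)
  then have "(\<integral>x. exp (- \<i> * complex_of_real (x * t)) * complex_of_real (std_normal_density x) \<partial>lborel) = complex_of_real (exp (- t\<^sup>2 / 2))"
    by (simp add: char_std_normal_distribution)
  then have "complex_of_real (sqrt (2 * pi)) * (\<integral>x. exp (- \<i> * complex_of_real (x * t)) * complex_of_real (std_normal_density x) \<partial>lborel)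
     = complex_of_real (sqrt (2 * pi) * exp (- t\<^sup>2 / 2))" by simp
  then show ?E unfolding eq
    by (subst (asm) integral_mult_right_zero[symmetric]) (simp add: mult_ac)
qed

text \<open>
  Both the Gaussian and the plane wave factor over the coordinates, so the transform is a product of
  one-dimensional ones, that is, of values of the characteristic function of the normal distribution.
\<close>

lemma gauss_FT:
  fixes z :: "'a::euclidean_space"
  shows "integrable lborel (\<lambda>x. wave x z * complex_of_real (gauss x))" (is ?I)
    and "(\<integral>x. wave x z * complex_of_real (gauss x) \<partial>lborel)
      = complex_of_real (sqrt (2 * pi) ^ DIM('a) * gauss z)" (is ?E)
proof -
  interpret product_sigma_finite "\<lambda>_::'a. lborel :: real measure" by standard
  define e where "e b x = exp (- \<i> * complex_of_real (x * (z \<bullet> b))) * complex_of_real (exp (- x\<^sup>2 / 2))" for b x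
  have e_int: "integrable lborel (e b)" for b unfolding e_def[abs_def] by (rule gauss_FT_1d)
  have gauss_prod: "gauss x = (\<Prod>b\<in>Basis. exp (- (x \<bullet> b)\<^sup>2 / 2))" for x :: 'a
  proof -
    have "- (norm x)\<^sup>2 / 2 = (\<Sum>b\<in>Basis. - (x \<bullet> b)\<^sup>2 / 2)"
      unfolding power2_norm_eq_inner euclidean_inner[of x x]
      by (simp add: sum_divide_distrib sum_negf power2_eq_square)
    then show ?thesis by (simp add: gauss_def exp_sum)
  qed
  have prod: "wave x z * complex_of_real (gauss x) = (\<Prod>b\<in>Basis. e b (x \<bullet> b))" for x
  proof -
    have g: "complex_of_real (gauss x) = (\<Prod>b\<in>Basis. complex_of_real (exp (- (x \<bullet> b)\<^sup>2 / 2)))"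
      unfolding gauss_prod by (rule of_real_prod)
    have c: "wave x z = (\<Prod>b\<in>Basis. exp (- \<i> * complex_of_real ((x \<bullet> b) * (z \<bullet> b))))"
      unfolding euclidean_inner[of x z] by (simp add: exp_sum[symmetric] sum_distrib_left sum_negf)
    show ?thesis unfolding e_def prod.distrib g c ..
  qed
  let ?T = "\<lambda>f. \<Sum>b\<in>Basis. f b *\<^sub>R b :: 'a"
  have T: "?T \<in> measurable (\<Pi>\<^sub>M b\<in>Basis. lborel) borel" by measurable
  have prodT: "exp (- \<i> * complex_of_real (?T f \<bullet> z)) * complex_of_real (gauss (?T f)) = (\<Prod>b\<in>Basis. e b (f b))" for f
    unfolding prod by (intro prod.cong) (auto simp: inner_sum_left inner_Basis if_distrib sum.If_cases cong: if_cong)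
  have meas: "(\<lambda>x. wave x z * complex_of_real (gauss x)) \<in> borel_measurable borel"
    by measurable
  show ?I
    unfolding lborel_eq[where 'a='a] by (subst integrable_distr_eq[OF T meas], unfold prodT) (intro product_integrable_prod e_int, simp)
  have "(\<integral>x. wave x z * complex_of_real (gauss x) \<partial>lborel) = (\<Prod>b\<in>Basis. \<integral>x. e b x \<partial>lborel)"
    unfolding lborel_eq[where 'a='a] by (subst integral_distr[OF T meas], unfold prodT) (intro product_integral_prod e_int, simp)
  also have "\<dots> = (\<Prod>b\<in>Basis. complex_of_real (sqrt (2 * pi) * exp (- (z \<bullet> b)\<^sup>2 / 2)))"
    unfolding e_def by (simp only: gauss_FT_1d)
  also have "\<dots> = complex_of_real (sqrt (2 * pi) ^ DIM('a) * gauss z)"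
    by (simp add: gauss_prod prod.distrib)
  finally show ?E .
qed

lemma integrable_gauss: "integrable lborel (gauss :: 'a::euclidean_space \<Rightarrow> real)"
  using gauss_FT(1)[of 0] by (simp add: complex_of_real_integrable_eq)

lemma integral_gauss: "(\<integral>x. gauss (x::'a::euclidean_space) \<partial>lborel) = sqrt (2 * pi) ^ DIM('a)"
proof -
  have "complex_of_real (\<integral>x. gauss (x::'a) \<partial>lborel) = complex_of_real (sqrt (2 * pi) ^ DIM('a))"
    using gauss_FT(2)[of "0::'a"] by (simp add: gauss_def)
  then show ?thesis by (simp only: of_real_eq_iff)
qed

lemma lborel_integral_scale:
  fixes f :: "'a::euclidean_space \<Rightarrow> complex"
  assumes [measurable]: "f \<in> borel_measurable borel" and c: "0 < c"
  shows "(\<integral>x. f x \<partial>lborel) = complex_of_real (c ^ DIM('a)) * (\<integral>x. f (c *\<^sub>R x) \<partial>lborel)"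
proof -
  have "(\<integral>x. f x \<partial>lborel) = (\<integral>x. f x \<partial>density (distr lborel borel (\<lambda>x. 0 + c *\<^sub>R x)) (\<lambda>_. ennreal (\<bar>c\<bar>^DIM('a))))"
    using lborel_affine[of c "0::'a"] c by simp
  also have "\<dots> = (\<integral>x. (\<bar>c\<bar>^DIM('a)) *\<^sub>R f x \<partial>distr lborel borel (\<lambda>x. 0 + c *\<^sub>R x))"
    by (rule integral_density) auto
  also have "\<dots> = (\<integral>x. (\<bar>c\<bar>^DIM('a)) *\<^sub>R f (c *\<^sub>R x) \<partial>lborel)"
    by (subst integral_distr) auto
  finally show ?thesis using c by (simp add: scaleR_conv_of_real)
qed

lemma gauss_FT_scaled:
  fixes z :: "'a::euclidean_space"
  assumes "0 < \<epsilon>"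
  shows "(\<integral>\<xi>. wave \<xi> z * complex_of_real (gauss (\<epsilon> *\<^sub>R \<xi>)) \<partial>lborel)
    = complex_of_real ((1 / \<epsilon>) ^ DIM('a) * sqrt (2 * pi) ^ DIM('a) * gauss ((1 / \<epsilon>) *\<^sub>R z))"
proof -
  have "(\<integral>\<xi>. wave \<xi> z * complex_of_real (gauss (\<epsilon> *\<^sub>R \<xi>)) \<partial>lborel)
    = complex_of_real ((1 / \<epsilon>) ^ DIM('a)) * (\<integral>\<xi>. exp (- \<i> * complex_of_real (\<xi> \<bullet> ((1 / \<epsilon>) *\<^sub>R z))) * complex_of_real (gauss \<xi>) \<partial>lborel)"
    using assms by (subst lborel_integral_scale[where c="1 / \<epsilon>"]) auto
  then show ?thesis unfolding gauss_FT by simp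
qed

lemma integrable_gauss_scaled:
  assumes "0 < \<epsilon>"
  shows "integrable lborel (\<lambda>x::'a::euclidean_space. gauss (\<epsilon> *\<^sub>R x))"
proof -
  have "integrable (density (distr lborel borel (\<lambda>x::'a. 0 + \<epsilon> *\<^sub>R x)) (\<lambda>_. ennreal (\<bar>\<epsilon>\<bar>^DIM('a)))) gauss"
    using lborel_affine[of \<epsilon> "0::'a"] assms integrable_gauss[where 'a='a] by simp
  then have "integrable (distr lborel borel (\<lambda>x::'a. 0 + \<epsilon> *\<^sub>R x)) (\<lambda>x. (\<bar>\<epsilon>\<bar>^DIM('a)) *\<^sub>R gauss x)"
    by (subst (asm) integrable_density) auto
  then have "integrable lborel (\<lambda>x::'a. (\<bar>\<epsilon>\<bar>^DIM('a)) *\<^sub>R gauss (\<epsilon> *\<^sub>R x))"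
    by (subst (asm) integrable_distr_eq) auto
  then show ?thesis using assms by simp
qed

subsection \<open>Continuity of translations\<close>

lemma lborel_integral_translate:
  fixes f :: "'a::euclidean_space \<Rightarrow> 'b::{banach, second_countable_topology}"
  assumes [measurable]: "f \<in> borel_measurable borel"
  shows "(\<integral>x. f (x + h) \<partial>lborel) = (\<integral>x. f x \<partial>lborel)"
    and "integrable lborel (\<lambda>x. f (x + h)) \<longleftrightarrow> integrable lborel f"
proof -
  show "(\<integral>x. f (x + h) \<partial>lborel) = (\<integral>x. f x \<partial>lborel)"
    by (subst (2) lborel_distr_plus[symmetric, of h]) (simp add: integral_distr add.commute)
  show "integrable lborel (\<lambda>x. f (x + h)) \<longleftrightarrow> integrable lborel f"
    by (subst (2) lborel_distr_plus[symmetric, of h]) (simp add: integrable_distr_eq add.commute)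
qed

text \<open>
  If \<open>x \<in> U\<close> then \<open>x + h\<^sub>k \<in> U\<close> eventually,
  so the positive part of \<open>1\<^sub>U(x) - 1\<^sub>U(x + h\<^sub>k)\<close> tends to \<open>0\<close> under the integral, and the
  negative part has the same integral because translations preserve measure.
\<close>

lemma translation_indicator_open:
  fixes U :: "'a::euclidean_space set"
  assumes U: "open U" "emeasure lborel U < \<infinity>" and h: "h \<longlonglongrightarrow> 0"
  shows "(\<lambda>k. \<integral>y. \<bar>indicator U (y + h k) - indicator U y\<bar> \<partial>lborel) \<longlonglongrightarrow> (0::real)"
proof -
  have [measurable]: "U \<in> sets borel" using U by simp
  have int: "integrable lborel (indicator U :: 'a \<Rightarrow> real)" using U by simp
  have int': "integrable lborel (\<lambda>y. indicator U (y + h k) :: real)" for k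
    using int by (subst lborel_integral_translate) auto
  define p where "p k y = max 0 (indicator U y - indicator U (y + h k) :: real)" for k y
  have "(\<lambda>k. \<integral>y. p k y \<partial>lborel) \<longlonglongrightarrow> (\<integral>y. 0 \<partial>(lborel :: 'a measure))"
  proof (rule integral_dominated_convergence[where w="indicator U"])
    show "AE x in lborel. (\<lambda>k. p k x) \<longlonglongrightarrow> 0"
    proof (intro AE_I2)
      fix x
      show "(\<lambda>k. p k x) \<longlonglongrightarrow> 0"
      proof (cases "x \<in> U")
        case True
        have "(\<lambda>k. x + h k) \<longlonglongrightarrow> x + 0" by (intro tendsto_intros h)
        then have "\<forall>\<^sub>F k in sequentially. x + h k \<in> U" using U True by (simp add: topological_tendstoD)
        then have "\<forall>\<^sub>F k in sequentially. p k x = 0"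
          by (rule eventually_mono) (use True in \<open>simp add: p_def\<close>)
        then show ?thesis by (rule tendsto_eventually)
      qed (simp add: p_def)
    qed
  qed (use int in \<open>auto simp: p_def indicator_def\<close>)
  then have lim: "(\<lambda>k. 2 * (\<integral>y. p k y \<partial>lborel)) \<longlonglongrightarrow> 0" by (auto intro!: tendsto_eq_intros)
  have intp: "integrable lborel (p k)" for k
    unfolding p_def[abs_def] using int int' by (intro integrable_max) auto
  have "(\<integral>y. \<bar>indicator U (y + h k) - indicator U y\<bar> \<partial>lborel) = 2 * (\<integral>y. p k y \<partial>lborel)" for k
  proof -
    have "(\<integral>y. \<bar>indicator U (y + h k) - indicator U y\<bar> \<partial>lborel)
      = (\<integral>y. 2 * p k y + (indicator U (y + h k) - indicator U y) \<partial>lborel)"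
      by (intro Bochner_Integration.integral_cong) (simp_all add: p_def max_def abs_if)
    also have "\<dots> = 2 * (\<integral>y. p k y \<partial>lborel) + ((\<integral>y. indicator U (y + h k) \<partial>lborel) - (\<integral>y. indicator U y \<partial>lborel))"
      using int int' intp by simp
    also have "(\<integral>y. indicator U (y + h k) \<partial>lborel) = (\<integral>y. indicator U y \<partial>lborel :: real)"
      by (rule lborel_integral_translate) simp
    finally show ?thesis by simp
  qed
  then show ?thesis using lim by simp
qed

text \<open>
  The functions with this property are closed in \<open>L\<^sup>1\<close>, since the modulus of continuity changes by at
  most twice the distance (\<open>tri\<close>). Indicators of sets of finite measure are limits of indicators
  of open sets by outer regularity, and these generate everything.
\<close>

lemma translation_tendsto_L1:
  fixes f :: "'a::euclidean_space \<Rightarrow> complex"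
  assumes "integrable lborel f" and h: "h \<longlonglongrightarrow> 0"
  shows "(\<lambda>k. \<integral>y. cmod (f (y + h k) - f y) \<partial>lborel) \<longlonglongrightarrow> 0"
proof -
  define \<tau> where "\<tau> f k = (\<integral>y. cmod (f (y + h k) - f y) \<partial>lborel)" for f k
  have tri: "\<tau> f k \<le> \<tau> g k + 2 * (\<integral>y. cmod (f y - g y) \<partial>lborel)"
    if f: "integrable lborel f" and g: "integrable lborel g" for f g :: "'a \<Rightarrow> complex" and k
  proof -
    have [measurable]: "f \<in> borel_measurable borel" "g \<in> borel_measurable borel"
      using f g borel_measurable_integrable by fastforce+
    have f': "integrable lborel (\<lambda>y. f (y + h k))" and g': "integrable lborel (\<lambda>y. g (y + h k))"
      using f g lborel_integral_translate(2)[of f] lborel_integral_translate(2)[of g] by auto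
    have d: "integrable lborel (\<lambda>y. cmod (f y - g y))" "integrable lborel (\<lambda>y. cmod (f (y + h k) - g (y + h k)))"
      "integrable lborel (\<lambda>y. cmod (g (y + h k) - g y))" "integrable lborel (\<lambda>y. cmod (f (y + h k) - f y))"
      using f g f' g' by auto
    have "\<tau> f k \<le> (\<integral>y. cmod (g (y + h k) - g y) + (cmod (f y - g y) + cmod (f (y + h k) - g (y + h k))) \<partial>lborel)"
      unfolding \<tau>_def
    proof (rule integral_mono)
      fix y
      have eq: "f (y + h k) - f y = (g (y + h k) - g y) + ((f (y + h k) - g (y + h k)) - (f y - g y))" by simp
      show "cmod (f (y + h k) - f y) \<le> cmod (g (y + h k) - g y) + (cmod (f y - g y) + cmod (f (y + h k) - g (y + h k)))"
        using norm_triangle_ineq[of "g (y + h k) - g y" "(f (y + h k) - g (y + h k)) - (f y - g y)"]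
          norm_triangle_ineq4[of "f (y + h k) - g (y + h k)" "f y - g y"] unfolding eq by linarith
    qed (use d in auto)
    also have "\<dots> = \<tau> g k + ((\<integral>y. cmod (f y - g y) \<partial>lborel) + (\<integral>y. cmod (f (y + h k) - g (y + h k)) \<partial>lborel))"
      unfolding \<tau>_def using d by simp
    also have "(\<integral>y. cmod (f (y + h k) - g (y + h k)) \<partial>lborel) = (\<integral>y. cmod (f y - g y) \<partial>lborel)"
      by (rule lborel_integral_translate(1)) measurable
    finally show ?thesis by simp
  qed
  have \<tau>_nn: "0 \<le> \<tau> f k" for f k unfolding \<tau>_def by simp
  have approx: "\<tau> f \<longlonglongrightarrow> 0"
    if f: "integrable lborel f" and ap: "\<And>e. e > 0 \<Longrightarrow> \<exists>g. integrable lborel g \<and> \<tau> g \<longlonglongrightarrow> 0 \<and> (\<integral>y. cmod (f y - g y) \<partial>lborel) < e" for f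
  proof (rule LIMSEQ_I)
    fix e :: real assume e: "0 < e"
    obtain g where g: "integrable lborel g" "\<tau> g \<longlonglongrightarrow> 0" "(\<integral>y. cmod (f y - g y) \<partial>lborel) < e / 4"
      using ap[of "e / 4"] e by auto
    obtain N where N: "\<forall>k\<ge>N. norm (\<tau> g k - 0) < e / 2" using LIMSEQ_D[OF g(2), of "e / 2"] e by auto
    have "norm (\<tau> f k - 0) < e" if "k \<ge> N" for k
      using tri[OF f g(1), of k] N[rule_format, OF that] g(3) \<tau>_nn[of f k] \<tau>_nn[of g k] by simp
    then show "\<exists>N. \<forall>k\<ge>N. norm (\<tau> f k - 0) < e" by blast
  qed
  have "\<tau> f \<longlonglongrightarrow> 0" using assms(1)
  proof (induction rule: integrable_induct)
    case (base A c)
    have A: "A \<in> sets borel" using base by simp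
    have intA: "integrable lborel (\<lambda>x. indicator A x *\<^sub>R c)" using base by simp
    show ?case
    proof (rule approx[OF intA])
      fix e :: real assume e: "0 < e"
      define e' where "e' = e / (cmod c + 1)"
      have e': "0 < e'" using e by (simp add: e'_def add_nonneg_pos)
      obtain U where U: "open U" "A \<subseteq> U" "emeasure lborel (U - A) < e'" using outer_regular_lborel[OF A e'] .
      have [measurable]: "U \<in> sets borel" "A \<in> sets borel" using U A by auto
      have "emeasure lborel U = emeasure lborel A + emeasure lborel (U - A)"
        using U by (subst plus_emeasure) (auto simp: Un_absorb1)
      also have "\<dots> < \<infinity>" using base U(3) by (simp add: less_top[symmetric]) (metis ennreal_less_top less_imp_neq order_less_trans)
      finally have Ufin: "emeasure lborel U < \<infinity>" .
      let ?g = "\<lambda>x. indicator U x *\<^sub>R c"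
      have "(\<lambda>k. \<integral>y. \<bar>indicator U (y + h k) - indicator U y\<bar> * cmod c \<partial>lborel) \<longlonglongrightarrow> 0 * cmod c"
        by (subst integral_mult_left_zero) (intro tendsto_mult_right translation_indicator_open U(1) Ufin h)
      moreover have "cmod (?g (y + h k) - ?g y) = \<bar>indicator U (y + h k) - indicator U y\<bar> * cmod c" for y k
        by (simp flip: scaleR_diff_left)
      ultimately have lim: "\<tau> ?g \<longlonglongrightarrow> 0" by (simp add: \<tau>_def[abs_def])
      have "(\<integral>y. cmod (indicator A y *\<^sub>R c - ?g y) \<partial>lborel) = (\<integral>y. indicator (U - A) y * cmod c \<partial>lborel)"
        using U(2) by (intro Bochner_Integration.integral_cong) (auto simp: indicator_def)
      also have "\<dots> = measure lborel (U - A) * cmod c" by simp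
      also have "\<dots> \<le> e' * cmod c"
        using U(3) e' by (intro mult_right_mono) (auto simp: measure_def enn2real_leI less_imp_le)
      also have "\<dots> < e"
      proof -
        have "e * cmod c < e * (cmod c + 1)" using e by simp
        then show ?thesis by (simp add: e'_def pos_divide_less_eq add_nonneg_pos)
      qed
      finally show "\<exists>g. integrable lborel g \<and> \<tau> g \<longlonglongrightarrow> 0 \<and> (\<integral>y. cmod (indicator A y *\<^sub>R c - g y) \<partial>lborel) < e"
        using lim Ufin by (intro exI[of _ ?g]) simp
    qed
  next
    case (add f g)
    note [measurable] = borel_measurable_integrable[OF add.hyps(1)] borel_measurable_integrable[OF add.hyps(2)]
    have fg: "integrable lborel (\<lambda>y. f (y + h k))" "integrable lborel (\<lambda>y. g (y + h k))" for k
      using add.hyps lborel_integral_translate(2)[of f] lborel_integral_translate(2)[of g] by auto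
    have "\<tau> (\<lambda>x. f x + g x) k \<le> \<tau> f k + \<tau> g k" for k
    proof -
      have "\<tau> (\<lambda>x. f x + g x) k \<le> (\<integral>y. cmod (f (y + h k) - f y) + cmod (g (y + h k) - g y) \<partial>lborel)"
        unfolding \<tau>_def using add.hyps fg
        by (intro integral_mono) (auto simp: add_diff_add norm_triangle_ineq)
      also have "\<dots> = \<tau> f k + \<tau> g k" unfolding \<tau>_def using add.hyps fg by simp
      finally show ?thesis .
    qed
    moreover have "(\<lambda>k. \<tau> f k + \<tau> g k) \<longlonglongrightarrow> 0" using tendsto_add[OF add.IH] by simp
    ultimately show ?case
      using \<tau>_nn by (intro tendsto_sandwich[of "\<lambda>_. 0" "\<tau> (\<lambda>x. f x + g x)" sequentially "\<lambda>k. \<tau> f k + \<tau> g k"]) auto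
  next
    case (lim f s)
    show ?case
    proof (rule approx[OF lim.hyps(4)])
      fix e :: real assume e: "0 < e"
      note [measurable] = borel_measurable_integrable[OF lim.hyps(1)] borel_measurable_integrable[OF lim.hyps(4)]
      have "(\<lambda>i. \<integral>y. cmod (f y - s i y) \<partial>lborel) \<longlonglongrightarrow> (\<integral>y. 0 \<partial>(lborel::'a measure))"
      proof (rule integral_dominated_convergence[where w="\<lambda>y. 3 * cmod (f y)"])
        show "AE x in lborel. (\<lambda>i. cmod (f x - s i x)) \<longlonglongrightarrow> 0"
          using lim.hyps(2) by (intro AE_I2 tendsto_norm_zero) (auto intro!: tendsto_eq_intros)
        show "AE x in lborel. norm (cmod (f x - s i x)) \<le> 3 * cmod (f x)" for i
        proof (intro AE_I2)
          fix x
          show "norm (cmod (f x - s i x)) \<le> 3 * cmod (f x)"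
            using lim.hyps(3)[of x i] norm_triangle_ineq4[of "f x" "s i x"] by simp
        qed
      qed (use lim.hyps(4) in auto)
      then obtain i where "(\<integral>y. cmod (f y - s i y) \<partial>lborel) < e"
        using LIMSEQ_D[of _ 0 e] e by fastforce
      then show "\<exists>g. integrable lborel g \<and> \<tau> g \<longlonglongrightarrow> 0 \<and> (\<integral>y. cmod (f y - g y) \<partial>lborel) < e"
        using lim.IH lim.hyps(1) by blast
    qed
  qed
  then show ?thesis by (simp add: \<tau>_def[abs_def])
qed


lemma square_integrable_borel:
  assumes "f \<in> borel_measurable borel"
  shows "square_integrable f \<longleftrightarrow> integrable lborel (\<lambda>x. (cmod (f x))\<^sup>2)"
    and "square_integrable f \<Longrightarrow> (norm (L2_of f))\<^sup>2 = (\<integral>x. (cmod (f x))\<^sup>2 \<partial>lborel)"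
proof -
  have m: "(\<lambda>x. (cmod (f x))\<^sup>2) \<in> borel_measurable lborel" using assms by simp
  show "square_integrable f \<longleftrightarrow> integrable lborel (\<lambda>x. (cmod (f x))\<^sup>2)"
    using assms integrable_completion[OF m] by (simp add: square_integrable_def)
  show "square_integrable f \<Longrightarrow> (norm (L2_of f))\<^sup>2 = (\<integral>x. (cmod (f x))\<^sup>2 \<partial>lborel)"
    using integral_completion[OF m] by (simp add: norm_L2_of)
qed

lemma L2_translate:
  fixes f :: "'a::euclidean_space \<Rightarrow> complex"
  assumes [measurable]: "f \<in> borel_measurable borel" and f: "square_integrable f"
  shows "square_integrable (\<lambda>x. f (x + h))" and "norm (L2_of (\<lambda>x. f (x + h))) = norm (L2_of f)"
proof -
  have m: "(\<lambda>x. f (x + h)) \<in> borel_measurable borel" by measurable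
  have m2: "(\<lambda>x. (cmod (f x))\<^sup>2) \<in> borel_measurable borel" by measurable
  show *: "square_integrable (\<lambda>x. f (x + h))"
    using f lborel_integral_translate(2)[OF m2, of h] square_integrable_borel(1)[OF m] square_integrable_borel(1)[of f] by simp
  have "(norm (L2_of (\<lambda>x. f (x + h))))\<^sup>2 = (norm (L2_of f))\<^sup>2"
    using square_integrable_borel(2)[OF m *] square_integrable_borel(2)[OF assms]
      lborel_integral_translate(1)[OF m2, of h] by simp
  then show "norm (L2_of (\<lambda>x. f (x + h))) = norm (L2_of f)" by simp
qed

text \<open>
  Truncation of \<open>f\<close> at height \<open>N\<close> leaves a remainder that is small in \<open>L\<^sup>2\<close> uniformly in the
  translation; for the bounded part the \<open>L\<^sup>2\<close> distance is controlled by the \<open>L\<^sup>1\<close> distance.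
\<close>

lemma translation_tendsto_L2:
  fixes f :: "'a::euclidean_space \<Rightarrow> complex"
  assumes f_meas [measurable]: "f \<in> borel_measurable borel" and f: "integrable lborel f" "square_integrable f"
    and h: "h \<longlonglongrightarrow> 0"
  shows "(\<lambda>k. L2_of (\<lambda>x. f (x + h k))) \<longlonglongrightarrow> L2_of f"
proof (rule LIMSEQ_I)
  fix e :: real assume e: "0 < e"
  define r where "r N x = (if cmod (f x) \<le> real N then 0 else f x)" for N x
  define g where "g N x = (if cmod (f x) \<le> real N then f x else 0)" for N x
  have [measurable]: "r N \<in> borel_measurable borel" "g N \<in> borel_measurable borel" for N
    unfolding r_def[abs_def] g_def[abs_def] by measurable
  have r_sq: "square_integrable (r N)" and g_sq: "square_integrable (g N)" for N
    by (rule square_integrable_mono(1)[OF f(2)]; auto simp: r_def g_def)+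
  have "(\<lambda>N. L2_of (r N)) \<longlonglongrightarrow> 0"
  proof (rule L2_dominated_convergence[OF _ f(2)])
    show "AE x in lebesgue. (\<lambda>N. r N x) \<longlonglongrightarrow> 0"
    proof (intro AE_I2 tendsto_eventually)
      fix x
      obtain N0 where "cmod (f x) \<le> real N0" using real_arch_simple by blast
      then show "\<forall>\<^sub>F N in sequentially. r N x = 0"
        unfolding eventually_sequentially r_def by (intro exI[of _ N0]) auto
    qed
  qed (auto simp: r_def)
  then obtain N where "norm (L2_of (r N) - 0) < e / 3" using LIMSEQ_D[of _ 0 "e / 3"] e by fastforce
  then have rN: "norm (L2_of (r N)) < e / 3" by simp
  have g_int: "integrable lborel (g N)"
    by (rule Bochner_Integration.integrable_bound[OF f(1)]) (auto simp: g_def)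
  have g'_int: "integrable lborel (\<lambda>y. g N (y + h k))" for k using g_int lborel_integral_translate(2)[of "g N"] by simp
  define d where "d k x = g N (x + h k) - g N x" for k x
  have [measurable]: "d k \<in> borel_measurable borel" for k unfolding d_def[abs_def] by measurable
  have d_sq: "square_integrable (d k)" for k
    unfolding d_def[abs_def] by (intro square_integrable_diff L2_translate(1) g_sq) measurable
  have gb: "cmod (g N x) \<le> N" for x by (auto simp: g_def)
  have d_le: "(norm (L2_of (d k)))\<^sup>2 \<le> 2 * real N * (\<integral>y. cmod (d k y) \<partial>lborel)" for k
  proof -
    have "(norm (L2_of (d k)))\<^sup>2 = (\<integral>y. (cmod (d k y))\<^sup>2 \<partial>lborel)"
      by (rule square_integrable_borel(2)[OF _ d_sq]) measurable
    also have "\<dots> \<le> (\<integral>y. 2 * real N * cmod (d k y) \<partial>lborel)"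
    proof (rule integral_mono)
      show "integrable lborel (\<lambda>y. (cmod (d k y))\<^sup>2)" using d_sq[of k] square_integrable_borel(1)[of "d k"] by simp
      show "integrable lborel (\<lambda>y. 2 * real N * cmod (d k y))"
        unfolding d_def using g_int g'_int by auto
      fix y
      have "cmod (d k y) \<le> 2 * real N" unfolding d_def using norm_triangle_ineq4[of "g N (y + h k)" "g N y"] gb[of "y + h k"] gb[of y] by linarith
      then show "(cmod (d k y))\<^sup>2 \<le> 2 * real N * cmod (d k y)"
        unfolding power2_eq_square by (intro mult_right_mono) auto
    qed
    finally show ?thesis by simp
  qed
  have "(\<lambda>k. 2 * real N * (\<integral>y. cmod (d k y) \<partial>lborel)) \<longlonglongrightarrow> 2 * real N * 0"
    unfolding d_def by (intro tendsto_mult_left translation_tendsto_L1 g_int h)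
  then have "(\<lambda>k. (norm (L2_of (d k)))\<^sup>2) \<longlonglongrightarrow> 0"
    by (intro tendsto_sandwich[of "\<lambda>_. 0" "\<lambda>k. (norm (L2_of (d k)))\<^sup>2" sequentially "\<lambda>k. 2 * real N * (\<integral>y. cmod (d k y) \<partial>lborel)"])
       (auto simp: d_le)
  then have "(\<lambda>k. sqrt ((norm (L2_of (d k)))\<^sup>2)) \<longlonglongrightarrow> sqrt 0" by (intro tendsto_intros)
  then obtain K where K: "\<And>k. k \<ge> K \<Longrightarrow> norm (L2_of (d k)) < e / 3"
    using LIMSEQ_D[of "\<lambda>k. norm (L2_of (d k))" 0 "e / 3"] e by auto
  have "norm (L2_of (\<lambda>x. f (x + h k)) - L2_of f) < e" if "k \<ge> K" for k
  proof -
    have eq: "f (x + h k) - f x = (d k x + r N (x + h k)) - r N x" for x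
      by (simp add: d_def g_def r_def)
    have sq: "square_integrable (\<lambda>x. r N (x + h k))" by (rule L2_translate(1)[OF _ r_sq]) measurable
    have sqf: "square_integrable (\<lambda>x. f (x + h k))" by (rule L2_translate(1)[OF _ f(2)]) measurable
    have "L2_of (\<lambda>x. f (x + h k)) - L2_of f = L2_of (\<lambda>x. f (x + h k) - f x)"
      using sqf f(2) by (simp add: L2_of_diff)
    also have "\<dots> = (L2_of (d k) + L2_of (\<lambda>x. r N (x + h k))) - L2_of (r N)"
      unfolding eq using d_sq[of k] r_sq[of N] sq by (simp add: L2_of_diff L2_of_add square_integrable_add)
    finally have "norm (L2_of (\<lambda>x. f (x + h k)) - L2_of f)
      \<le> norm (L2_of (d k)) + norm (L2_of (\<lambda>x. r N (x + h k))) + norm (L2_of (r N))"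
      using norm_triangle_ineq4[of "L2_of (d k) + L2_of (\<lambda>x. r N (x + h k))" "L2_of (r N)"]
        norm_triangle_ineq[of "L2_of (d k)" "L2_of (\<lambda>x. r N (x + h k))"] by simp
    also have "norm (L2_of (\<lambda>x. r N (x + h k))) = norm (L2_of (r N))"
      by (rule L2_translate(2)[OF _ r_sq]) measurable
    finally show ?thesis using K[OF that] rN by simp
  qed
  then show "\<exists>K. \<forall>k\<ge>K. norm (L2_of (\<lambda>x. f (x + h k)) - L2_of f) < e" by blast
qed

lemma cmod_integral_le_norms:
  assumes f: "square_integrable f" and g: "square_integrable g"
  shows "cmod (\<integral>x. f x * cnj (g x) \<partial>lebesgue) \<le> norm (L2_of f) * norm (L2_of g)"
proof -
  define f' g' where "f' x = complex_of_real (cmod (f x))" and "g' x = complex_of_real (cmod (g x))" for x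
  have [measurable]: "f \<in> borel_measurable lebesgue" "g \<in> borel_measurable lebesgue"
    using f g by (auto simp: square_integrable_def)
  have f': "square_integrable f'" "norm (L2_of f') \<le> norm (L2_of f)"
    and g': "square_integrable g'" "norm (L2_of g') \<le> norm (L2_of g)"
  proof -
    have m: "f' \<in> borel_measurable lebesgue" "g' \<in> borel_measurable lebesgue"
      unfolding f'_def[abs_def] g'_def[abs_def] by measurable
    have ae: "AE x in lebesgue. cmod (f' x) \<le> cmod (f x)" "AE x in lebesgue. cmod (g' x) \<le> cmod (g x)"
      by (simp_all add: f'_def g'_def)
    show "square_integrable f'" "norm (L2_of f') \<le> norm (L2_of f)"
      "square_integrable g'" "norm (L2_of g') \<le> norm (L2_of g)"
      by (rule square_integrable_mono[OF f m(1) ae(1)] square_integrable_mono[OF g m(2) ae(2)])+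
  qed
  have "cmod (\<integral>x. f x * cnj (g x) \<partial>lebesgue) \<le> (\<integral>x. cmod (f x * cnj (g x)) \<partial>lebesgue)"
    by (rule integral_norm_bound)
  also have "\<dots> = Re (\<integral>x. complex_of_real (cmod (f x) * cmod (g x)) \<partial>lebesgue)"
    by (simp only: integral_complex_of_real Re_complex_of_real norm_mult complex_mod_cnj)
  also have "\<dots> = inner (L2_of f') (L2_of g')"
    using f' g' by (simp add: inner_L2_of f'_def g'_def)
  also have "\<dots> \<le> norm (L2_of f') * norm (L2_of g')" by (rule norm_cauchy_schwarz)
  also have "\<dots> \<le> norm (L2_of f) * norm (L2_of g)" using f' g' by (intro mult_mono) auto
  finally show ?thesis .
qed

subsection \<open>The isometry on integrable functions\<close>

text \<open>
  Throughout, \<open>\<phi>\<close> is the autocorrelation of \<open>f\<close>. Its value at \<open>0\<close> is \<open>|f|\<^sup>2\<close> and its Fourier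
  transform is \<open>|FT f|\<^sup>2\<close>, so Plancherel's theorem is the inversion formula for \<open>\<phi>\<close> at \<open>0\<close>.
\<close>

context
  fixes f :: "'a::euclidean_space \<Rightarrow> complex" and \<phi> :: "'a \<Rightarrow> complex"
  assumes f_meas [measurable]: "f \<in> borel_measurable borel"
    and f_int: "integrable lborel f" and f_sq: "square_integrable f"
  defines "\<phi> \<equiv> (\<lambda>z. \<integral>y. f (y + z) * cnj (f y) \<partial>lborel)"
begin

lemma autocorrelation_product_integrable:
  "integrable (lborel \<Otimes>\<^sub>M lborel) (\<lambda>(y, z). f (y + z) * cnj (f y))"
proof -
  have t: "(\<integral>z. cmod (f (y + z)) \<partial>lborel) = (\<integral>z. cmod (f z) \<partial>lborel)" for y
    using lborel_integral_translate(1)[of "\<lambda>z. cmod (f z)" y] by (simp add: add.commute)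
  have i: "integrable lborel (\<lambda>z. f (y + z))" for y
    using lborel_integral_translate(2)[of f y] f_int by (simp add: add.commute)
  show ?thesis
  proof (rule lborel_pair.Fubini_integrable)
    show "integrable lborel (\<lambda>y. \<integral>z. norm (case (y, z) of (y, z) \<Rightarrow> f (y + z) * cnj (f y)) \<partial>lborel)"
      using f_int by (simp add: norm_mult t)
    show "AE y in lborel. integrable lborel (\<lambda>z. case (y, z) of (y, z) \<Rightarrow> f (y + z) * cnj (f y))"
      using i by auto
  qed measurable
qed

lemma autocorrelation_measurable [measurable]: "\<phi> \<in> borel_measurable borel"
  unfolding \<phi>_def by measurable

lemma autocorrelation_integrable: "integrable lborel \<phi>"
proof -
  show ?thesis
    using lborel_pair.integrable_snd[OF autocorrelation_product_integrable] by (simp add: \<phi>_def)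
qed

lemma autocorrelation_lebesgue: "\<phi> z = (\<integral>y. f (y + z) * cnj (f y) \<partial>lebesgue)"
  unfolding \<phi>_def by (rule integral_completion[symmetric]) measurable

lemma autocorrelation_bound: "cmod (\<phi> z) \<le> (norm (L2_of f))\<^sup>2"
  unfolding autocorrelation_lebesgue power2_eq_square
  using cmod_integral_le_norms[OF L2_translate(1)[OF f_meas f_sq, of z] f_sq] L2_translate(2)[OF f_meas f_sq, of z] by simp

lemma autocorrelation_tendsto:
  assumes "h \<longlonglongrightarrow> 0"
  shows "(\<lambda>k. \<phi> (h k)) \<longlonglongrightarrow> complex_of_real ((norm (L2_of f))\<^sup>2)"
proof -
  have 0: "complex_of_real ((norm (L2_of f))\<^sup>2) = (\<integral>y. f y * cnj (f y) \<partial>lebesgue)"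
    unfolding norm_L2_of[OF f_sq] complex_norm_square[symmetric] by (simp only: integral_complex_of_real)
  have le: "cmod (\<phi> (h k) - complex_of_real ((norm (L2_of f))\<^sup>2)) \<le> norm (L2_of (\<lambda>x. f (x + h k)) - L2_of f) * norm (L2_of f)" for k
  proof -
    have sq: "square_integrable (\<lambda>x. f (x + h k))" by (rule L2_translate(1)[OF f_meas f_sq])
    have "\<phi> (h k) - complex_of_real ((norm (L2_of f))\<^sup>2) = (\<integral>y. (f (y + h k) - f y) * cnj (f y) \<partial>lebesgue)"
      unfolding 0 autocorrelation_lebesgue using square_integrable_mult_cnj[OF sq f_sq] square_integrable_mult_cnj[OF f_sq f_sq]
      by (simp add: left_diff_distrib)
    then show ?thesis
      using cmod_integral_le_norms[OF square_integrable_diff[OF sq f_sq] f_sq] L2_of_diff[OF sq f_sq] by simp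
  qed
  have "(\<lambda>k. norm (L2_of (\<lambda>x. f (x + h k)) - L2_of f) * norm (L2_of f)) \<longlonglongrightarrow> 0 * norm (L2_of f)"
    using translation_tendsto_L2[OF f_meas f_int f_sq assms]
    by (intro tendsto_mult tendsto_const) (simp add: LIM_zero_iff tendsto_norm_zero_iff)
  then have "(\<lambda>k. \<phi> (h k) - complex_of_real ((norm (L2_of f))\<^sup>2)) \<longlonglongrightarrow> 0"
    by (intro Lim_null_comparison[OF always_eventually[OF allI[OF le]]]) simp
  then show ?thesis by (simp add: LIM_zero_iff)
qed

lemma FT_square_eq: "complex_of_real ((cmod (FT f \<xi>))\<^sup>2) = (\<integral>z. wave z \<xi> * \<phi> z \<partial>lborel)"
proof -
  let ?e = "\<lambda>z. wave z \<xi>"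
  have int: "integrable (lborel \<Otimes>\<^sub>M lborel) (\<lambda>(y, z). ?e z * (f (y + z) * cnj (f y)))"
    using integrable_mult_bounded[OF autocorrelation_product_integrable, of "\<lambda>(y, z). ?e z" 1]
    by (simp add: case_prod_beta')
  have inner: "(\<integral>z. ?e z * (f (y + z) * cnj (f y)) \<partial>lborel) = FT f \<xi> * cnj (?e y * f y)" for y
  proof -
    have eq: "?e (z + y) * f (z + y) = ?e y * (?e z * f (z + y))" for z
      by (simp add: inner_add_left exp_add[symmetric] algebra_simps)
    have "FT f \<xi> = (\<integral>z. ?e (z + y) * f (z + y) \<partial>lborel)"
      unfolding FT_borel[OF f_meas] by (rule lborel_integral_translate(1)[symmetric]) measurable
    also have "\<dots> = ?e y * (\<integral>z. ?e z * f (z + y) \<partial>lborel)"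
      unfolding eq by (rule integral_mult_right_zero)
    finally have "cnj (?e y) * FT f \<xi> = (cnj (?e y) * ?e y) * (\<integral>z. ?e z * f (z + y) \<partial>lborel)"
      by (simp only: mult.assoc)
    also have "cnj (?e y) * ?e y = 1"
      by (simp add: exp_cnj exp_add[symmetric])
    finally have A: "cnj (?e y) * FT f \<xi> = (\<integral>z. ?e z * f (z + y) \<partial>lborel)" by simp
    have "(\<integral>z. ?e z * (f (y + z) * cnj (f y)) \<partial>lborel) = (\<integral>z. ?e z * f (z + y) \<partial>lborel) * cnj (f y)"
      unfolding integral_mult_left_zero[symmetric] by (simp only: add.commute mult.assoc)
    also have "\<dots> = FT f \<xi> * cnj (?e y * f y)" unfolding A[symmetric] by (simp only: complex_cnj_mult mult_ac)
    finally show ?thesis .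
  qed
  have "complex_of_real ((cmod (FT f \<xi>))\<^sup>2) = FT f \<xi> * (\<integral>y. cnj (?e y * f y) \<partial>lborel)"
    by (simp only: complex_norm_square Bochner_Integration.integral_cnj FT_borel[OF f_meas])
  also have "\<dots> = (\<integral>y. (\<integral>z. ?e z * (f (y + z) * cnj (f y)) \<partial>lborel) \<partial>lborel)"
    unfolding inner by simp
  also have "\<dots> = (\<integral>z. (\<integral>y. ?e z * (f (y + z) * cnj (f y)) \<partial>lborel) \<partial>lborel)"
    using lborel_pair.Fubini_integral[OF int] by simp
  also have "\<dots> = (\<integral>z. ?e z * \<phi> z \<partial>lborel)" by (simp add: \<phi>_def)
  finally show ?thesis .
qed

lemma FT_integrable_lebesgue: "integrable lebesgue f"
  using f_int integrable_completion[of f lborel] by simp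

lemma FT_gauss_integrable:
  assumes "0 < \<epsilon>"
  shows "integrable lborel (\<lambda>\<xi>. (cmod (FT f \<xi>))\<^sup>2 * gauss (\<epsilon> *\<^sub>R \<xi>))"
proof (rule Bochner_Integration.integrable_bound)
  let ?C = "\<integral>x. cmod (f x) \<partial>lebesgue"
  show "integrable lborel (\<lambda>\<xi>. ?C\<^sup>2 * gauss (\<epsilon> *\<^sub>R (\<xi>::'a)))"
    using integrable_gauss_scaled[OF assms] by (rule integrable_mult_right)
  show "AE x in lborel. norm ((cmod (FT f x))\<^sup>2 * gauss (\<epsilon> *\<^sub>R x)) \<le> norm (?C\<^sup>2 * gauss (\<epsilon> *\<^sub>R x))"
  proof (intro AE_I2)
    fix x
    have "(cmod (FT f x))\<^sup>2 \<le> ?C\<^sup>2" using cmod_FT_le[OF FT_integrable_lebesgue, of x] by (intro power_mono) auto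
    then show "norm ((cmod (FT f x))\<^sup>2 * gauss (\<epsilon> *\<^sub>R x)) \<le> norm (?C\<^sup>2 * gauss (\<epsilon> *\<^sub>R x))"
      using gauss_pos[of "\<epsilon> *\<^sub>R x"] by (simp add: abs_mult mult_right_mono)
  qed
  have [measurable]: "FT f \<in> borel_measurable borel" by (rule FT_measurable_borel) measurable
  show "(\<lambda>\<xi>. (cmod (FT f \<xi>))\<^sup>2 * gauss (\<epsilon> *\<^sub>R \<xi>)) \<in> borel_measurable lborel" by measurable
qed

text \<open>
  The Gaussian factor makes the triple integral absolutely convergent; after exchanging the integrals
  its own transform appears, and rescaling moves the parameter \<open>\<epsilon>\<close> into the argument of \<open>\<phi>\<close>.
\<close>

lemma FT_gauss_identity:
  assumes \<epsilon>: "0 < \<epsilon>"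
  shows "complex_of_real (\<integral>\<xi>. (cmod (FT f \<xi>))\<^sup>2 * gauss (\<epsilon> *\<^sub>R \<xi>) \<partial>lborel)
    = complex_of_real (sqrt (2 * pi) ^ DIM('a)) * (\<integral>w. \<phi> (\<epsilon> *\<^sub>R w) * complex_of_real (gauss w) \<partial>lborel)"
proof -
  let ?e = "\<lambda>z \<xi>. wave z \<xi>"
  let ?g = "\<lambda>\<xi>. complex_of_real (gauss (\<epsilon> *\<^sub>R (\<xi>::'a)))"
  have g: "integrable lborel ?g" using integrable_gauss_scaled[OF \<epsilon>] by (simp add: complex_of_real_integrable_eq)
  have e: "(\<lambda>(x, y). ?e y x) \<in> borel_measurable (lborel \<Otimes>\<^sub>M lborel)" 
    unfolding lborel_prod by (simp add: case_prod_beta') (intro borel_measurable_continuous_onI continuous_intros)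
  have "integrable (lborel \<Otimes>\<^sub>M lborel) (\<lambda>(\<xi>, z). ?g \<xi> * \<phi> z)"
  proof (rule lborel_pair.Fubini_integrable)
    show "integrable lborel (\<lambda>\<xi>. \<integral>z. norm (case (\<xi>, z) of (\<xi>, z) \<Rightarrow> ?g \<xi> * \<phi> z) \<partial>lborel)"
      using integrable_mult_left[OF integrable_norm[OF g]] by (simp add: norm_mult)
  qed (use autocorrelation_integrable in auto)
  then have int: "integrable (lborel \<Otimes>\<^sub>M lborel) (\<lambda>(\<xi>, z). ?e z \<xi> * (?g \<xi> * \<phi> z))"
    using integrable_mult_bounded[OF _ e, of "\<lambda>(\<xi>, z). ?g \<xi> * \<phi> z" 1]
    by (simp add: case_prod_beta')
  have "complex_of_real (\<integral>\<xi>. (cmod (FT f \<xi>))\<^sup>2 * gauss (\<epsilon> *\<^sub>R \<xi>) \<partial>lborel)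
    = (\<integral>\<xi>. complex_of_real ((cmod (FT f \<xi>))\<^sup>2) * ?g \<xi> \<partial>lborel)"
    by (simp only: integral_complex_of_real[symmetric] of_real_mult)
  also have "\<dots> = (\<integral>\<xi>. (\<integral>z. ?e z \<xi> * (?g \<xi> * \<phi> z) \<partial>lborel) \<partial>lborel)"
  proof (rule Bochner_Integration.integral_cong[OF refl])
    fix \<xi> :: 'a
    have "complex_of_real ((cmod (FT f \<xi>))\<^sup>2) * ?g \<xi> = (\<integral>z. (?e z \<xi> * \<phi> z) * ?g \<xi> \<partial>lborel)"
      unfolding FT_square_eq by (rule integral_mult_left_zero[symmetric])
    then show "complex_of_real ((cmod (FT f \<xi>))\<^sup>2) * ?g \<xi> = (\<integral>z. ?e z \<xi> * (?g \<xi> * \<phi> z) \<partial>lborel)"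
      by (simp only: mult.assoc mult.commute[of "\<phi> _"])
  qed
  also have "\<dots> = (\<integral>z. (\<integral>\<xi>. ?e z \<xi> * (?g \<xi> * \<phi> z) \<partial>lborel) \<partial>lborel)"
    using lborel_pair.Fubini_integral[OF int] by simp
  also have "\<dots> = (\<integral>z. \<phi> z * (\<integral>\<xi>. wave \<xi> z * ?g \<xi> \<partial>lborel) \<partial>lborel)"
    by (simp add: mult_ac inner_commute)
  also have "\<dots> = (\<integral>z. \<phi> z * complex_of_real ((1 / \<epsilon>) ^ DIM('a) * sqrt (2 * pi) ^ DIM('a) * gauss ((1 / \<epsilon>) *\<^sub>R z)) \<partial>lborel)"
    by (simp only: gauss_FT_scaled[OF \<epsilon>])
  also have "\<dots> = complex_of_real (\<epsilon> ^ DIM('a)) * (\<integral>w. \<phi> (\<epsilon> *\<^sub>R w) * complex_of_real ((1 / \<epsilon>) ^ DIM('a) * sqrt (2 * pi) ^ DIM('a) * gauss w) \<partial>lborel)"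
    using \<epsilon> by (subst lborel_integral_scale[OF _ \<epsilon>]) simp_all
  also have "\<dots> = (\<integral>w. complex_of_real (sqrt (2 * pi) ^ DIM('a)) * (\<phi> (\<epsilon> *\<^sub>R w) * complex_of_real (gauss w)) \<partial>lborel)"
    unfolding integral_mult_right_zero[symmetric]
    by (rule Bochner_Integration.integral_cong[OF refl]) (use \<epsilon> in \<open>simp add: power_one_over field_simps\<close>)
  finally show ?thesis by simp
qed

text \<open>
  As \<open>\<epsilon>\<close> decreases to \<open>0\<close>, the left side of the Gaussian identity increases to the integral of
  \<open>|FT f|\<^sup>2\<close> by monotone convergence, which also shows that this integral is finite, and the right
  side tends to \<open>(2 \<pi>)\<^sup>n \<phi> 0\<close> because \<open>\<phi>\<close> is bounded and continuous at \<open>0\<close>.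
\<close>

lemma Plancherel_borel:
  shows "square_integrable (FT f)" and "norm (L2_of (FT f)) = sqrt (2 * pi) ^ DIM('a) * norm (L2_of f)"
proof -
  let ?c = "sqrt (2 * pi) ^ DIM('a)"
  define \<epsilon> where "\<epsilon> k = 1 / real (Suc k)" for k
  have \<epsilon>: "0 < \<epsilon> k" for k by (simp add: \<epsilon>_def)
  have \<epsilon>_lim: "\<epsilon> \<longlonglongrightarrow> 0" unfolding \<epsilon>_def[abs_def] by (rule LIMSEQ_inverse_real_of_nat[unfolded inverse_eq_divide])
  define J where "J k = (\<integral>\<xi>. (cmod (FT f \<xi>))\<^sup>2 * gauss (\<epsilon> k *\<^sub>R \<xi>) \<partial>lborel)" for k
  have [measurable]: "FT f \<in> borel_measurable borel" by (rule FT_measurable_borel) measurable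
  have "(\<lambda>k. \<integral>w. \<phi> (\<epsilon> k *\<^sub>R w) * complex_of_real (gauss w) \<partial>lborel)
     \<longlonglongrightarrow> (\<integral>w. complex_of_real ((norm (L2_of f))\<^sup>2) * complex_of_real (gauss (w::'a)) \<partial>lborel)"
  proof (rule integral_dominated_convergence)
    show "integrable lborel (\<lambda>w::'a. (norm (L2_of f))\<^sup>2 * gauss w)" by (rule integrable_mult_right[OF integrable_gauss])
    show "AE w in lborel. (\<lambda>k. \<phi> (\<epsilon> k *\<^sub>R w) * complex_of_real (gauss w)) \<longlonglongrightarrow> complex_of_real ((norm (L2_of f))\<^sup>2) * complex_of_real (gauss w)"
    proof (intro AE_I2 tendsto_mult tendsto_const autocorrelation_tendsto)
      fix w :: 'a show "(\<lambda>k. \<epsilon> k *\<^sub>R w) \<longlonglongrightarrow> 0" using tendsto_scaleR[OF \<epsilon>_lim tendsto_const[of w]] by simp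
    qed
    show "AE w in lborel. norm (\<phi> (\<epsilon> k *\<^sub>R w) * complex_of_real (gauss w)) \<le> (norm (L2_of f))\<^sup>2 * gauss w" for k
    proof (intro AE_I2)
      fix w :: 'a
      have "\<bar>gauss w\<bar> = gauss w" using gauss_pos[of w] by simp
      then show "norm (\<phi> (\<epsilon> k *\<^sub>R w) * complex_of_real (gauss w)) \<le> (norm (L2_of f))\<^sup>2 * gauss w"
        using mult_right_mono[OF autocorrelation_bound[of "\<epsilon> k *\<^sub>R w"] less_imp_le[OF gauss_pos[of w]]]
        by (simp add: norm_mult)
    qed
  qed auto
  also have "(\<integral>w. complex_of_real ((norm (L2_of f))\<^sup>2) * complex_of_real (gauss (w::'a)) \<partial>lborel) = complex_of_real ((norm (L2_of f))\<^sup>2 * ?c)"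
    by (simp add: integral_gauss)
  finally have lim: "(\<lambda>k. \<integral>w. \<phi> (\<epsilon> k *\<^sub>R w) * complex_of_real (gauss w) \<partial>lborel)
     \<longlonglongrightarrow> complex_of_real ((norm (L2_of f))\<^sup>2 * ?c)" .
  have "(\<lambda>k. complex_of_real (J k)) \<longlonglongrightarrow> complex_of_real (?c * ((norm (L2_of f))\<^sup>2 * ?c))"
    unfolding J_def FT_gauss_identity[OF \<epsilon>] of_real_mult[of ?c] by (intro tendsto_mult tendsto_const lim)
  then have J: "J \<longlonglongrightarrow> ?c * ((norm (L2_of f))\<^sup>2 * ?c)" by (simp only: tendsto_of_real_iff)
  have "incseq (\<lambda>k \<xi>. ennreal ((cmod (FT f \<xi>))\<^sup>2 * gauss (\<epsilon> k *\<^sub>R \<xi>)))"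
  proof (rule incseq_SucI, rule le_funI, rule ennreal_leI, rule mult_left_mono)
    fix k and \<xi> :: 'a
    have "(\<epsilon> (Suc k) * norm \<xi>)\<^sup>2 \<le> (\<epsilon> k * norm \<xi>)\<^sup>2"
      using \<epsilon> by (intro power_mono mult_right_mono) (auto simp: \<epsilon>_def frac_le less_imp_le)
    then show "gauss (\<epsilon> k *\<^sub>R \<xi>) \<le> gauss (\<epsilon> (Suc k) *\<^sub>R \<xi>)"
      using \<epsilon>[of k] \<epsilon>[of "Suc k"] by (simp add: gauss_def)
  qed simp
  moreover have "(\<lambda>k. ennreal ((cmod (FT f \<xi>))\<^sup>2 * gauss (\<epsilon> k *\<^sub>R \<xi>))) \<longlonglongrightarrow> ennreal ((cmod (FT f \<xi>))\<^sup>2)" for \<xi>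
  proof -
    have "(\<lambda>k. (cmod (FT f \<xi>))\<^sup>2 * gauss (\<epsilon> k *\<^sub>R \<xi>)) \<longlonglongrightarrow> (cmod (FT f \<xi>))\<^sup>2 * gauss (0 *\<^sub>R \<xi>)"
      unfolding gauss_def by (intro tendsto_intros \<epsilon>_lim) auto
    then show ?thesis by (intro tendsto_ennrealI) (simp add: gauss_def)
  qed
  ultimately have "(\<lambda>k. \<integral>\<^sup>+\<xi>. ennreal ((cmod (FT f \<xi>))\<^sup>2 * gauss (\<epsilon> k *\<^sub>R \<xi>)) \<partial>lborel) \<longlonglongrightarrow> (\<integral>\<^sup>+\<xi>. ennreal ((cmod (FT f \<xi>))\<^sup>2) \<partial>lborel)"
    by (intro nn_integral_LIMSEQ) auto
  moreover have "(\<integral>\<^sup>+\<xi>. ennreal ((cmod (FT f \<xi>))\<^sup>2 * gauss (\<epsilon> k *\<^sub>R \<xi>)) \<partial>lborel) = ennreal (J k)" for k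
    unfolding J_def
    by (intro nn_integral_eq_integral FT_gauss_integrable \<epsilon> AE_I2 mult_nonneg_nonneg less_imp_le[OF gauss_pos]) simp
  ultimately have "(\<lambda>k. ennreal (J k)) \<longlonglongrightarrow> (\<integral>\<^sup>+\<xi>. ennreal ((cmod (FT f \<xi>))\<^sup>2) \<partial>lborel)" by simp
  moreover have "(\<lambda>k. ennreal (J k)) \<longlonglongrightarrow> ennreal ((?c * norm (L2_of f))\<^sup>2)"
    using tendsto_ennrealI[OF J] by (simp add: power2_eq_square mult_ac)
  ultimately have eq: "(\<integral>\<^sup>+\<xi>. ennreal ((cmod (FT f \<xi>))\<^sup>2) \<partial>lebesgue) = ennreal ((?c * norm (L2_of f))\<^sup>2)"
    by (simp add: nn_integral_completion LIMSEQ_unique)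
  have c0: "0 \<le> ?c * norm (L2_of f)" by simp
  show sq: "square_integrable (FT f)"
    using square_integrableI_nn(1)[OF _ _ c0, of "FT f"] eq by simp
  have "ennreal ((norm (L2_of (FT f)))\<^sup>2) = ennreal ((?c * norm (L2_of f))\<^sup>2)"
    using norm_L2_of_nn[OF sq] eq by simp
  then have "(norm (L2_of (FT f)))\<^sup>2 = (?c * norm (L2_of f))\<^sup>2" by (subst (asm) ennreal_inj) auto
  then show "norm (L2_of (FT f)) = ?c * norm (L2_of f)" by (rule power2_eq_imp_eq[OF _ norm_ge_zero c0])
qed

end

theorem Plancherel:
  fixes f :: "'a::euclidean_space \<Rightarrow> complex"
  assumes "integrable lebesgue f" "square_integrable f"
  shows "square_integrable (FT f)" and "norm (L2_of (FT f)) = sqrt (2 * pi) ^ DIM('a) * norm (L2_of f)"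
proof -
  have fm: "f \<in> borel_measurable lebesgue" using assms(1) by simp
  obtain g where g: "g \<in> borel_measurable borel" "AE x in lebesgue. f x = g x"
    using borel_representative[OF fm] .
  have gm: "g \<in> borel_measurable lebesgue" using g by simp
  have "integrable lebesgue f = integrable lebesgue g" using g(2) fm gm by (intro integrable_cong_AE)
  then have "integrable lborel g" using integrable_completion[of g lborel] assms g by simp
  moreover have "square_integrable g" by (rule square_integrable_cong_AE[OF assms(2) gm g(2)])
  moreover have "FT f = FT g" by (rule FT_cong_AE[OF fm gm g(2)])
  moreover have "L2_of f = L2_of g" by (rule L2_of_cong_AE) fact+
  ultimately show "square_integrable (FT f)" "norm (L2_of (FT f)) = sqrt (2 * pi) ^ DIM('a) * norm (L2_of f)"
    using Plancherel_borel[OF g(1)] by simp_all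
qed

section \<open>The Fourier--Plancherel transform as a scaled unitary operator\<close>

lemma integrable_indicator_mult:
  fixes f :: "'a::euclidean_space \<Rightarrow> complex"
  assumes "bounded S" "S \<in> sets lebesgue" "square_integrable f"
  shows "integrable lebesgue (\<lambda>x. indicator S x * f x)"
proof -
  have [measurable]: "f \<in> borel_measurable lebesgue" using assms(3) by (simp add: square_integrable_def)
  have "S \<in> lmeasurable" using assms by (simp add: bounded_set_imp_lmeasurable)
  then have "integrable lebesgue (\<lambda>x. (cmod (indicator S x))\<^sup>2)"
  proof -
    have "(\<lambda>x. (cmod (indicator S x))\<^sup>2) = (indicator S :: 'a \<Rightarrow> real)" by (auto simp: indicator_def)
    moreover have "integrable lebesgue (indicator S :: 'a \<Rightarrow> real)"
      using \<open>S \<in> lmeasurable\<close> by (intro integrable_real_indicator) (auto simp: fmeasurable_def)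
    ultimately show ?thesis by simp
  qed
  then have S: "square_integrable (indicator S)"
    using assms(2) by (simp add: square_integrable_def)
  have "square_integrable (\<lambda>x. cnj (f x))"
    by (rule square_integrable_mono(1)[OF assms(3)]) auto
  from square_integrable_mult_cnj[OF S this] show ?thesis by simp
qed

text \<open>
  Truncation to a ball. It produces integrable representatives, and it is the truncation that occurs
  in the definition of the transform on \<open>L2\<close>.
\<close>

abbreviation cut :: "real \<Rightarrow> 'a::euclidean_space L2 \<Rightarrow> 'a L2" where
  "cut R \<equiv> Mul (indicator (cball 0 R))"

lemma cut_eq: "cut R u = L2_of (\<lambda>x. indicator (cball 0 R) x * L2_fun u x)"
  by (simp add: Mul_def)

lemma cut_integrable: "integrable lebesgue (\<lambda>x. indicator (cball 0 R) x * L2_fun u x)"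
  by (rule integrable_indicator_mult) auto

lemma cut_square_integrable: "square_integrable (\<lambda>x. indicator (cball 0 R) x * L2_fun u x)"
  by (rule square_integrable_Mul) auto

lemma cut_tendsto: "((\<lambda>R. cut R u) \<longlongrightarrow> u) at_top"
proof (rule tendsto_at_topI_sequentially)
  fix X :: "nat \<Rightarrow> real" assume X: "filterlim X at_top sequentially"
  let ?s = "\<lambda>n x. indicator (cball 0 (X n)) x * L2_fun u x - L2_fun u x"
  have "(\<lambda>n. L2_of (?s n)) \<longlonglongrightarrow> 0"
  proof (rule L2_dominated_convergence[where w="L2_fun u"])
    show "AE x in lebesgue. (\<lambda>n. ?s n x) \<longlonglongrightarrow> 0"
    proof (intro AE_I2 tendsto_eventually)
      fix x :: 'a
      have "\<forall>\<^sub>F n in sequentially. norm x \<le> X n" using X by (simp add: filterlim_at_top)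
      then show "\<forall>\<^sub>F n in sequentially. ?s n x = 0" by (rule eventually_mono) simp
    qed
    show "AE x in lebesgue. cmod (?s n x) \<le> cmod (L2_fun u x)" for n
      by (intro AE_I2) (auto simp: indicator_def)
  qed (auto intro!: borel_measurable_diff borel_measurable_times borel_measurable_indicator)
  moreover have "L2_of (?s n) = cut (X n) u - u" for n
    by (simp add: L2_of_diff cut_square_integrable cut_eq)
  ultimately show "(\<lambda>n. cut (X n) u) \<longlonglongrightarrow> u" by (simp add: LIM_zero_iff)
qed

definition cut_FT :: "'a::euclidean_space L2 \<Rightarrow> real \<Rightarrow> 'a L2" where
  "cut_FT u R = L2_of (FT (\<lambda>x. indicator (cball 0 R) x * L2_fun u x))"

lemma fourier_L2_cut_FT: "fourier_L2 u = Lim at_top (cut_FT u)"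
proof -
  have "(LINT x:cball 0 R|lebesgue. wave x \<xi> * L2_fun u x)
     = FT (\<lambda>x. indicator (cball 0 R) x * L2_fun u x) \<xi>" for R \<xi>
    unfolding set_lebesgue_integral_def FT_def
    by (intro Bochner_Integration.integral_cong) (auto simp: indicator_def)
  then show ?thesis unfolding fourier_L2_def cut_FT_def[abs_def] by presburger
qed

lemma norm_FT_L2:
  fixes f :: "'a::euclidean_space \<Rightarrow> complex"
  assumes "integrable lebesgue f" "square_integrable f" "integrable lebesgue g" "square_integrable g"
  shows "norm (L2_of (FT f) - L2_of (FT g)) = sqrt (2 * pi) ^ DIM('a) * norm (L2_of f - L2_of g)"
proof -
  have "L2_of (FT f) - L2_of (FT g) = L2_of (FT (\<lambda>x. f x - g x))"
  proof -
    have "FT (\<lambda>x. f x - g x) = (\<lambda>\<xi>. FT f \<xi> - FT g \<xi>)" by (intro ext FT_diff assms)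
    then show ?thesis using assms by (simp add: Plancherel(1) L2_of_diff)
  qed
  also have "norm \<dots> = sqrt (2 * pi) ^ DIM('a) * norm (L2_of (\<lambda>x. f x - g x))"
    using assms by (intro Plancherel(2) square_integrable_diff Bochner_Integration.integrable_diff)
  finally show ?thesis using assms by (simp add: L2_of_diff)
qed

lemma norm_cut_FT_diff:
  fixes u :: "'a::euclidean_space L2"
  shows "norm (cut_FT u R - cut_FT u R') = sqrt (2 * pi) ^ DIM('a) * norm (cut R u - cut R' u)"
  unfolding cut_FT_def cut_eq by (intro norm_FT_L2 cut_integrable cut_square_integrable)

text \<open>
  The transform is isometric up to a factor on truncations, so the transforms of the truncations are
  Cauchy because the truncations are. Completeness gives a limit along the integers; the identity
  \<open>le\<close>, in which the limit has been taken in one of two radii, then gives convergence along all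
  real radii.
\<close>

lemma cut_FT_tendsto: "(cut_FT u \<longlongrightarrow> fourier_L2 u) at_top"
  for u :: "'a::euclidean_space L2"
proof -
  let ?c = "sqrt (2 * pi) ^ DIM('a)"
  have c: "0 < ?c" by simp
  have seq: "(\<lambda>n. cut (real n) u) \<longlonglongrightarrow> u"
    using filterlim_compose[OF cut_tendsto filterlim_real_sequentially] .
  have "Cauchy (\<lambda>n. cut_FT u (real n))"
  proof (rule metric_CauchyI)
    fix e :: real assume "0 < e"
    then have "0 < e / ?c" by simp
    then obtain M where M: "\<And>m n. m \<ge> M \<Longrightarrow> n \<ge> M \<Longrightarrow> norm (cut (real m) u - cut (real n) u) < e / ?c"
      using metric_CauchyD[OF LIMSEQ_imp_Cauchy[OF seq], of "e / ?c"] by (auto simp: dist_norm)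
    have "dist (cut_FT u (real m)) (cut_FT u (real n)) < e" if "m \<ge> M" "n \<ge> M" for m n
      using M[OF that] by (simp add: dist_norm norm_cut_FT_diff field_simps)
    then show "\<exists>M. \<forall>m\<ge>M. \<forall>n\<ge>M. dist (cut_FT u (real m)) (cut_FT u (real n)) < e" by blast
  qed
  then obtain l where l: "(\<lambda>n. cut_FT u (real n)) \<longlonglongrightarrow> l" by (meson Cauchy_convergent_iff convergent_def)
  have le: "norm (cut_FT u R - l) = ?c * norm (cut R u - u)" for R
  proof (rule LIMSEQ_unique)
    show "(\<lambda>n. norm (cut_FT u R - cut_FT u (real n))) \<longlonglongrightarrow> norm (cut_FT u R - l)"
      by (intro tendsto_intros l)
    show "(\<lambda>n. norm (cut_FT u R - cut_FT u (real n))) \<longlonglongrightarrow> ?c * norm (cut R u - u)"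
      unfolding norm_cut_FT_diff by (intro tendsto_intros seq)
  qed
  have "((\<lambda>R. ?c * norm (cut R u - u)) \<longlongrightarrow> ?c * norm (u - u)) at_top"
    by (intro tendsto_intros cut_tendsto)
  then have "((\<lambda>R. norm (cut_FT u R - l)) \<longlongrightarrow> 0) at_top" by (simp add: le)
  then have "(cut_FT u \<longlongrightarrow> l) at_top" by (simp add: tendsto_norm_zero_iff LIM_zero_iff)
  then show ?thesis unfolding fourier_L2_cut_FT by (metis tendsto_Lim trivial_limit_at_top_linorder)
qed

lemma norm_fourier_L2: "norm (fourier_L2 u) = sqrt (2 * pi) ^ DIM('a) * norm u"
  for u :: "'a::euclidean_space L2"
proof (rule tendsto_unique[OF trivial_limit_at_top_linorder])
  show "((\<lambda>R. norm (cut_FT u R)) \<longlongrightarrow> norm (fourier_L2 u)) at_top" by (intro tendsto_intros cut_FT_tendsto)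
  have "norm (cut_FT u R) = sqrt (2 * pi) ^ DIM('a) * norm (cut R u)" for R
    unfolding cut_FT_def cut_eq by (intro Plancherel(2) cut_integrable cut_square_integrable)
  then show "((\<lambda>R. norm (cut_FT u R)) \<longlongrightarrow> sqrt (2 * pi) ^ DIM('a) * norm u) at_top"
    by simp (intro tendsto_intros cut_tendsto)
qed

lemma cut_FT_add: "cut_FT (u + v) R = cut_FT u R + cut_FT v R"
proof -
  let ?t = "\<lambda>u x. indicator (cball 0 R) x * L2_fun u x"
  have "FT (?t (u + v)) = FT (\<lambda>x. ?t u x + ?t v x)"
  proof (rule FT_cong_AE)
    show "AE x in lebesgue. ?t (u + v) x = ?t u x + ?t v x"
      using L2_fun_add[of u v] by eventually_elim (simp add: distrib_left)
  qed (auto intro!: borel_measurable_times borel_measurable_add borel_measurable_indicator)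
  also have "\<dots> = (\<lambda>\<xi>. FT (?t u) \<xi> + FT (?t v) \<xi>)"
    by (intro ext FT_add cut_integrable)
  finally show ?thesis
    unfolding cut_FT_def by (simp add: L2_of_add Plancherel(1) cut_integrable cut_square_integrable)
qed

lemma cut_FT_scaleC: "cut_FT (scaleC_L2 a u) R = scaleC_L2 a (cut_FT u R)"
proof -
  let ?t = "\<lambda>u x. indicator (cball 0 R) x * L2_fun u x"
  have "FT (?t (scaleC_L2 a u)) = FT (\<lambda>x. a * ?t u x)"
  proof (rule FT_cong_AE)
    show "AE x in lebesgue. ?t (scaleC_L2 a u) x = a * ?t u x"
      using L2_fun_Mul[OF bounded_symbol_const, of a u] unfolding scaleC_L2_Mul by eventually_elim simp
  qed (auto intro!: borel_measurable_times borel_measurable_indicator)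
  also have "\<dots> = (\<lambda>\<xi>. a * FT (?t u) \<xi>)" by (intro ext FT_cmult)
  finally show ?thesis
    unfolding cut_FT_def scaleC_L2_Mul by (simp add: Mul_L2_of Plancherel(1) cut_integrable cut_square_integrable)
qed

lemma fourier_L2_add: "fourier_L2 (u + v) = fourier_L2 u + fourier_L2 v"
proof (rule tendsto_unique[OF trivial_limit_at_top_linorder cut_FT_tendsto])
  show "(cut_FT (u + v) \<longlongrightarrow> fourier_L2 u + fourier_L2 v) at_top"
    unfolding cut_FT_add[abs_def] by (intro tendsto_intros cut_FT_tendsto)
qed

lemma fourier_L2_scaleC: "fourier_L2 (scaleC_L2 a u) = scaleC_L2 a (fourier_L2 u)"
proof (rule tendsto_unique[OF trivial_limit_at_top_linorder cut_FT_tendsto])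
  show "(cut_FT (scaleC_L2 a u) \<longlongrightarrow> scaleC_L2 a (fourier_L2 u)) at_top"
    unfolding cut_FT_scaleC[abs_def] unfolding scaleC_L2_Mul
    by (intro bounded_linear.tendsto[OF bounded_linear_Mul] cut_FT_tendsto) simp
qed

lemma scaleR_scaleC_L2: "r *\<^sub>R u = scaleC_L2 (complex_of_real r) u"
  using L2_of_scaleR[of "L2_fun u" r] by (simp add: scaleC_L2_def)

lemma fourier_L2_scaleR: "fourier_L2 (r *\<^sub>R u) = r *\<^sub>R fourier_L2 u"
  by (simp only: scaleR_scaleC_L2 fourier_L2_scaleC)

lemma bounded_linear_fourier_L2: "bounded_linear (fourier_L2 :: 'a::euclidean_space L2 \<Rightarrow> 'a L2)"
  by (rule bounded_linear_intro[where K="sqrt (2 * pi) ^ DIM('a)"])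
     (simp_all add: fourier_L2_add fourier_L2_scaleR norm_fourier_L2 mult.commute)

lemma fourier_L2_of:
  assumes "integrable lebesgue f" "square_integrable f"
  shows "fourier_L2 (L2_of f) = L2_of (FT f)"
proof -
  let ?u = "L2_of f" and ?c = "sqrt (2 * pi) ^ DIM('a)"
  have "((\<lambda>R. ?c * norm (cut R ?u - ?u)) \<longlongrightarrow> ?c * norm (?u - ?u)) at_top"
    by (intro tendsto_intros cut_tendsto)
  moreover have "norm (cut_FT ?u R - L2_of (FT f)) = ?c * norm (cut R ?u - ?u)" for R
    unfolding cut_FT_def cut_eq by (intro norm_FT_L2 cut_integrable cut_square_integrable assms)
  ultimately have "((\<lambda>R. norm (cut_FT ?u R - L2_of (FT f))) \<longlongrightarrow> 0) at_top" by simp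
  then have "(cut_FT ?u \<longlongrightarrow> L2_of (FT f)) at_top" by (simp add: tendsto_norm_zero_iff LIM_zero_iff)
  then show ?thesis using cut_FT_tendsto tendsto_unique[OF trivial_limit_at_top_linorder] by blast
qed

subsection \<open>Inversion\<close>

definition conj_L2 :: "'a::euclidean_space L2 \<Rightarrow> 'a L2" where
  "conj_L2 u = L2_of (\<lambda>x. cnj (L2_fun u x))"

lemma square_integrable_cnj: "square_integrable f \<Longrightarrow> square_integrable (\<lambda>x. cnj (f x))"
  by (rule square_integrable_mono(1)) (auto simp: square_integrable_def)

lemma conj_L2_of: "square_integrable f \<Longrightarrow> conj_L2 (L2_of f) = L2_of (\<lambda>x. cnj (f x))"
  unfolding conj_L2_def using L2_fun_L2_of[of f]
  by (intro L2_of_cong_AE square_integrable_cnj) auto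

lemma conj_L2_add: "conj_L2 (u + v) = conj_L2 u + conj_L2 v"
proof -
  have "conj_L2 (u + v) = conj_L2 (L2_of (\<lambda>x. L2_fun u x + L2_fun v x))" by (simp add: L2_of_add)
  also have "\<dots> = L2_of (\<lambda>x. cnj (L2_fun u x) + cnj (L2_fun v x))"
    by (subst conj_L2_of) (auto intro: square_integrable_add)
  also have "\<dots> = conj_L2 u + conj_L2 v" unfolding conj_L2_def by (intro L2_of_add square_integrable_cnj) auto
  finally show ?thesis .
qed

lemma conj_L2_scaleC: "conj_L2 (scaleC_L2 a u) = scaleC_L2 (cnj a) (conj_L2 u)"
proof -
  have "conj_L2 (scaleC_L2 a u) = L2_of (\<lambda>x. cnj a * cnj (L2_fun u x))"
    unfolding scaleC_L2_def by (subst conj_L2_of) (auto intro: square_integrable_cmult)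
  also have "\<dots> = scaleC_L2 (cnj a) (conj_L2 u)"
    unfolding conj_L2_def scaleC_L2_Mul by (subst Mul_L2_of) (auto intro: square_integrable_cnj)
  finally show ?thesis .
qed

lemma norm_conj_L2: "norm (conj_L2 u) = norm u"
proof -
  have "(norm (conj_L2 u))\<^sup>2 = (norm (L2_of (L2_fun u)))\<^sup>2"
    unfolding conj_L2_def by (simp only: norm_L2_of square_integrable_cnj square_integrable_L2_fun complex_mod_cnj)
  then show ?thesis by simp
qed

lemma bounded_linear_conj_L2: "bounded_linear conj_L2"
  by (rule bounded_linear_intro[where K=1]) (simp_all add: conj_L2_add scaleR_scaleC_L2 conj_L2_scaleC norm_conj_L2)

text \<open>
  The Hilbert space adjoint of the transform: it has the kernel \<open>exp (\<i> x \<bullet> \<xi>)\<close>, which is the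
  conjugate of the original one.
\<close>

definition adj_fourier :: "'a::euclidean_space L2 \<Rightarrow> 'a L2" where
  "adj_fourier v = conj_L2 (fourier_L2 (conj_L2 v))"

lemma norm_adj_fourier: "norm (adj_fourier v) = sqrt (2 * pi) ^ DIM('a) * norm v"
  for v :: "'a::euclidean_space L2"
  by (simp add: adj_fourier_def norm_conj_L2 norm_fourier_L2)

lemma bounded_linear_adj_fourier: "bounded_linear (adj_fourier :: 'a::euclidean_space L2 \<Rightarrow> 'a L2)"
  unfolding adj_fourier_def[abs_def]
  by (intro bounded_linear_compose[OF bounded_linear_conj_L2] bounded_linear_compose[OF bounded_linear_fourier_L2]
      bounded_linear_conj_L2)

lemma adj_fourier_scaleC: "adj_fourier (scaleC_L2 a v) = scaleC_L2 a (adj_fourier v)"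
  by (simp add: adj_fourier_def conj_L2_scaleC fourier_L2_scaleC)

lemma FT_multiplication_formula:
  fixes f g :: "'a::euclidean_space \<Rightarrow> complex"
  assumes "integrable lebesgue f" "integrable lebesgue g"
  shows "(\<integral>x. FT f x * g x \<partial>lebesgue) = (\<integral>x. f x * FT g x \<partial>lebesgue)"
proof -
  obtain f' where f': "f' \<in> borel_measurable borel" "AE x in lebesgue. f x = f' x"
    using borel_representative[OF borel_measurable_integrable[OF assms(1)]] .
  obtain g' where g': "g' \<in> borel_measurable borel" "AE x in lebesgue. g x = g' x"
    using borel_representative[OF borel_measurable_integrable[OF assms(2)]] .
  note [measurable] = f'(1) g'(1) borel_measurable_integrable[OF assms(1)] borel_measurable_integrable[OF assms(2)]
  have meas [measurable]: "f' \<in> borel_measurable lebesgue" "g' \<in> borel_measurable lebesgue" using f' g' by auto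
  have F: "FT f = FT f'" "FT g = FT g'" by (rule FT_cong_AE; measurable; fail | rule FT_cong_AE, measurable, (rule f' g')+)+
  have [measurable]: "FT f' \<in> borel_measurable borel" "FT g' \<in> borel_measurable borel"
    by (rule FT_measurable_borel; measurable)+
  have [measurable]: "FT f' \<in> borel_measurable lebesgue" "FT g' \<in> borel_measurable lebesgue" by auto
  have int: "integrable lborel f'" "integrable lborel g'"
  proof -
    have "integrable lebesgue f = integrable lebesgue f'" using f'(2) by (intro integrable_cong_AE) auto
    then show "integrable lborel f'" using assms integrable_completion[of f' lborel] f' by simp
    have "integrable lebesgue g = integrable lebesgue g'" using g'(2) by (intro integrable_cong_AE) auto
    then show "integrable lborel g'" using assms integrable_completion[of g' lborel] g' by simp
  qed
  let ?e = "\<lambda>y x. wave y x"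
  have e: "(\<lambda>(x, y). ?e y x) \<in> borel_measurable (lborel \<Otimes>\<^sub>M (lborel :: 'a measure))"
    unfolding lborel_prod by (simp add: case_prod_beta') (intro borel_measurable_continuous_onI continuous_intros)
  have "integrable (lborel \<Otimes>\<^sub>M lborel) (\<lambda>(y, x). f' y * g' x)"
  proof (rule lborel_pair.Fubini_integrable)
    show "integrable lborel (\<lambda>y. \<integral>x. norm (case (y, x) of (y, x) \<Rightarrow> f' y * g' x) \<partial>lborel)"
      using integrable_mult_left[OF integrable_norm[OF int(1)]] by (simp add: norm_mult)
  qed (use int in auto)
  then have int2: "integrable (lborel \<Otimes>\<^sub>M lborel) (\<lambda>(y, x). ?e x y * (f' y * g' x))"
    using integrable_mult_bounded[OF _ e, of "\<lambda>(y, x). f' y * g' x" 1]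
    by (simp add: case_prod_beta')
  have "(\<integral>x. FT f x * g x \<partial>lebesgue) = (\<integral>x. FT f' x * g' x \<partial>lebesgue)"
    unfolding F by (rule integral_cong_AE; use g'(2) in \<open>(measurable; fail) | (eventually_elim, simp)\<close>)
  also have "\<dots> = (\<integral>x. FT f' x * g' x \<partial>lborel)" by (rule integral_completion) measurable
  also have "\<dots> = (\<integral>x. (\<integral>y. ?e x y * (f' y * g' x) \<partial>lborel) \<partial>lborel)"
  proof (rule Bochner_Integration.integral_cong[OF refl])
    fix x
    have "FT f' x * g' x = (\<integral>y. (?e y x * f' y) * g' x \<partial>lborel)"
      unfolding FT_borel[OF f'(1)] by (rule integral_mult_left_zero[symmetric])
    then show "FT f' x * g' x = (\<integral>y. ?e x y * (f' y * g' x) \<partial>lborel)"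
      by (simp only: mult.assoc inner_commute)
  qed
  also have "\<dots> = (\<integral>y. (\<integral>x. ?e x y * (f' y * g' x) \<partial>lborel) \<partial>lborel)"
    using lborel_pair.Fubini_integral[OF int2] by simp
  also have "\<dots> = (\<integral>y. f' y * FT g' y \<partial>lborel)"
  proof (rule Bochner_Integration.integral_cong[OF refl])
    fix y
    have "f' y * FT g' y = (\<integral>x. f' y * (?e x y * g' x) \<partial>lborel)"
      unfolding FT_borel[OF g'(1)] by (rule integral_mult_right_zero[symmetric])
    then show "(\<integral>x. ?e x y * (f' y * g' x) \<partial>lborel) = f' y * FT g' y"
      by (simp only: mult.left_commute)
  qed
  also have "\<dots> = (\<integral>y. f' y * FT g' y \<partial>lebesgue)" by (rule integral_completion[symmetric]) measurable
  also have "\<dots> = (\<integral>y. f y * FT g y \<partial>lebesgue)"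
    unfolding F by (rule integral_cong_AE; use f'(2) in \<open>(measurable; fail) | (eventually_elim, simp)\<close>)
  finally show ?thesis .
qed

lemma adj_fourier_L2_of:
  assumes "integrable lebesgue g" "square_integrable g"
  shows "adj_fourier (L2_of g) = L2_of (\<lambda>x. cnj (FT (\<lambda>y. cnj (g y)) x))"
proof -
  have i: "integrable lebesgue (\<lambda>y. cnj (g y))" using assms(1) by simp
  note s = square_integrable_cnj[OF assms(2)]
  show ?thesis
    unfolding adj_fourier_def by (simp add: conj_L2_of assms fourier_L2_of[OF i s] Plancherel(1)[OF i s])
qed

lemma inner_fourier_L2_integrable:
  assumes f: "integrable lebesgue f" "square_integrable f" and g: "integrable lebesgue g" "square_integrable g"
  shows "inner (fourier_L2 (L2_of f)) (L2_of g) = inner (L2_of f) (adj_fourier (L2_of g))"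
proof -
  have i: "integrable lebesgue (\<lambda>y. cnj (g y))" using g(1) by simp
  note s = square_integrable_cnj[OF g(2)]
  have "inner (fourier_L2 (L2_of f)) (L2_of g) = Re (\<integral>x. FT f x * cnj (g x) \<partial>lebesgue)"
    by (simp add: fourier_L2_of[OF f] inner_L2_of Plancherel(1)[OF f] g)
  also have "\<dots> = Re (\<integral>x. f x * FT (\<lambda>y. cnj (g y)) x \<partial>lebesgue)"
    by (simp add: FT_multiplication_formula[OF f(1) i])
  also have "\<dots> = inner (L2_of f) (adj_fourier (L2_of g))"
    by (simp add: adj_fourier_L2_of[OF g] inner_L2_of f square_integrable_cnj[OF Plancherel(1)[OF i s]])
  finally show ?thesis .
qed

text \<open>
  Both sides are continuous, and truncations are integrable, so the multiplication formula for
  integrable functions suffices.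
\<close>

lemma inner_fourier_L2: "inner (fourier_L2 u) v = inner u (adj_fourier v)"
proof (rule tendsto_unique[OF trivial_limit_at_top_linorder])
  note W = bounded_linear_fourier_L2 and A = bounded_linear_adj_fourier
  show "((\<lambda>R. inner (fourier_L2 (cut R u)) (cut R v)) \<longlongrightarrow> inner (fourier_L2 u) v) at_top"
    by (intro tendsto_inner bounded_linear.tendsto[OF W] cut_tendsto)
  have "inner (fourier_L2 (cut R u)) (cut R v) = inner (cut R u) (adj_fourier (cut R v))" for R
    unfolding cut_eq by (intro inner_fourier_L2_integrable cut_integrable cut_square_integrable)
  then show "((\<lambda>R. inner (fourier_L2 (cut R u)) (cut R v)) \<longlongrightarrow> inner u (adj_fourier v)) at_top"
    by simp (intro tendsto_inner bounded_linear.tendsto[OF A] cut_tendsto)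
qed

lemma inner_scaled_isometry:
  fixes A :: "'b::real_inner \<Rightarrow> 'c::real_inner"
  assumes "linear A" "\<And>x. norm (A x) = c * norm x"
  shows "inner (A x) (A y) = c\<^sup>2 * inner x y"
  using assms(2)[of "x + y"] assms(2)[of x] assms(2)[of y]
  unfolding dot_norm[of "A x"] dot_norm[of x] linear_add[OF assms(1), symmetric]
  by (simp add: power_mult_distrib right_diff_distrib)

lemma sqrt_power_square: "(sqrt (2 * pi) ^ n)\<^sup>2 = (2 * pi) ^ n"
proof -
  have "(sqrt (2 * pi) ^ n)\<^sup>2 = ((sqrt (2 * pi))\<^sup>2) ^ n" by (metis power_mult mult.commute)
  then show ?thesis by simp
qed

text \<open>
  An isometry up to a factor preserves inner products up to its square. Applied to the adjoint, this
  reads \<open>\<langle>W W\<^sup>* v, w\<rangle> = \<langle>W\<^sup>* v, W\<^sup>* w\<rangle> = (2 \<pi>)\<^sup>n \<langle>v, w\<rangle>\<close>, which gives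
  surjectivity of the transform \<open>W\<close>.
\<close>

lemma fourier_adj_fourier: "fourier_L2 (adj_fourier v) = ((2 * pi) ^ DIM('a)) *\<^sub>R v"
  for v :: "'a::euclidean_space L2"
proof -
  note lin = bounded_linear.linear[OF bounded_linear_adj_fourier]
  have "\<forall>w. inner (fourier_L2 (adj_fourier v)) w = inner (((2 * pi) ^ DIM('a)) *\<^sub>R v) w"
    unfolding inner_fourier_L2 inner_scaled_isometry[OF lin norm_adj_fourier] sqrt_power_square by simp
  then show ?thesis by (rule vector_eq_rdot[THEN iffD1])
qed

lemma inner_fourier_fourier: "inner (fourier_L2 u) (fourier_L2 v) = (2 * pi) ^ DIM('a) * inner u v"
  for u v :: "'a::euclidean_space L2"
  using inner_scaled_isometry[OF bounded_linear.linear[OF bounded_linear_fourier_L2] norm_fourier_L2]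
  by (simp only: sqrt_power_square)

lemma inj_fourier_L2: "inj (fourier_L2 :: 'a::euclidean_space L2 \<Rightarrow> 'a L2)"
proof (rule injI)
  fix u v :: "'a L2" assume "fourier_L2 u = fourier_L2 v"
  then have "fourier_L2 (u - v) = 0"
    by (simp add: linear_diff[OF bounded_linear.linear[OF bounded_linear_fourier_L2]])
  then show "u = v" using norm_fourier_L2[of "u - v"] by simp
qed

lemma inv_fourier_L2: "inv fourier_L2 v = (1 / (2 * pi) ^ DIM('a)) *\<^sub>R adj_fourier v"
  for v :: "'a::euclidean_space L2"
proof (rule inv_f_eq[OF inj_fourier_L2])
  show "fourier_L2 ((1 / (2 * pi) ^ DIM('a)) *\<^sub>R adj_fourier v) = v"
    by (simp add: fourier_L2_scaleR fourier_adj_fourier)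
qed

lemma fourier_inv_fourier [simp]: "fourier_L2 (inv fourier_L2 v) = v"
  unfolding inv_fourier_L2
  by (simp add: fourier_L2_scaleR fourier_adj_fourier)

lemma inv_fourier_fourier [simp]: "inv fourier_L2 (fourier_L2 u) = u"
  by (rule inv_f_f[OF inj_fourier_L2])

lemma bounded_clinear_fourier_L2: "bounded_clinear_L2 (fourier_L2 :: 'a::euclidean_space L2 \<Rightarrow> 'a L2)"
  unfolding bounded_clinear_L2_def using bounded_linear_fourier_L2 fourier_L2_scaleC by blast

lemma bounded_clinear_inv_fourier: "bounded_clinear_L2 (inv fourier_L2 :: 'a::euclidean_space L2 \<Rightarrow> 'a L2)"
proof -
  have "bounded_clinear_L2 (adj_fourier :: 'a L2 \<Rightarrow> 'a L2)"
    unfolding bounded_clinear_L2_def using bounded_linear_adj_fourier adj_fourier_scaleC by blast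
  from bounded_clinear_L2_compose[OF bounded_clinear_L2_Mul[OF bounded_symbol_const] this]
  show ?thesis unfolding inv_fourier_L2[abs_def] scaleR_scaleC_L2 scaleC_L2_Mul .
qed

section \<open>A Remez-type inequality on a segment\<close>

text \<open>
  The localisation between the extreme zeros is what makes the induction work: each new zero lies
  strictly to the right of the ones found before.
\<close>

lemma Rolle_zeros:
  fixes f f' :: "real \<Rightarrow> real"
  assumes "finite Z" and deriv: "\<And>x. (f has_real_derivative f' x) (at x)"
    and "\<And>z. z \<in> Z \<Longrightarrow> f z = 0" and "Z \<noteq> {}"
  shows "\<exists>Z'. finite Z' \<and> Suc (card Z') = card Z \<and> Z' \<subseteq> {Min Z..Max Z} \<and> (\<forall>z\<in>Z'. f' z = 0)"
  using assms(1,3,4)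
proof (induction rule: finite_linorder_max_induct)
  case (insert b A)
  show ?case
  proof (cases "A = {}")
    case True
    then show ?thesis by (intro exI[of _ "{}"]) auto
  next
    case False
    then obtain Z' where Z': "finite Z'" "Suc (card Z') = card A" "Z' \<subseteq> {Min A..Max A}" "\<forall>z\<in>Z'. f' z = 0"
      using insert.IH insert.prems by auto
    have less: "Max A < b" using insert False by auto
    obtain z where z: "Max A < z" "z < b" "f b - f (Max A) = (b - Max A) * f' z"
      using MVT2[OF less, of f f'] deriv by blast
    have "f b = 0" "f (Max A) = 0" using insert False by auto
    then have "f' z = 0" using z less by simp
    have "z \<notin> Z'" using z Z' by auto
    have "b \<notin> A" using insert by auto
    have mM: "Min (insert b A) = Min A" "Max (insert b A) = b"
      using insert(1,2) False less Min_in[of A] by (auto intro!: min_absorb2 max_absorb1 simp: less_imp_le)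
    have "Min A \<le> Max A" using insert(1) False by simp
    then show ?thesis
      using Z' z \<open>f' z = 0\<close> \<open>z \<notin> Z'\<close> \<open>b \<notin> A\<close> insert(1) less unfolding mM
      by (intro exI[of _ "insert z Z'"]) auto
  qed
qed simp

lemma Rolle_iterated:
  fixes h :: "nat \<Rightarrow> real \<Rightarrow> real"
  assumes "\<And>k x. (h k has_real_derivative h (Suc k) x) (at x)"
    and "finite Z" "card Z = Suc m" "\<And>z. z \<in> Z \<Longrightarrow> h 0 z = 0" "Z \<subseteq> {a..b}"
  shows "\<exists>\<xi>\<in>{a..b}. h m \<xi> = 0"
  using assms
proof (induction m arbitrary: h Z)
  case 0
  then obtain z where "z \<in> Z" by fastforce
  then show ?case using 0 by blast
next
  case (Suc m)
  have "Z \<noteq> {}" using Suc.prems by auto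
  then obtain Z' where Z': "finite Z'" "Suc (card Z') = card Z" "Z' \<subseteq> {Min Z..Max Z}" "\<forall>z\<in>Z'. h (Suc 0) z = 0"
    using Rolle_zeros[OF Suc.prems(2), of "h 0" "h (Suc 0)"] Suc.prems by auto
  have "Min Z \<in> Z" "Max Z \<in> Z" using Suc.prems \<open>Z \<noteq> {}\<close> by auto
  then have "{Min Z..Max Z} \<subseteq> {a..b}" using Suc.prems(5) by auto
  then have "Z' \<subseteq> {a..b}" using Z'(3) by (rule order_trans[rotated])
  then show ?case
    using Suc.IH[of "\<lambda>k. h (Suc k)" Z'] Z' Suc.prems by simp
qed

text \<open>
  The left side is the coefficient of top degree of the polynomial of degree at most \<open>m\<close> that
  interpolates \<open>g 0\<close> on \<open>X\<close>. The interpolation error has \<open>m + 1\<close> zeros, so its \<open>m\<close>-th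
  derivative vanishes somewhere.
\<close>

lemma divided_difference_mean_value:
  fixes g :: "nat \<Rightarrow> real \<Rightarrow> real"
  assumes g: "\<And>k x. (g k has_real_derivative g (Suc k) x) (at x)"
    and X: "finite X" "card X = Suc m" "X \<subseteq> {a..b}"
  shows "\<exists>\<xi>\<in>{a..b}. (\<Sum>x\<in>X. g 0 x / (\<Prod>y\<in>X - {x}. (x - y))) = g m \<xi> / fact m"
proof -
  define D where "D x = (\<Prod>y\<in>X - {x}. (x - y))" for x
  define q where "q x = (\<Prod>y\<in>X - {x}. [:- y, 1:])" for x
  define p where "p = (\<Sum>x\<in>X. smult (g 0 x / D x) (q x))"
  have D0: "D x \<noteq> 0" for x unfolding D_def using X by auto
  have deg_q: "degree (q x) = m" and lead_q: "coeff (q x) m = 1" if "x \<in> X" for x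
  proof -
    have "degree (q x) = (\<Sum>y\<in>X - {x}. degree [:- y, 1:])"
      unfolding q_def by (rule degree_prod_eq_sum_degree) auto
    then show *: "degree (q x) = m" using X that by (simp add: card_Diff_singleton)
    have "lead_coeff (q x) = (\<Prod>y\<in>X - {x}. lead_coeff [:- y, 1:])"
      unfolding q_def by (rule lead_coeff_prod)
    then show "coeff (q x) m = 1" using * by simp
  qed
  have deg_p: "degree p \<le> m"
    unfolding p_def using deg_q X by (intro degree_sum_le) (auto intro: order_trans[OF degree_smult_le])
  have coeff_p: "coeff p m = (\<Sum>x\<in>X. g 0 x / D x)"
    unfolding p_def by (simp add: coeff_sum lead_q)
  have poly_q: "poly (q x) z = (if x = z then D x else 0)" if "x \<in> X" "z \<in> X" for x z
    using X that by (auto simp: q_def D_def poly_prod)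
  have poly_p: "poly p z = g 0 z" if "z \<in> X" for z
  proof -
    have "poly p z = (\<Sum>x\<in>X. if x = z then g 0 z else 0)"
      unfolding p_def poly_sum using that by (intro sum.cong) (auto simp: poly_q D0)
    then show ?thesis using X that by simp
  qed
  define h where "h k t = g k t - poly ((pderiv ^^ k) p) t" for k t
  have "(h k has_real_derivative h (Suc k) x) (at x)" for k x
    unfolding h_def[abs_def] by (auto intro!: derivative_eq_intros g poly_DERIV)
  then obtain \<xi> where \<xi>: "\<xi> \<in> {a..b}" "h m \<xi> = 0"
    using Rolle_iterated[of h X m a b] X by (auto simp: h_def poly_p)
  have "degree ((pderiv ^^ m) p) = 0" using deg_p by (simp add: degree_higher_pderiv)
  then obtain c where c: "(pderiv ^^ m) p = [:c:]" by (metis degree_eq_zeroE)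
  have "coeff ((pderiv ^^ m) p) 0 = fact m * coeff p m"
    by (simp add: coeff_higher_pderiv pochhammer_fact)
  then have "g m \<xi> = fact m * coeff p m"
    using \<xi> by (simp add: h_def c)
  then show ?thesis using \<xi> unfolding coeff_p D_def
    by (intro bexI[of _ \<xi>]) auto
qed

text \<open>
  The derivative of \<open>|f|\<^sup>2\<close> is bounded by \<open>|f|\<^sup>2 + |f'|\<^sup>2\<close>, so \<open>|f|\<^sup>2\<close> at \<open>\<xi>\<close> exceeds
  its value at any other point by at most the integral of this bound; averaging over that other point
  gives the claim.
\<close>

lemma sup_le_H1_norm:
  fixes f f' :: "real \<Rightarrow> complex"
  assumes L: "0 < L" and f: "\<And>x. (f has_vector_derivative f' x) (at x)"
    and f': "continuous_on UNIV f'" and \<xi>: "\<xi> \<in> {0..L}"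
  shows "(cmod (f \<xi>))\<^sup>2 \<le> (1 / L + 1) * integral {0..L} (\<lambda>x. (cmod (f x))\<^sup>2 + (cmod (f' x))\<^sup>2)"
proof -
  define w where "w x = (cmod (f x))\<^sup>2 + (cmod (f' x))\<^sup>2" for x
  define q where "q x = (cmod (f x))\<^sup>2" for x
  have contf: "continuous_on UNIV f"
    by (meson f continuous_at_imp_continuous_on has_vector_derivative_continuous)
  have w: "continuous_on S w" for S
    unfolding w_def using continuous_on_subset[OF contf] continuous_on_subset[OF f'] by (intro continuous_intros) auto
  have q: "continuous_on S q" for S
    unfolding q_def using continuous_on_subset[OF contf] by (intro continuous_intros) auto
  have qd: "(q has_real_derivative 2 * inner (f x) (f' x)) (at x)" for x
  proof -
    have "((\<lambda>x. inner (f x) (f x)) has_vector_derivative inner (f x) (f' x) + inner (f' x) (f x)) (at x)"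
      using f[of x] unfolding has_vector_derivative_def
      by (auto intro!: derivative_eq_intros simp: inner_add_right inner_commute algebra_simps)
    then show ?thesis
      unfolding q_def[abs_def] power2_norm_eq_inner has_real_derivative_iff_has_vector_derivative
      by (simp add: inner_commute)
  qed
  have qw: "\<bar>2 * inner (f x) (f' x)\<bar> \<le> w x" for x
  proof -
    have "\<bar>inner (f x) (f' x)\<bar> \<le> cmod (f x) * cmod (f' x)" by (rule Cauchy_Schwarz_ineq2)
    moreover have "2 * (cmod (f x) * cmod (f' x)) \<le> w x"
      unfolding w_def using sum_squares_bound[of "cmod (f x)" "cmod (f' x)"] by simp
    ultimately show ?thesis by linarith
  qed
  define J where "J = integral {0..L} w"
  have *: "\<bar>q t - q s\<bar> \<le> J" if "0 \<le> s" "s \<le> t" "t \<le> L" for s t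
  proof -
    have "((\<lambda>x. 2 * inner (f x) (f' x)) has_integral (q t - q s)) {s..t}"
      using that qd by (intro fundamental_theorem_of_calculus)
        (auto simp: has_real_derivative_iff_has_vector_derivative[symmetric] intro: has_field_derivative_at_within)
    moreover have "(w has_integral (integral {s..t} w)) {s..t}"
      using w by (intro integrable_integral integrable_continuous_real)
    ultimately have "norm (q t - q s) \<le> integral {s..t} w"
      by (intro has_integral_norm_bound_integral_component[where k=1, simplified] | 
          (metis (no_types, lifting) has_integral_integrable_integral integral_norm_bound_integral qw real_norm_def))
    also have "\<dots> \<le> J" unfolding J_def using that w
      by (intro integral_subset_le integrable_continuous_real) (auto simp: w_def)
    finally show ?thesis by simp
  qed
  have le: "q \<xi> \<le> q s + J" if "s \<in> {0..L}" for s
    using *[of s \<xi>] *[of \<xi> s] that \<xi> by (cases "s \<le> \<xi>") auto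
  have "integral {0..L} (\<lambda>s. q \<xi>) \<le> integral {0..L} (\<lambda>s. q s + J)"
    using le q by (intro integral_le integrable_continuous_real continuous_intros) auto
  then have "L * q \<xi> \<le> integral {0..L} q + L * J"
    using L q by (simp add: integral_add integrable_continuous_real)
  also have "integral {0..L} q \<le> J" unfolding J_def using q w
    by (intro integral_le integrable_continuous_real) (auto simp: q_def w_def)
  finally have "L * q \<xi> \<le> J + L * J" by simp
  then have "q \<xi> \<le> (J + L * J) / L" using L by (simp add: field_simps)
  also have "\<dots> = (1 / L + 1) * J" using L by (simp add: field_simps)
  finally show ?thesis by (simp add: q_def J_def w_def[abs_def])
qed

text \<open>
  Greedy choice. The open intervals of radius \<open>\<rho>\<close> around \<open>0\<close> and the nodes chosen so far have
  total length at most \<open>\<delta> / 2\<close>, so what remains of \<open>E\<close> has measure at least \<open>\<delta> / 2\<close> and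
  contains a point where \<open>\<phi>\<close> is at most \<open>2 / \<delta>\<close> times
  its integral over \<open>E\<close>. The point \<open>0\<close> is kept away because it
  serves as a further interpolation node.
\<close>

lemma separated_nodes:
  fixes E :: "real set" and \<phi> :: "real \<Rightarrow> real"
  assumes E: "E \<in> sets borel" "E \<subseteq> {0..L}" "\<delta> \<le> measure lborel E" "0 < \<delta>"
    and \<phi>: "continuous_on UNIV \<phi>" "\<And>x. 0 \<le> \<phi> x" and "j \<le> m"
  defines "\<rho> \<equiv> \<delta> / (4 * (real m + 1))" and "I \<equiv> (\<integral>x. indicator E x * \<phi> x \<partial>lborel)"
  shows "\<exists>X. finite X \<and> card X = j \<and> X \<subseteq> E \<and> (\<forall>x\<in>X. \<rho> \<le> \<bar>x\<bar> \<and> \<phi> x \<le> 2 / \<delta> * I)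
           \<and> (\<forall>x\<in>X. \<forall>y\<in>X. x \<noteq> y \<longrightarrow> \<rho> \<le> \<bar>x - y\<bar>)"
  using \<open>j \<le> m\<close>
proof (induction j)
  case 0
  show ?case by (intro exI[of _ "{}"]) auto
next
  case (Suc j)
  have \<rho>: "0 < \<rho>" unfolding \<rho>_def using E by simp
  obtain X where X: "finite X" "card X = j" "X \<subseteq> E" "\<And>x. x \<in> X \<Longrightarrow> \<rho> \<le> \<bar>x\<bar>"
    "\<And>x. x \<in> X \<Longrightarrow> \<phi> x \<le> 2 / \<delta> * I" "\<And>x y. x \<in> X \<Longrightarrow> y \<in> X \<Longrightarrow> x \<noteq> y \<Longrightarrow> \<rho> \<le> \<bar>x - y\<bar>"
    using Suc by auto
  define B where "B = (\<Union>x\<in>insert 0 X. {x - \<rho><..<x + \<rho>})"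
  define E' where "E' = E - B"
  have [measurable]: "E \<in> sets borel" by (rule E(1))
  have [measurable]: "B \<in> sets borel"
    unfolding B_def by (intro borel_open open_UN ballI open_greaterThanLessThan)
  have [measurable]: "E' \<in> sets borel" unfolding E'_def by measurable
  have [measurable]: "\<phi> \<in> borel_measurable borel" using \<phi>(1) by (rule borel_measurable_continuous_onI)
  have "bounded E" using E(2) bounded_subset bounded_closed_interval by blast
  then have fm: "E \<in> fmeasurable lborel" by (intro fmeasurableI emeasure_bounded_finite) simp
  have "bounded B" unfolding B_def using X(1)
    by (intro bounded_UN) auto
  then have fmB: "B \<in> fmeasurable lborel" by (intro fmeasurableI emeasure_bounded_finite) simp
  have "measure lborel B \<le> (\<Sum>x\<in>insert 0 X. measure lborel {x - \<rho><..<x + \<rho>})"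
    unfolding B_def using X(1) by (intro measure_UNION_le) auto
  also have "\<dots> = (\<Sum>x\<in>insert 0 X. 2 * \<rho>)" using \<rho> by (intro sum.cong) auto
  also have "\<dots> = card (insert 0 X) * (2 * \<rho>)" by (rule sum_constant)
  also have "\<dots> \<le> (real m + 1) * (2 * \<rho>)"
  proof (intro mult_right_mono)
    have "card (insert 0 X) \<le> Suc j" using X(1,2) by (simp add: card_insert_if)
    then show "real (card (insert 0 X)) \<le> real m + 1" using Suc.prems by linarith
  qed (use \<rho> in simp)
  also have "\<dots> = \<delta> / 2" unfolding \<rho>_def by (simp add: field_simps)
  finally have "measure lborel B \<le> \<delta> / 2" .
  moreover have "measure lborel E' \<ge> measure lborel E - measure lborel B"
  proof -
    have "measure lborel E \<le> measure lborel (E' \<union> B)"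
      using fm fmB fmeasurable_Diff[OF fm, of B] unfolding E'_def
      by (intro measure_mono_fmeasurable fmeasurable.Un) auto
    also have "\<dots> \<le> measure lborel E' + measure lborel B" by (intro measure_Un_le) auto
    finally show ?thesis by simp
  qed
  ultimately have mE': "\<delta> / 2 \<le> measure lborel E'" using E by linarith
  have int: "integrable lborel (\<lambda>x. indicator S x * \<phi> x)" if "S \<subseteq> {0..L}" "S \<in> sets borel" for S
  proof (rule Bochner_Integration.integrable_bound)
    show "integrable lborel (\<lambda>x. indicator {0..L} x * \<phi> x)"
      using borel_integrable_atLeastAtMost'[of 0 L \<phi>] continuous_on_subset[OF \<phi>(1)]
      by (simp add: set_integrable_def)
    show "AE x in lborel. norm (indicator S x * \<phi> x) \<le> norm (indicator {0..L} x * \<phi> x)"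
      using that(1) by (intro AE_I2) (auto simp: indicator_def)
    show "(\<lambda>x. indicator S x * \<phi> x) \<in> borel_measurable lborel" using that(2) by measurable
  qed
  have "\<exists>x\<in>E'. \<phi> x \<le> 2 / \<delta> * I"
  proof (rule ccontr)
    assume "\<not> ?thesis"
    then have gt: "\<And>x. x \<in> E' \<Longrightarrow> 2 / \<delta> * I < \<phi> x" by (meson not_le)
    have E'L: "E' \<subseteq> {0..L}" using E by (auto simp: E'_def)
    have fm': "E' \<in> fmeasurable lborel" unfolding E'_def by (intro fmeasurable_Diff fm) auto
    have int': "integrable lborel (\<lambda>x. indicator E' x * (2 / \<delta> * I))"
      using fm' by (intro integrable_mult_left) (simp add: fmeasurable_def)
    have "(\<integral>x. indicator E' x * \<phi> x - indicator E' x * (2 / \<delta> * I) \<partial>lborel)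
      = (\<integral>x. indicator E' x * \<phi> x \<partial>lborel) - measure lborel E' * (2 / \<delta> * I)"
      using int[OF E'L] int' by simp
    also have "(\<integral>x. indicator E' x * \<phi> x \<partial>lborel) \<le> I"
      unfolding I_def using int[OF E'L] int[OF E(2)] \<phi>(2)
      by (intro integral_mono) (auto simp: E'_def indicator_def)
    finally have "(\<integral>x. indicator E' x * \<phi> x - indicator E' x * (2 / \<delta> * I) \<partial>lborel) \<le> I - measure lborel E' * (2 / \<delta> * I)"
      by simp
    also have "\<dots> \<le> 0"
    proof -
      have "0 \<le> I" unfolding I_def using \<phi>(2) by simp
      then have "\<delta> / 2 * (2 / \<delta> * I) \<le> measure lborel E' * (2 / \<delta> * I)"
        using mE' E(4) by (intro mult_right_mono) auto
      then show ?thesis using E(4) by simp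
    qed
    finally have le0: "(\<integral>x. indicator E' x * \<phi> x - indicator E' x * (2 / \<delta> * I) \<partial>lborel) \<le> 0" .
    have nn: "0 \<le> indicator E' x * \<phi> x - indicator E' x * (2 / \<delta> * I)" for x
      using gt[of x] by (auto simp: indicator_def)
    then have "AE x in lborel. indicator E' x * \<phi> x - indicator E' x * (2 / \<delta> * I) = 0"
    proof (subst integral_nonneg_eq_0_iff_AE[symmetric])
      show "integrable lborel (\<lambda>x. indicator E' x * \<phi> x - indicator E' x * (2 / \<delta> * I))"
        by (rule Bochner_Integration.integrable_diff[OF int[OF E'L] int']) simp
      show "AE x in lborel. 0 \<le> indicator E' x * \<phi> x - indicator E' x * (2 / \<delta> * I)"
        using nn by (intro AE_I2)
      show "(\<integral>x. indicator E' x * \<phi> x - indicator E' x * (2 / \<delta> * I) \<partial>lborel) = 0"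
        using le0 by (rule antisym) (intro Bochner_Integration.integral_nonneg nn)
    qed
    then have "AE x in lborel. x \<notin> E'"
    proof eventually_elim
      case (elim x)
      then show ?case using gt[of x] by (cases "x \<in> E'") auto
    qed
    then have "emeasure lborel E' = 0" by (subst (asm) AE_iff_measurable[of E']) auto
    then show False using mE' E(4) by (simp add: measure_def)
  qed
  then obtain x where x: "x \<in> E'" "\<phi> x \<le> 2 / \<delta> * I" by blast
  have sep: "\<rho> \<le> \<bar>x - y\<bar>" if "y \<in> insert 0 X" for y
    using x(1) that unfolding E'_def B_def by (auto simp: abs_real_def)
  have "x \<notin> X" using sep[of x] \<rho> by auto
  then show ?case using X x sep sep[of 0]
    by (intro exI[of _ "insert x X"]) (auto simp: E'_def abs_minus_commute)
qed

text \<open>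
  Apply the mean value theorem for divided differences to \<open>m\<close> nodes in \<open>E\<close> together with \<open>0\<close> and
  solve for the value at \<open>0\<close>. The separation of the nodes bounds the coefficients, which only
  affects \<open>A\<close>. The derivative of order \<open>m\<close> enters with the factor \<open>L\<^sup>m / m!\<close>, independent of
  \<open>E\<close>; this is the only smallness that the later argument needs.
\<close>

lemma remez_taylor_inequality:
  assumes L: "0 < L" and \<delta>: "0 < \<delta>"
  shows "\<exists>A\<ge>0. \<forall>E (g :: nat \<Rightarrow> real \<Rightarrow> complex). E \<in> sets borel \<longrightarrow> E \<subseteq> {0..L} \<longrightarrow> \<delta> \<le> measure lborel E \<longrightarrow>
     (\<forall>k x. (g k has_vector_derivative g (Suc k) x) (at x)) \<longrightarrow>
     (cmod (g 0 0))\<^sup>2 \<le> A * (\<integral>x. indicator E x * (cmod (g 0 x))\<^sup>2 \<partial>lborel)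
       + 2 * (1 / L + 1) * (L ^ m / fact m)\<^sup>2 * integral {0..L} (\<lambda>x. (cmod (g m x))\<^sup>2 + (cmod (g (Suc m) x))\<^sup>2)"
proof -
  define \<rho> where "\<rho> = \<delta> / (4 * (real m + 1))"
  have \<rho>: "0 < \<rho>" using \<delta> by (simp add: \<rho>_def)
  define A where "A = 2 * (L ^ m * (real m / \<rho> ^ m))\<^sup>2 * (2 / \<delta>)"
  have A0: "0 \<le> A" using \<delta> by (simp add: A_def)
  show ?thesis
  proof (intro exI[of _ A] conjI A0 allI impI)
    fix E and g :: "nat \<Rightarrow> real \<Rightarrow> complex"
    assume E: "E \<in> sets borel" "E \<subseteq> {0..L}" "\<delta> \<le> measure lborel E"
      and g: "\<forall>k x. (g k has_vector_derivative g (Suc k) x) (at x)"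
    define I where "I = (\<integral>x. indicator E x * (cmod (g 0 x))\<^sup>2 \<partial>lborel)"
    have I0: "0 \<le> I" unfolding I_def by simp
    have contg: "continuous_on UNIV (g k)" for k
      by (meson g continuous_at_imp_continuous_on has_vector_derivative_continuous)
    obtain X where X: "finite X" "card X = m" "X \<subseteq> E" "\<And>x. x \<in> X \<Longrightarrow> \<rho> \<le> \<bar>x\<bar>"
      "\<And>x. x \<in> X \<Longrightarrow> (cmod (g 0 x))\<^sup>2 \<le> 2 / \<delta> * I" "\<And>x y. x \<in> X \<Longrightarrow> y \<in> X \<Longrightarrow> x \<noteq> y \<Longrightarrow> \<rho> \<le> \<bar>x - y\<bar>"
    proof -
      have "continuous_on UNIV (\<lambda>x. (cmod (g 0 x))\<^sup>2)" using contg[of 0] by (intro continuous_intros)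
      from separated_nodes[OF E \<delta> this _ order_refl, of m]
      have "\<exists>X. finite X \<and> card X = m \<and> X \<subseteq> E \<and> (\<forall>x\<in>X. \<rho> \<le> \<bar>x\<bar> \<and> (cmod (g 0 x))\<^sup>2 \<le> 2 / \<delta> * I)
           \<and> (\<forall>x\<in>X. \<forall>y\<in>X. x \<noteq> y \<longrightarrow> \<rho> \<le> \<bar>x - y\<bar>)"
        unfolding \<rho>_def I_def by simp
      then show ?thesis using that by blast
    qed
    (* Rolle's theorem is real, so g is rotated to be a nonnegative real number at 0 and replaced by its
       real part. *)
    obtain \<theta> where \<theta>: "cmod \<theta> = 1" "\<theta> * g 0 0 = complex_of_real (cmod (g 0 0))"
    proof (cases "g 0 0 = 0")
      case False
      define r where "r = cmod (g 0 0)"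
      have r: "r \<noteq> 0" using False by (simp add: r_def)
      have "cnj (g 0 0) / complex_of_real r * g 0 0 = complex_of_real (r\<^sup>2) / complex_of_real r"
        unfolding r_def by (subst complex_norm_square) simp
      also have "\<dots> = complex_of_real r" using r by (simp add: power2_eq_square)
      finally show ?thesis using that[of "cnj (g 0 0) / complex_of_real r"] r
        by (simp add: norm_divide r_def)
    qed (use that[of 1] in auto)
    define h where "h k x = Re (\<theta> * g k x)" for k x
    have hg: "\<bar>h k x\<bar> \<le> cmod (g k x)" for k x
      unfolding h_def using abs_Re_le_cmod[of "\<theta> * g k x"] \<theta> by (simp add: norm_mult)
    have h: "(h k has_real_derivative h (Suc k) x) (at x)" for k x
    proof -
      have "((\<lambda>x. Re (\<theta> * g k x)) has_vector_derivative Re (\<theta> * g (Suc k) x)) (at x)"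
        using g by (intro bounded_linear.has_vector_derivative[OF bounded_linear_Re] has_vector_derivative_mult_right) auto
      then show ?thesis unfolding h_def[abs_def] by (simp add: has_real_derivative_iff_has_vector_derivative)
    qed
    have 0: "0 \<notin> X" using X(4)[of 0] \<rho> by auto
    have Y: "finite (insert 0 X)" "card (insert 0 X) = Suc m" "insert 0 X \<subseteq> {0..L}"
      using X 0 E L by auto
    obtain \<xi> where \<xi>: "\<xi> \<in> {0..L}"
      "(\<Sum>x\<in>insert 0 X. h 0 x / (\<Prod>y\<in>insert 0 X - {x}. (x - y))) = h m \<xi> / fact m"
      using divided_difference_mean_value[of h, OF h Y] by auto
    define P where "P = (\<Prod>y\<in>X. (0 - y))"
    define Q where "Q x = (\<Prod>y\<in>insert 0 X - {x}. (x - y))" for x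
    have P0: "P \<noteq> 0" unfolding P_def using 0 X by auto
    have P: "\<bar>P\<bar> \<le> L ^ m"
    proof -
      have "(\<Prod>y\<in>X. \<bar>0 - y\<bar>) \<le> (\<Prod>y\<in>X. L)" using X(3) E(2) by (intro prod_mono) force
      then show ?thesis unfolding P_def abs_prod using X(2) by simp
    qed
    have Q: "\<rho> ^ m \<le> \<bar>Q x\<bar>" if "x \<in> X" for x
    proof -
      have "(\<Prod>y\<in>insert 0 X - {x}. \<rho>) \<le> (\<Prod>y\<in>insert 0 X - {x}. \<bar>x - y\<bar>)"
        using X(4,6) that \<rho> by (intro prod_mono) auto
      moreover have "card (insert 0 X - {x}) = m" using Y that 0 by (simp add: card_Diff_singleton)
      ultimately show ?thesis unfolding Q_def abs_prod by simp
    qed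
    have "(\<Sum>x\<in>insert 0 X. h 0 x / Q x) = h m \<xi> / fact m" using \<xi> by (simp add: Q_def)
    then have "h 0 0 / P + (\<Sum>x\<in>X. h 0 x / Q x) = h m \<xi> / fact m"
      using X(1) 0 by (simp add: Q_def P_def)
    then have "h 0 0 = P * (h m \<xi> / fact m - (\<Sum>x\<in>X. h 0 x / Q x))"
      using P0 by (simp add: field_simps)
    then have "\<bar>h 0 0\<bar> = \<bar>P\<bar> * \<bar>h m \<xi> / fact m - (\<Sum>x\<in>X. h 0 x / Q x)\<bar>" by (simp add: abs_mult)
    also have "\<dots> \<le> L ^ m * (\<bar>h m \<xi> / fact m\<bar> + \<bar>\<Sum>x\<in>X. h 0 x / Q x\<bar>)"
      using P L by (intro mult_mono abs_triangle_ineq4) auto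
    also have "\<bar>\<Sum>x\<in>X. h 0 x / Q x\<bar> \<le> (\<Sum>x\<in>X. sqrt (2 / \<delta> * I) / \<rho> ^ m)"
    proof (intro order_trans[OF sum_abs] sum_mono)
      fix x assume x: "x \<in> X"
      have "\<bar>h 0 x\<bar> \<le> sqrt (2 / \<delta> * I)" using X(5)[OF x] hg[of 0 x] real_le_rsqrt order_trans by blast
      then show "\<bar>h 0 x / Q x\<bar> \<le> sqrt (2 / \<delta> * I) / \<rho> ^ m"
        unfolding abs_divide using Q[OF x] \<rho> I0 \<delta> by (intro frac_le) auto
    qed
    also have "(\<Sum>x\<in>X. sqrt (2 / \<delta> * I) / \<rho> ^ m) = real m / \<rho> ^ m * sqrt (2 / \<delta> * I)" using X by simp
    also have "\<bar>h m \<xi> / fact m\<bar> \<le> cmod (g m \<xi>) / fact m"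
      using hg[of m \<xi>] by (simp add: divide_right_mono)
    finally have "\<bar>h 0 0\<bar> \<le> L ^ m / fact m * cmod (g m \<xi>) + L ^ m * (real m / \<rho> ^ m) * sqrt (2 / \<delta> * I)"
      using L by (simp add: algebra_simps)
    moreover have "\<bar>h 0 0\<bar> = cmod (g 0 0)" unfolding h_def \<theta>(2) by simp
    ultimately have "(cmod (g 0 0))\<^sup>2 \<le> (L ^ m / fact m * cmod (g m \<xi>) + L ^ m * (real m / \<rho> ^ m) * sqrt (2 / \<delta> * I))\<^sup>2"
      by (intro power_mono) auto
    also have "\<dots> \<le> 2 * (L ^ m / fact m * cmod (g m \<xi>))\<^sup>2 + 2 * (L ^ m * (real m / \<rho> ^ m) * sqrt (2 / \<delta> * I))\<^sup>2"
      using sum_squares_bound[of "L ^ m / fact m * cmod (g m \<xi>)" "L ^ m * (real m / \<rho> ^ m) * sqrt (2 / \<delta> * I)"]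
      by (simp add: power2_sum)
    also have "(L ^ m * (real m / \<rho> ^ m) * sqrt (2 / \<delta> * I))\<^sup>2 = (L ^ m * (real m / \<rho> ^ m))\<^sup>2 * (2 / \<delta> * I)"
      using I0 \<delta> by (subst power_mult_distrib) simp
    also have "2 * ((L ^ m * (real m / \<rho> ^ m))\<^sup>2 * (2 / \<delta> * I)) = A * I" by (simp add: A_def)
    also have "(L ^ m / fact m * cmod (g m \<xi>))\<^sup>2
      \<le> (L ^ m / fact m)\<^sup>2 * ((1 / L + 1) * integral {0..L} (\<lambda>x. (cmod (g m x))\<^sup>2 + (cmod (g (Suc m) x))\<^sup>2))"
      unfolding power_mult_distrib[of _ "cmod (g m \<xi>)"] using g \<xi>(1) contg
      by (intro mult_left_mono sup_le_H1_norm[OF L]) auto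
    finally show "(cmod (g 0 0))\<^sup>2 \<le> A * (\<integral>x. indicator E x * (cmod (g 0 x))\<^sup>2 \<partial>lborel)
       + 2 * (1 / L + 1) * (L ^ m / fact m)\<^sup>2 * integral {0..L} (\<lambda>x. (cmod (g m x))\<^sup>2 + (cmod (g (Suc m) x))\<^sup>2)"
      by (simp only: I_def mult_ac add_ac)
  qed
qed

section \<open>The spectral inequality\<close>

text \<open>
  Band-limited functions are handled as transforms \<open>FT v\<close> of such \<open>v\<close>; they are smooth and the
  differentiation along \<open>b\<close> is the multiplication of \<open>v\<close> by \<open>- \<i> (\<xi> \<bullet> b)\<close>, whose powers are
  \<open>symbol_power\<close>.
\<close>

definition supported_in_ball :: "real \<Rightarrow> ('a::euclidean_space \<Rightarrow> complex) \<Rightarrow> bool" where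
  "supported_in_ball \<Lambda> v \<longleftrightarrow> square_integrable v \<and> (\<forall>\<xi>. \<Lambda> < norm \<xi> \<longrightarrow> v \<xi> = 0)"

lemma supported_in_ball_integrable:
  assumes "supported_in_ball \<Lambda> v"
  shows "integrable lebesgue v"
proof -
  have "integrable lebesgue (\<lambda>x. indicator (cball 0 \<Lambda>) x * v x)"
    using assms by (intro integrable_indicator_mult) (auto simp: supported_in_ball_def)
  moreover have "(\<lambda>x. indicator (cball 0 \<Lambda>) x * v x) = v"
    using assms by (force simp: supported_in_ball_def indicator_def not_le)
  ultimately show ?thesis by simp
qed

lemma symbol_le_on_ball:
  fixes b :: "'a::euclidean_space"
  assumes "supported_in_ball \<Lambda> v" "b \<in> Basis"
  shows "cmod ((- \<i> * complex_of_real (\<xi> \<bullet> b)) ^ m * v \<xi>) \<le> \<Lambda> ^ m * cmod (v \<xi>)"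
proof (cases "v \<xi> = 0")
  case False
  then have "norm \<xi> \<le> \<Lambda>" using assms by (force simp: supported_in_ball_def not_le)
  then have "\<bar>\<xi> \<bullet> b\<bar> \<le> \<Lambda>" using Basis_le_norm[OF assms(2), of \<xi>] by simp
  then have "\<bar>\<xi> \<bullet> b\<bar> ^ m \<le> \<Lambda> ^ m" by (intro power_mono) auto
  then show ?thesis by (simp add: norm_mult norm_power mult_right_mono)
qed simp

lemma symbol_measurable:
  fixes b :: "'a::euclidean_space"
  shows "(\<lambda>\<xi>. (- \<i> * complex_of_real (\<xi> \<bullet> b)) ^ m) \<in> borel_measurable lebesgue"
  by (intro lebesgue_measurable_if_borel borel_measurable_continuous_onI continuous_intros)

definition symbol_power :: "'a::euclidean_space \<Rightarrow> nat \<Rightarrow> ('a \<Rightarrow> complex) \<Rightarrow> 'a \<Rightarrow> complex" where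
  "symbol_power b m v \<xi> = (- \<i> * complex_of_real (\<xi> \<bullet> b)) ^ m * v \<xi>"

lemma
  fixes b :: "'a::euclidean_space"
  assumes v: "supported_in_ball \<Lambda> v" and b: "b \<in> Basis" and "0 \<le> \<Lambda>"
  shows supported_symbol_power: "supported_in_ball \<Lambda> (symbol_power b m v)"
    and norm_symbol_power: "norm (L2_of (symbol_power b m v)) \<le> \<Lambda> ^ m * norm (L2_of v)"
proof -
  have sv: "square_integrable v" and [measurable]: "v \<in> borel_measurable lebesgue"
    using v by (auto simp: supported_in_ball_def square_integrable_def)
  note [measurable] = symbol_measurable
  have sq: "square_integrable (\<lambda>\<xi>. complex_of_real (\<Lambda> ^ m) * v \<xi>)" by (rule square_integrable_cmult[OF sv])
  have m: "symbol_power b m v \<in> borel_measurable lebesgue" unfolding symbol_power_def[abs_def] by measurable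
  have ae: "AE \<xi> in lebesgue. cmod (symbol_power b m v \<xi>) \<le> cmod (complex_of_real (\<Lambda> ^ m) * v \<xi>)"
    using symbol_le_on_ball[OF v b] \<open>0 \<le> \<Lambda>\<close> by (simp add: symbol_power_def norm_mult norm_power)
  note * = square_integrable_mono[OF sq m ae]
  show "supported_in_ball \<Lambda> (symbol_power b m v)"
    unfolding supported_in_ball_def
  proof (intro conjI allI impI)
    show "square_integrable (symbol_power b m v)" by (rule *(1))
  qed (use v in \<open>simp add: supported_in_ball_def symbol_power_def\<close>)
  show "norm (L2_of (symbol_power b m v)) \<le> \<Lambda> ^ m * norm (L2_of v)"
    using *(2) \<open>0 \<le> \<Lambda>\<close> unfolding L2_of_scaleR[OF sv] by simp
qed

text \<open>
  The Taylor bound \<open>|exp (\<i> \<theta>) - 1 - \<i> \<theta>| \<le> \<theta>\<^sup>2\<close> under the integral gives a quadratic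
  remainder, uniformly because the frequencies are bounded by \<open>\<Lambda>\<close>.
\<close>

lemma FT_has_derivative_along:
  fixes b :: "'a::euclidean_space"
  assumes w: "supported_in_ball \<Lambda> w" and b: "b \<in> Basis" and "0 \<le> \<Lambda>"
  shows "((\<lambda>s. FT w (x + s *\<^sub>R b)) has_vector_derivative FT (symbol_power b 1 w) (x + s *\<^sub>R b)) (at s)"
  unfolding has_vector_derivative_def
proof (rule has_derivativeI_sandwich[where e=1])
  let ?w1 = "symbol_power b 1 w"
  have wi: "integrable lebesgue w" by (rule supported_in_ball_integrable[OF w])
  have w1i: "integrable lebesgue ?w1"
    by (rule supported_in_ball_integrable[OF supported_symbol_power[OF w b \<open>0 \<le> \<Lambda>\<close>]])
  define C where "C = \<Lambda>\<^sup>2 * (\<integral>\<xi>. cmod (w \<xi>) \<partial>lebesgue)"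
  show "bounded_linear (\<lambda>t. t *\<^sub>R FT ?w1 (x + s *\<^sub>R b))" by (rule bounded_linear_scaleR_left)
  have bd: "cmod (FT w (x + t *\<^sub>R b) - FT w (x + s *\<^sub>R b) - (t - s) *\<^sub>R FT ?w1 (x + s *\<^sub>R b)) \<le> (t - s)\<^sup>2 * C" for t
  proof -
    let ?y = "x + s *\<^sub>R b"
    let ?e = "\<lambda>\<xi>. wave \<xi> ?y"
    let ?R = "\<lambda>\<xi>. exp (- \<i> * complex_of_real ((t - s) * (\<xi> \<bullet> b))) - 1 + \<i> * complex_of_real ((t - s) * (\<xi> \<bullet> b))"
    have "FT w (x + t *\<^sub>R b) - FT w ?y - (t - s) *\<^sub>R FT ?w1 ?y
      = (\<integral>\<xi>. exp (- \<i> * complex_of_real (\<xi> \<bullet> (x + t *\<^sub>R b))) * w \<xi> \<partial>lebesgue) - (\<integral>\<xi>. ?e \<xi> * w \<xi> \<partial>lebesgue)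
        - (\<integral>\<xi>. (t - s) *\<^sub>R (?e \<xi> * ?w1 \<xi>) \<partial>lebesgue)"
      unfolding FT_def by (subst integral_scaleR_right) simp_all
    also have "\<dots> = (\<integral>\<xi>. exp (- \<i> * complex_of_real (\<xi> \<bullet> (x + t *\<^sub>R b))) * w \<xi> - ?e \<xi> * w \<xi> - (t - s) *\<^sub>R (?e \<xi> * ?w1 \<xi>) \<partial>lebesgue)"
    proof -
      note i1 = integrable_FT_integrand[OF wi, of "x + t *\<^sub>R b"] and i2 = integrable_FT_integrand[OF wi, of ?y]
        and i3 = integrable_scaleR_right[OF integrable_FT_integrand[OF w1i, of ?y], of "t - s"]
      show ?thesis
        unfolding Bochner_Integration.integral_diff[OF Bochner_Integration.integrable_diff[OF i1 i2] i3]
          Bochner_Integration.integral_diff[OF i1 i2] ..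
    qed
    also have "\<dots> = (\<integral>\<xi>. ?e \<xi> * ?R \<xi> * w \<xi> \<partial>lebesgue)"
    proof (rule Bochner_Integration.integral_cong[OF refl])
      fix \<xi>
      have "exp (- \<i> * complex_of_real (\<xi> \<bullet> (x + t *\<^sub>R b))) = ?e \<xi> * exp (- \<i> * complex_of_real ((t - s) * (\<xi> \<bullet> b)))"
        unfolding exp_add[symmetric] by (intro arg_cong[of _ _ exp]) (simp add: inner_add_right algebra_simps)
      then show "exp (- \<i> * complex_of_real (\<xi> \<bullet> (x + t *\<^sub>R b))) * w \<xi> - ?e \<xi> * w \<xi> - (t - s) *\<^sub>R (?e \<xi> * ?w1 \<xi>) = ?e \<xi> * ?R \<xi> * w \<xi>"
        by (simp add: symbol_power_def scaleR_conv_of_real algebra_simps)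
    qed
    finally have eq: "FT w (x + t *\<^sub>R b) - FT w ?y - (t - s) *\<^sub>R FT ?w1 ?y = (\<integral>\<xi>. ?e \<xi> * ?R \<xi> * w \<xi> \<partial>lebesgue)" .
    have "cmod (\<integral>\<xi>. ?e \<xi> * ?R \<xi> * w \<xi> \<partial>lebesgue) \<le> (\<integral>\<xi>. cmod (?e \<xi> * ?R \<xi> * w \<xi>) \<partial>lebesgue)"
      by (rule integral_norm_bound)
    also have "\<dots> \<le> (\<integral>\<xi>. (t - s)\<^sup>2 * \<Lambda>\<^sup>2 * cmod (w \<xi>) \<partial>lebesgue)"
    proof (rule integral_mono')
      show "integrable lebesgue (\<lambda>\<xi>. (t - s)\<^sup>2 * \<Lambda>\<^sup>2 * cmod (w \<xi>))" using wi by simp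
      fix \<xi>
      show "cmod (?e \<xi> * ?R \<xi> * w \<xi>) \<le> (t - s)\<^sup>2 * \<Lambda>\<^sup>2 * cmod (w \<xi>)"
      proof (cases "w \<xi> = 0")
        case False
        then have "norm \<xi> \<le> \<Lambda>" using w by (force simp: supported_in_ball_def not_le)
        then have *: "\<bar>\<xi> \<bullet> b\<bar> \<le> \<Lambda>" using Basis_le_norm[OF b, of \<xi>] by simp
        define \<theta> where "\<theta> = (t - s) * (\<xi> \<bullet> b)"
        have R: "?R \<xi> = iexp (- \<theta>) - (\<Sum>k\<le>1. (\<i> * complex_of_real (- \<theta>)) ^ k / fact k)"
          unfolding \<theta>_def[symmetric] by simp
        have "cmod (?R \<xi>) \<le> \<bar>- \<theta>\<bar> ^ Suc 1 / fact (Suc 1)" unfolding R by (rule iexp_approx1)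
        also have "\<dots> = \<bar>- ((t - s) * (\<xi> \<bullet> b))\<bar> ^ 2 / 2" by (simp add: \<theta>_def numeral_2_eq_2)
        also have "\<dots> \<le> (t - s)\<^sup>2 * (\<xi> \<bullet> b)\<^sup>2" by (simp add: power_mult_distrib)
        also have "\<dots> \<le> (t - s)\<^sup>2 * \<Lambda>\<^sup>2" using * power_mono[OF *, of 2] by (intro mult_left_mono) auto
        finally show ?thesis by (simp add: norm_mult mult_right_mono)
      qed simp
    qed simp
    also have "\<dots> = (t - s)\<^sup>2 * C" by (simp add: C_def)
    finally show ?thesis unfolding eq .
  qed
  show "norm (FT w (x + t *\<^sub>R b) - FT w (x + s *\<^sub>R b) - (t - s) *\<^sub>R FT ?w1 (x + s *\<^sub>R b)) / norm (t - s) \<le> \<bar>t - s\<bar> * C"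
    if "t \<noteq> s" for t
    using bd[of t] that by (simp add: pos_divide_le_eq power2_eq_square mult_ac)
  have "((\<lambda>t. \<bar>t - s\<bar> * C) \<longlongrightarrow> \<bar>s - s\<bar> * C) (at s)" by (intro tendsto_intros)
  then show "((\<lambda>t. \<bar>t - s\<bar> * C) \<longlongrightarrow> 0) (at s)" by simp
qed simp

definition FT_mass :: "'a set \<Rightarrow> ('a::euclidean_space \<Rightarrow> complex) \<Rightarrow> ennreal" where
  "FT_mass S v = (\<integral>\<^sup>+x. indicator S x * ennreal ((cmod (FT v x))\<^sup>2) \<partial>lborel)"

lemma FT_mass_UNIV:
  assumes "supported_in_ball \<Lambda> v"
  shows "FT_mass UNIV v = ennreal ((norm (L2_of (FT v)))\<^sup>2)"
  using assms norm_L2_of_nn[OF Plancherel(1)[OF supported_in_ball_integrable[OF assms]]]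
  by (simp add: FT_mass_def supported_in_ball_def nn_integral_completion)

lemma FT_mass_mono: "S \<subseteq> S' \<Longrightarrow> FT_mass S v \<le> FT_mass S' v"
  unfolding FT_mass_def by (intro nn_integral_mono mult_right_mono) (auto simp: indicator_def)

text \<open>
  Bernstein's inequality in the mean: on the Fourier side a derivative of order \<open>m\<close> is a
  multiplication by a factor of modulus at most \<open>\<Lambda>\<^sup>m\<close>.
\<close>

lemma FT_mass_symbol_power:
  fixes b :: "'a::euclidean_space"
  assumes v: "supported_in_ball \<Lambda> v" and b: "b \<in> Basis" and l: "0 \<le> \<Lambda>"
  shows "FT_mass UNIV (symbol_power b m v) \<le> ennreal (\<Lambda> ^ (2 * m)) * FT_mass UNIV v"
proof -
  note w = supported_symbol_power[OF v b l, of m]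
  have "norm (L2_of (FT (symbol_power b m v))) \<le> \<Lambda> ^ m * norm (L2_of (FT v))"
  proof -
    have P: "norm (L2_of (FT w)) = sqrt (2 * pi) ^ DIM('a) * norm (L2_of w)" if "supported_in_ball \<Lambda> w" for w :: "'a \<Rightarrow> complex"
      using that by (intro Plancherel(2) supported_in_ball_integrable[OF that]) (simp add: supported_in_ball_def)
    show ?thesis
      using mult_left_mono[OF norm_symbol_power[OF v b l, of m], of "sqrt (2 * pi) ^ DIM('a)"]
      unfolding P[OF v] P[OF w] by (simp add: mult.left_commute)
  qed
  then have "(norm (L2_of (FT (symbol_power b m v))))\<^sup>2 \<le> (\<Lambda> ^ m * norm (L2_of (FT v)))\<^sup>2"
    by (intro power_mono) auto
  also have "\<dots> = \<Lambda> ^ (2 * m) * (norm (L2_of (FT v)))\<^sup>2"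
    by (simp add: power_mult_distrib power_mult[symmetric] mult.commute)
  finally show ?thesis
    using l unfolding FT_mass_UNIV[OF v] FT_mass_UNIV[OF w] by (simp add: ennreal_mult[symmetric] ennreal_leI)
qed

text \<open>
  Averaging over all segments parallel to \<open>b\<close> amounts to averaging over translations, and
  these preserve the measure.
\<close>

lemma nn_integral_sliding:
  fixes h :: "'a::euclidean_space \<Rightarrow> ennreal"
  assumes [measurable]: "h \<in> borel_measurable borel" and "0 \<le> L"
  shows "(\<integral>\<^sup>+x. (\<integral>\<^sup>+s. indicator {0..L} s * h (x + s *\<^sub>R b) \<partial>lborel) \<partial>lborel) = ennreal L * (\<integral>\<^sup>+x. h x \<partial>lborel)"
proof -
  have "(\<integral>\<^sup>+x. (\<integral>\<^sup>+s. indicator {0..L} s * h (x + s *\<^sub>R b) \<partial>lborel) \<partial>lborel)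
    = (\<integral>\<^sup>+s. (\<integral>\<^sup>+x. indicator {0..L} s * h (x + s *\<^sub>R b) \<partial>lborel) \<partial>lborel)"
    by (rule lborel_pair.Fubini') measurable
  also have "\<dots> = (\<integral>\<^sup>+s. indicator {0..L} s * (\<integral>\<^sup>+x. h x \<partial>lborel) \<partial>lborel)"
  proof (rule nn_integral_cong)
    fix s
    have "(\<integral>\<^sup>+x. h (x + s *\<^sub>R b) \<partial>lborel) = (\<integral>\<^sup>+x. h x \<partial>lborel)"
      by (subst (2) lborel_distr_plus[symmetric, of "s *\<^sub>R b"]) (simp add: nn_integral_distr add.commute)
    then show "(\<integral>\<^sup>+x. indicator {0..L} s * h (x + s *\<^sub>R b) \<partial>lborel) = indicator {0..L} s * (\<integral>\<^sup>+x. h x \<partial>lborel)"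
      by (subst nn_integral_cmult) auto
  qed
  also have "\<dots> = ennreal L * (\<integral>\<^sup>+x. h x \<partial>lborel)"
    using \<open>0 \<le> L\<close> by (subst nn_integral_multc) auto
  finally show ?thesis .
qed

lemma ennreal_integral_le_nn_integral:
  fixes f :: "'b \<Rightarrow> real"
  assumes "f \<in> borel_measurable M" "\<And>x. 0 \<le> f x"
  shows "ennreal (\<integral>x. f x \<partial>M) \<le> (\<integral>\<^sup>+x. ennreal (f x) \<partial>M)"
  using assms by (subst integral_eq_nn_integral) (auto simp: ennreal_enn2real_if)

text \<open>
  The points at which a band-limited function is controlled by its values on \<open>\<omega>\<close> along the
  segment that starts there.
\<close>

definition segment_thickening :: "real \<Rightarrow> real \<Rightarrow> 'a::euclidean_space \<Rightarrow> 'a set \<Rightarrow> 'a set" where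
  "segment_thickening L \<delta> b \<omega> = {x. ennreal \<delta> \<le> emeasure lborel {s \<in> {0..L}. x + s *\<^sub>R b \<in> \<omega>}}"

lemma emeasure_slice:
  fixes b :: "'a::euclidean_space"
  assumes [measurable]: "\<omega> \<in> sets borel"
  shows "{s \<in> {0..L}. x + s *\<^sub>R b \<in> \<omega>} \<in> sets borel"
    and "emeasure lborel {s \<in> {0..L}. x + s *\<^sub>R b \<in> \<omega>} = (\<integral>\<^sup>+s. indicator {0..L} s * indicator \<omega> (x + s *\<^sub>R b) \<partial>lborel)"
proof -
  show *: "{s \<in> {0..L}. x + s *\<^sub>R b \<in> \<omega>} \<in> sets borel" by measurable
  have "emeasure lborel {s \<in> {0..L}. x + s *\<^sub>R b \<in> \<omega>} = (\<integral>\<^sup>+s. indicator {s \<in> {0..L}. x + s *\<^sub>R b \<in> \<omega>} s \<partial>lborel)"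
    using * by simp
  also have "\<dots> = (\<integral>\<^sup>+s. indicator {0..L} s * indicator \<omega> (x + s *\<^sub>R b) \<partial>lborel)"
    by (intro nn_integral_cong) (auto simp: indicator_def)
  finally show "emeasure lborel {s \<in> {0..L}. x + s *\<^sub>R b \<in> \<omega>} = (\<integral>\<^sup>+s. indicator {0..L} s * indicator \<omega> (x + s *\<^sub>R b) \<partial>lborel)" .
qed

lemma segment_thickening_borel:
  fixes b :: "'a::euclidean_space"
  assumes [measurable]: "\<omega> \<in> sets borel"
  shows "segment_thickening L \<delta> b \<omega> \<in> sets borel"
proof -
  have "(\<lambda>x. \<integral>\<^sup>+s. indicator {0..L} s * indicator \<omega> (x + s *\<^sub>R b) \<partial>lborel) \<in> borel_measurable borel"
    by measurable
  then show ?thesis unfolding segment_thickening_def emeasure_slice(2)[OF assms] by measurable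
qed

definition observable_from :: "real \<Rightarrow> 'a::euclidean_space set \<Rightarrow> bool" where
  "observable_from \<Lambda> \<omega> \<longleftrightarrow> (\<exists>C\<ge>0. \<forall>v. supported_in_ball \<Lambda> v \<longrightarrow> FT_mass UNIV v \<le> ennreal C * FT_mass \<omega> v)"

lemma small_remainder:
  fixes L \<Lambda> \<eta> :: real
  assumes "0 < L" "0 < \<eta>" "0 \<le> \<Lambda>"
  shows "\<exists>m::nat. 2 * (1 / L + 1) * (L ^ m / fact m)\<^sup>2 * (L * (\<Lambda> ^ (2 * m) + \<Lambda> ^ (2 * Suc m))) \<le> \<eta>"
proof -
  have s: "(\<lambda>m. (L * \<Lambda>) ^ m / fact m) \<longlonglongrightarrow> 0"
    using summable_LIMSEQ_zero[OF summable_exp[of "L * \<Lambda>"]] by (simp add: field_simps)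
  have "(\<lambda>m. 2 * (1 / L + 1) * ((L * \<Lambda>) ^ m / fact m)\<^sup>2 * (L * (1 + \<Lambda>\<^sup>2))) \<longlonglongrightarrow> 2 * (1 / L + 1) * 0\<^sup>2 * (L * (1 + \<Lambda>\<^sup>2))"
    by (intro tendsto_intros s)
  then have "\<forall>\<^sub>F m in sequentially. 2 * (1 / L + 1) * ((L * \<Lambda>) ^ m / fact m)\<^sup>2 * (L * (1 + \<Lambda>\<^sup>2)) < \<eta>"
    using assms by (intro order_tendstoD(2)) auto
  then obtain m where "2 * (1 / L + 1) * ((L * \<Lambda>) ^ m / fact m)\<^sup>2 * (L * (1 + \<Lambda>\<^sup>2)) < \<eta>"
    by (auto simp: eventually_sequentially)
  moreover have "2 * (1 / L + 1) * ((L * \<Lambda>) ^ m / fact m)\<^sup>2 * (L * (1 + \<Lambda>\<^sup>2))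
    = 2 * (1 / L + 1) * (L ^ m / fact m)\<^sup>2 * (L * (\<Lambda> ^ (2 * m) + \<Lambda> ^ (2 * Suc m)))"
  proof -
    have "\<Lambda> ^ (2 * m) = (\<Lambda> ^ m)\<^sup>2" "\<Lambda> ^ (2 * Suc m) = (\<Lambda> ^ m)\<^sup>2 * \<Lambda>\<^sup>2"
      unfolding mult.commute[of 2] power_mult by (simp_all add: power_mult_distrib)
    moreover have "((L * \<Lambda>) ^ m / fact m)\<^sup>2 = (L ^ m / fact m)\<^sup>2 * (\<Lambda> ^ m)\<^sup>2"
      by (simp add: power_mult_distrib power_divide)
    ultimately show ?thesis by (simp only: distrib_left distrib_right mult_1_right mult_ac)
  qed
  ultimately have "2 * (1 / L + 1) * (L ^ m / fact m)\<^sup>2 * (L * (\<Lambda> ^ (2 * m) + \<Lambda> ^ (2 * Suc m))) < \<eta>"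
    by (simp only:)
  then show ?thesis by (blast intro: less_imp_le)
qed

text \<open>
  For \<open>x\<close> in the thickening, \<open>remez_taylor_inequality\<close> bounds \<open>|FT v x|\<^sup>2\<close> by integrals over
  the segment that starts at \<open>x\<close>. Integrating over \<open>x\<close> turns them into integrals over \<open>\<omega>\<close> and
  over the whole space, and the latter are controlled by Bernstein's inequality. Since
  \<open>(L \<Lambda>)\<^sup>m / m!\<close> tends to \<open>0\<close>, a suitable \<open>m\<close> makes the global term as small as desired.
\<close>

lemma segment_thickening_estimate:
  fixes b :: "'a::euclidean_space"
  assumes L: "0 < L" and \<delta>: "0 < \<delta>" and l: "0 \<le> \<Lambda>" and b: "b \<in> Basis"
    and \<omega> [measurable]: "\<omega> \<in> sets borel" and \<eta>: "0 < \<eta>"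
  shows "\<exists>A\<ge>0. \<forall>v. supported_in_ball \<Lambda> v \<longrightarrow>
    FT_mass (segment_thickening L \<delta> b \<omega>) v \<le> ennreal A * FT_mass \<omega> v + ennreal \<eta> * FT_mass UNIV v"
proof -
  obtain m :: nat where m: "2 * (1 / L + 1) * (L ^ m / fact m)\<^sup>2 * (L * (\<Lambda> ^ (2 * m) + \<Lambda> ^ (2 * Suc m))) \<le> \<eta>"
    using small_remainder[OF L \<eta> l] by blast
  define B where "B = 2 * (1 / L + 1) * (L ^ m / fact m)\<^sup>2"
  have B0: "0 \<le> B" using L by (simp add: B_def)
  obtain A where A0: "0 \<le> A" and A: "\<And>E (g :: nat \<Rightarrow> real \<Rightarrow> complex). E \<in> sets borel \<Longrightarrow> E \<subseteq> {0..L} \<Longrightarrow> \<delta> \<le> measure lborel E \<Longrightarrow>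
     (\<forall>k x. (g k has_vector_derivative g (Suc k) x) (at x)) \<Longrightarrow>
     (cmod (g 0 0))\<^sup>2 \<le> A * (\<integral>x. indicator E x * (cmod (g 0 x))\<^sup>2 \<partial>lborel)
       + B * integral {0..L} (\<lambda>x. (cmod (g m x))\<^sup>2 + (cmod (g (Suc m) x))\<^sup>2)"
    using remez_taylor_inequality[OF L \<delta>, of m] unfolding B_def by blast
  show ?thesis
  proof (intro exI[of _ "A * L"] conjI allI impI)
    show "0 \<le> A * L" using A0 L by simp
    fix v :: "'a \<Rightarrow> complex" assume v: "supported_in_ball \<Lambda> v"
    let ?\<omega>' = "segment_thickening L \<delta> b \<omega>"
    have [measurable]: "?\<omega>' \<in> sets borel" by (rule segment_thickening_borel) fact
    define V where "V k = symbol_power b k v" for k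
    have V: "supported_in_ball \<Lambda> (V k)" for k unfolding V_def by (rule supported_symbol_power[OF v b l])
    have V0: "V 0 = v" by (simp add: V_def symbol_power_def fun_eq_iff)
    have VS: "symbol_power b 1 (V k) = V (Suc k)" for k by (simp add: V_def symbol_power_def fun_eq_iff)
    have FTm [measurable]: "FT (V k) \<in> borel_measurable borel" for k
      using V[of k] by (intro FT_measurable) (simp add: supported_in_ball_def square_integrable_def)
    have FTv [measurable]: "FT v \<in> borel_measurable borel" using FTm[of 0] by (simp add: V0)
    define p where "p x = ennreal ((cmod (FT v x))\<^sup>2)" for x
    define q where "q x = ennreal ((cmod (FT (V m) x))\<^sup>2) + ennreal ((cmod (FT (V (Suc m)) x))\<^sup>2)" for x
    have [measurable]: "p \<in> borel_measurable borel" "q \<in> borel_measurable borel"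
      unfolding p_def[abs_def] q_def[abs_def] by measurable
    have pointwise: "indicator ?\<omega>' x * p x \<le> ennreal A * (\<integral>\<^sup>+s. indicator {0..L} s * (indicator \<omega> (x + s *\<^sub>R b) * p (x + s *\<^sub>R b)) \<partial>lborel)
        + ennreal B * (\<integral>\<^sup>+s. indicator {0..L} s * q (x + s *\<^sub>R b) \<partial>lborel)" for x
    proof (cases "x \<in> ?\<omega>'")
      case True
      define E where "E = {s \<in> {0..L}. x + s *\<^sub>R b \<in> \<omega>}"
      have E: "E \<in> sets borel" unfolding E_def by (rule emeasure_slice) fact
      note [measurable] = E
      have EL: "E \<subseteq> {0..L}" by (auto simp: E_def)
      have "emeasure lborel E \<noteq> \<infinity>" using emeasure_mono[OF EL, of lborel] L by (auto simp: top_unique)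
      moreover have "ennreal \<delta> \<le> emeasure lborel E"
        using True by (simp only: segment_thickening_def E_def mem_Collect_eq)
      ultimately have mE: "\<delta> \<le> measure lborel E" using \<delta> by (simp add: emeasure_eq_ennreal_measure)
      define g where "g k s = FT (V k) (x + s *\<^sub>R b)" for k s
      have g: "(g k has_vector_derivative g (Suc k) s) (at s)" for k s
        unfolding g_def[abs_def] using FT_has_derivative_along[OF V b l, of k x s] by (simp only: VS)
      have contg: "continuous_on UNIV (g k)" for k
        by (meson g continuous_at_imp_continuous_on has_vector_derivative_continuous)
      have [measurable]: "g k \<in> borel_measurable borel" for k by (rule borel_measurable_continuous_onI[OF contg])
      let ?I1 = "\<integral>s. indicator E s * (cmod (g 0 s))\<^sup>2 \<partial>lborel"
      let ?I2 = "integral {0..L} (\<lambda>s. (cmod (g m s))\<^sup>2 + (cmod (g (Suc m) s))\<^sup>2)"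
      have le: "(cmod (g 0 0))\<^sup>2 \<le> A * ?I1 + B * ?I2" using A[OF E EL mE, of g] g by blast
      have I1: "ennreal ?I1 \<le> (\<integral>\<^sup>+s. indicator {0..L} s * (indicator \<omega> (x + s *\<^sub>R b) * p (x + s *\<^sub>R b)) \<partial>lborel)"
      proof -
        have "ennreal ?I1 \<le> (\<integral>\<^sup>+s. ennreal (indicator E s * (cmod (g 0 s))\<^sup>2) \<partial>lborel)"
          by (rule ennreal_integral_le_nn_integral) auto
        also have "\<dots> = (\<integral>\<^sup>+s. indicator {0..L} s * (indicator \<omega> (x + s *\<^sub>R b) * p (x + s *\<^sub>R b)) \<partial>lborel)"
          by (intro nn_integral_cong) (auto simp: indicator_def E_def g_def V0 p_def)
        finally show ?thesis .
      qed
      have I2: "ennreal ?I2 \<le> (\<integral>\<^sup>+s. indicator {0..L} s * q (x + s *\<^sub>R b) \<partial>lborel)"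
      proof -
        have "set_integrable lborel {0..L} (\<lambda>s. (cmod (g m s))\<^sup>2 + (cmod (g (Suc m) s))\<^sup>2)"
          using continuous_on_subset[OF contg subset_UNIV] by (intro borel_integrable_atLeastAtMost' continuous_intros)
        from set_borel_integral_eq_integral(2)[OF this]
        have "?I2 = (\<integral>s. indicator {0..L} s * ((cmod (g m s))\<^sup>2 + (cmod (g (Suc m) s))\<^sup>2) \<partial>lborel)"
          by (simp add: set_lebesgue_integral_def)
        then have "ennreal ?I2 \<le> (\<integral>\<^sup>+s. ennreal (indicator {0..L} s * ((cmod (g m s))\<^sup>2 + (cmod (g (Suc m) s))\<^sup>2)) \<partial>lborel)"
          by (simp only:) (rule ennreal_integral_le_nn_integral, auto)
        also have "\<dots> = (\<integral>\<^sup>+s. indicator {0..L} s * q (x + s *\<^sub>R b) \<partial>lborel)"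
          by (intro nn_integral_cong) (auto simp: indicator_def g_def q_def ennreal_plus)
        finally show ?thesis .
      qed
      have "?I1 \<ge> 0" by (intro Bochner_Integration.integral_nonneg) auto
      moreover have "?I2 \<ge> 0" by (intro Henstock_Kurzweil_Integration.integral_nonneg integrable_continuous_real continuous_intros continuous_on_subset[OF contg]) auto
      ultimately have "p x \<le> ennreal A * ennreal ?I1 + ennreal B * ennreal ?I2"
        using le A0 B0 by (simp add: ennreal_mult[symmetric] ennreal_plus[symmetric] p_def g_def V0 ennreal_leI del: ennreal_plus)
      also have "\<dots> \<le> ennreal A * (\<integral>\<^sup>+s. indicator {0..L} s * (indicator \<omega> (x + s *\<^sub>R b) * p (x + s *\<^sub>R b)) \<partial>lborel)
        + ennreal B * (\<integral>\<^sup>+s. indicator {0..L} s * q (x + s *\<^sub>R b) \<partial>lborel)"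
        by (intro add_mono mult_left_mono I1 I2) auto
      finally show ?thesis using True by simp
    qed simp
    have "FT_mass ?\<omega>' v \<le> (\<integral>\<^sup>+x. ennreal A * (\<integral>\<^sup>+s. indicator {0..L} s * (indicator \<omega> (x + s *\<^sub>R b) * p (x + s *\<^sub>R b)) \<partial>lborel)
        + ennreal B * (\<integral>\<^sup>+s. indicator {0..L} s * q (x + s *\<^sub>R b) \<partial>lborel) \<partial>lborel)"
      unfolding FT_mass_def p_def[symmetric] by (intro nn_integral_mono pointwise)
    also have "\<dots> = ennreal A * (\<integral>\<^sup>+x. (\<integral>\<^sup>+s. indicator {0..L} s * (indicator \<omega> (x + s *\<^sub>R b) * p (x + s *\<^sub>R b)) \<partial>lborel) \<partial>lborel)
        + ennreal B * (\<integral>\<^sup>+x. (\<integral>\<^sup>+s. indicator {0..L} s * q (x + s *\<^sub>R b) \<partial>lborel) \<partial>lborel)"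
      by (subst nn_integral_add) (auto simp: nn_integral_cmult)
    also have "(\<integral>\<^sup>+x. (\<integral>\<^sup>+s. indicator {0..L} s * (indicator \<omega> (x + s *\<^sub>R b) * p (x + s *\<^sub>R b)) \<partial>lborel) \<partial>lborel) = ennreal L * FT_mass \<omega> v"
      unfolding FT_mass_def p_def[symmetric] using L by (subst nn_integral_sliding) auto
    also have "(\<integral>\<^sup>+x. (\<integral>\<^sup>+s. indicator {0..L} s * q (x + s *\<^sub>R b) \<partial>lborel) \<partial>lborel) = ennreal L * (FT_mass UNIV (V m) + FT_mass UNIV (V (Suc m)))"
    proof -
      have "(\<integral>\<^sup>+x. q x \<partial>lborel) = FT_mass UNIV (V m) + FT_mass UNIV (V (Suc m))"
        unfolding q_def FT_mass_def by (subst nn_integral_add) auto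
      then show ?thesis using L by (subst nn_integral_sliding) auto
    qed
    also have "FT_mass UNIV (V m) + FT_mass UNIV (V (Suc m)) \<le> ennreal (\<Lambda> ^ (2 * m)) * FT_mass UNIV v + ennreal (\<Lambda> ^ (2 * Suc m)) * FT_mass UNIV v"
      unfolding V_def by (intro add_mono FT_mass_symbol_power[OF v b l])
    also have "\<dots> = ennreal (\<Lambda> ^ (2 * m) + \<Lambda> ^ (2 * Suc m)) * FT_mass UNIV v"
      using l by (simp add: distrib_right ennreal_plus)
    finally have "FT_mass ?\<omega>' v \<le> ennreal A * (ennreal L * FT_mass \<omega> v)
       + ennreal B * (ennreal L * (ennreal (\<Lambda> ^ (2 * m) + \<Lambda> ^ (2 * Suc m)) * FT_mass UNIV v))"
      by (simp add: mult_left_mono)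
    also have "\<dots> = ennreal (A * L) * FT_mass \<omega> v + ennreal (B * (L * (\<Lambda> ^ (2 * m) + \<Lambda> ^ (2 * Suc m)))) * FT_mass UNIV v"
      using A0 B0 L l by (simp only: ennreal_mult ennreal_mult' mult.assoc less_imp_le zero_le_power add_nonneg_nonneg mult_nonneg_nonneg)
    also have "\<dots> \<le> ennreal (A * L) * FT_mass \<omega> v + ennreal \<eta> * FT_mass UNIV v"
      using m unfolding B_def[symmetric] by (intro add_left_mono mult_right_mono ennreal_leI) auto
    finally show "FT_mass ?\<omega>' v \<le> ennreal (A * L) * FT_mass \<omega> v + ennreal \<eta> * FT_mass UNIV v" .
  qed
qed

text \<open>
  The global term of the estimate, taken with \<open>C \<eta> \<le> 1 / 2\<close>, is absorbed into the left side; this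
  uses that the total mass is finite.
\<close>

lemma observable_from_segment_thickening:
  fixes b :: "'a::euclidean_space"
  assumes L: "0 < L" and \<delta>: "0 < \<delta>" and l: "0 \<le> \<Lambda>" and b: "b \<in> Basis"
    and \<omega>: "\<omega> \<in> sets borel" and obs: "observable_from \<Lambda> (segment_thickening L \<delta> b \<omega>)"
  shows "observable_from \<Lambda> \<omega>"
proof -
  obtain C where C: "0 \<le> C" "\<And>v. supported_in_ball \<Lambda> v \<Longrightarrow> FT_mass UNIV v \<le> ennreal C * FT_mass (segment_thickening L \<delta> b \<omega>) v"
    using obs by (auto simp: observable_from_def)
  define \<eta> where "\<eta> = 1 / (2 * (C + 1))"
  have \<eta>: "0 < \<eta>" "C * \<eta> \<le> 1 / 2" using C by (simp_all add: \<eta>_def field_simps)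
  obtain A where A: "0 \<le> A" "\<And>v. supported_in_ball \<Lambda> v \<Longrightarrow>
    FT_mass (segment_thickening L \<delta> b \<omega>) v \<le> ennreal A * FT_mass \<omega> v + ennreal \<eta> * FT_mass UNIV v"
    using segment_thickening_estimate[OF L \<delta> l b \<omega> \<eta>(1)] by blast
  show ?thesis unfolding observable_from_def
  proof (intro exI[of _ "2 * (C * A)"] conjI allI impI)
    show "0 \<le> 2 * (C * A)" using A C by simp
    fix v :: "'a \<Rightarrow> complex" assume v: "supported_in_ball \<Lambda> v"
    define n where "n = (norm (L2_of (FT v)))\<^sup>2"
    have n: "0 \<le> n" "FT_mass UNIV v = ennreal n" using FT_mass_UNIV[OF v] by (simp_all add: n_def)
    have "FT_mass \<omega> v \<le> ennreal n" using FT_mass_mono[of \<omega> UNIV v] n by simp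
    then obtain w where w: "0 \<le> w" "FT_mass \<omega> v = ennreal w"
      by (cases "FT_mass \<omega> v") (auto simp: top_unique)
    have "FT_mass UNIV v \<le> ennreal C * (ennreal A * FT_mass \<omega> v + ennreal \<eta> * FT_mass UNIV v)"
      using C(2)[OF v] A(2)[OF v] by (meson mult_left_mono order_trans zero_le)
    then have "n \<le> C * (A * w + \<eta> * n)"
      unfolding n(2) w(2) using n(1) w(1) A(1) C(1) \<eta>(1)
      by (simp add: ennreal_mult[symmetric] ennreal_plus[symmetric] ennreal_le_iff del: ennreal_plus)
    also have "\<dots> = C * A * w + (C * \<eta>) * n" by (simp add: algebra_simps)
    also have "(C * \<eta>) * n \<le> 1 / 2 * n" using \<eta>(2) n(1) by (rule mult_right_mono)
    finally have "n \<le> 2 * (C * A) * w" by simp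
    then show "FT_mass UNIV v \<le> ennreal (2 * (C * A)) * FT_mass \<omega> v"
      unfolding n(2) w(2) using w(1) A(1) C(1) by (simp add: ennreal_mult[symmetric] ennreal_leI)
  qed
qed

text \<open>
  For \<open>I \<subseteq> Basis\<close>, the measure of \<open>\<omega>\<close> in the \<open>|I|\<close>-dimensional box with corner \<open>x\<close> and side
  \<open>L\<close> spanned by \<open>I\<close>. It interpolates between the indicator of \<open>\<omega>\<close> and the measure of \<open>\<omega>\<close> in
  a cube.
\<close>

definition box_mass :: "real \<Rightarrow> 'a set \<Rightarrow> 'a::euclidean_space set \<Rightarrow> 'a \<Rightarrow> ennreal" where
  "box_mass L I \<omega> x = (\<integral>\<^sup>+y. indicator \<omega> (x + (\<Sum>i\<in>I. y i *\<^sub>R i)) * (\<Prod>i\<in>I. indicator {0..L} (y i)) \<partial>(\<Pi>\<^sub>M i\<in>I. lborel))"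

text \<open>
  On a segment in direction \<open>b\<close> the set \<open>\<omega>\<close> has length at most \<open>L\<close>, and less than \<open>\<delta>\<close> if the
  starting point is outside the thickening; integrate this over the box spanned by \<open>I\<close>.
\<close>

lemma box_mass_insert_le:
  fixes b :: "'a::euclidean_space"
  assumes I: "finite I" "b \<notin> I" and \<omega> [measurable]: "\<omega> \<in> sets borel" and "0 \<le> L" "0 \<le> \<delta>"
  shows "box_mass L (insert b I) \<omega> x \<le> ennreal L * box_mass L I (segment_thickening L \<delta> b \<omega>) x + ennreal (\<delta> * L ^ card I)"
proof -
  interpret product_sigma_finite "\<lambda>_::'a. lborel :: real measure" by standard
  let ?T = "segment_thickening L \<delta> b \<omega>"
  have [measurable]: "?T \<in> sets borel" by (rule segment_thickening_borel) fact
  let ?P = "\<lambda>y. \<Prod>i\<in>I. indicator {0..L} (y i) :: ennreal"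
  let ?S = "\<lambda>y. x + (\<Sum>i\<in>I. y i *\<^sub>R i)"
  have upd: "(\<Sum>i\<in>I. (y(b := s)) i *\<^sub>R i) = (\<Sum>i\<in>I. y i *\<^sub>R i)" "(\<Prod>i\<in>I. indicator {0..L} ((y(b := s)) i)) = ?P y" for y s
    using I(2) by (auto intro!: sum.cong prod.cong)
  have slice: "(\<integral>\<^sup>+s. indicator {0..L} s * indicator \<omega> (z + s *\<^sub>R b) \<partial>lborel) \<le> ennreal L * indicator ?T z + ennreal \<delta>" for z
  proof (cases "z \<in> ?T")
    case True
    have "(\<integral>\<^sup>+s. indicator {0..L} s * indicator \<omega> (z + s *\<^sub>R b) \<partial>lborel) \<le> (\<integral>\<^sup>+s. indicator {0..L} s \<partial>lborel)"
      by (intro nn_integral_mono) (auto simp: indicator_def)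
    also have "\<dots> = ennreal L" using \<open>0 \<le> L\<close> by simp
    finally show ?thesis using True by (simp add: add_increasing2)
  next
    case False
    then show ?thesis
      by (simp add: segment_thickening_def emeasure_slice(2)[OF \<omega>, symmetric])
  qed
  have "box_mass L (insert b I) \<omega> x
    = (\<integral>\<^sup>+y. (\<integral>\<^sup>+s. ?P y * (indicator {0..L} s * indicator \<omega> (?S y + s *\<^sub>R b)) \<partial>lborel) \<partial>(\<Pi>\<^sub>M i\<in>I. lborel))"
    unfolding box_mass_def using I
    by (subst product_nn_integral_insert) (auto simp: upd fun_upd_same mult_ac add_ac simp del: fun_upd_apply intro!: nn_integral_cong)
  also have "\<dots> \<le> (\<integral>\<^sup>+y. ennreal L * (indicator ?T (?S y) * ?P y) + ennreal \<delta> * ?P y \<partial>(\<Pi>\<^sub>M i\<in>I. lborel))"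
  proof (rule nn_integral_mono)
    fix y
    have "(\<integral>\<^sup>+s. ?P y * (indicator {0..L} s * indicator \<omega> (?S y + s *\<^sub>R b)) \<partial>lborel)
      = ?P y * (\<integral>\<^sup>+s. indicator {0..L} s * indicator \<omega> (?S y + s *\<^sub>R b) \<partial>lborel)"
      by (rule nn_integral_cmult) measurable
    also have "\<dots> \<le> ?P y * (ennreal L * indicator ?T (?S y) + ennreal \<delta>)" by (intro mult_left_mono slice) simp
    finally show "(\<integral>\<^sup>+s. ?P y * (indicator {0..L} s * indicator \<omega> (?S y + s *\<^sub>R b)) \<partial>lborel)
      \<le> ennreal L * (indicator ?T (?S y) * ?P y) + ennreal \<delta> * ?P y" by (simp add: distrib_left mult_ac)
  qed
  also have "\<dots> = ennreal L * box_mass L I ?T x + ennreal \<delta> * (\<integral>\<^sup>+y. ?P y \<partial>(\<Pi>\<^sub>M i\<in>I. lborel))"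
    unfolding box_mass_def by (subst nn_integral_add) (auto simp: nn_integral_cmult)
  also have "(\<integral>\<^sup>+y. ?P y \<partial>(\<Pi>\<^sub>M i\<in>I. lborel)) = ennreal (L ^ card I)"
    using I \<open>0 \<le> L\<close> by (subst product_nn_integral_prod) (auto simp: ennreal_power)
  also have "ennreal \<delta> * ennreal (L ^ card I) = ennreal (\<delta> * L ^ card I)"
    using \<open>0 \<le> \<delta>\<close> by (simp add: ennreal_mult')
  finally show ?thesis .
qed

text \<open>
  Induction on the set of directions. Thickening along \<open>b\<close> removes this direction and loses only half
  of \<open>\<kappa>\<close> (apart from the factor \<open>L\<close>), so the thickened set falls under the induction
  hypothesis. When no direction is left, the hypothesis says that \<open>\<omega>\<close> is the whole space.
\<close>

lemma observable_from_box_mass: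
  fixes \<omega> :: "'a::euclidean_space set"
  assumes "finite I" "I \<subseteq> Basis" "\<omega> \<in> sets borel" "0 < \<kappa>" "\<And>x. ennreal \<kappa> \<le> box_mass L I \<omega> x" and L: "0 < L" and l: "0 \<le> \<Lambda>"
  shows "observable_from \<Lambda> \<omega>"
  using assms(1-5)
proof (induction I arbitrary: \<omega> \<kappa> rule: finite_induct)
  case empty
  interpret product_sigma_finite "\<lambda>_::'a. lborel :: real measure" by standard
  have "box_mass L {} \<omega> x = indicator \<omega> x" for x
    unfolding box_mass_def by (simp add: PiM_empty nn_integral_count_space_finite)
  then have "x \<in> \<omega>" for x using empty(4)[of x] empty(3) by (cases "x \<in> \<omega>") (auto simp: ennreal_eq_0_iff)
  then have "\<omega> = UNIV" by blast
  then show ?case unfolding observable_from_def by (intro exI[of _ 1]) simp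
next
  case (insert b I)
  define \<delta> where "\<delta> = \<kappa> / (2 * L ^ card I)"
  have \<delta>: "0 < \<delta>" using insert.prems L by (simp add: \<delta>_def)
  let ?T = "segment_thickening L \<delta> b \<omega>"
  have T: "?T \<in> sets borel" by (rule segment_thickening_borel) fact
  have "ennreal (\<kappa> / (2 * L)) \<le> box_mass L I ?T x" for x
  proof (cases "box_mass L I ?T x")
    case (real r)
    have "ennreal \<kappa> \<le> ennreal L * ennreal r + ennreal (\<delta> * L ^ card I)"
      using insert.prems(4)[of x] box_mass_insert_le[OF insert.hyps(1,2) insert.prems(2), of L \<delta> x] L \<delta> real(2)
      by (metis less_imp_le order_trans)
    then have "\<kappa> \<le> L * r + \<delta> * L ^ card I"
      using real(1) L \<delta> by (simp add: ennreal_mult[symmetric] ennreal_plus[symmetric] ennreal_le_iff del: ennreal_plus)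
    also have "\<delta> * L ^ card I = \<kappa> / 2" using L by (simp add: \<delta>_def)
    finally have "\<kappa> / (2 * L) \<le> r" using L by (simp add: field_simps)
    then show ?thesis using real by (simp add: ennreal_leI)
  qed simp
  then have "observable_from \<Lambda> ?T"
    using insert.IH[OF _ T, of "\<kappa> / (2 * L)"] insert.prems L by simp
  then show ?case
    using observable_from_segment_thickening[OF L \<delta> l _ insert.prems(2)] insert.prems(1) by blast
qed

definition cube :: "real \<Rightarrow> 'a::euclidean_space set" where
  "cube L = {y. \<forall>i\<in>Basis. y \<bullet> i \<in> {0..L}}"

lemma cube_eq_cbox: "cube L = cbox 0 (\<Sum>i\<in>Basis. L *\<^sub>R i)"
  by (auto simp: cube_def mem_box)

lemma cube_borel [measurable]: "cube L \<in> sets borel"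
  unfolding cube_eq_cbox by (intro borel_closed closed_cbox)

lemma box_mass_Basis:
  fixes \<omega> :: "'a::euclidean_space set"
  assumes \<omega> [measurable]: "\<omega> \<in> sets borel"
  shows "box_mass L Basis \<omega> x = emeasure lborel (\<omega> \<inter> (+) x ` cube L)"
proof -
  let ?T = "\<lambda>f. \<Sum>b\<in>Basis. f b *\<^sub>R b :: 'a"
  have T: "?T \<in> measurable (\<Pi>\<^sub>M b\<in>Basis. lborel) borel" by measurable
  have ind: "(\<Prod>i\<in>Basis. indicator {0..L} (y i)) = (indicator (cube L) (?T y) :: ennreal)" for y
    by (auto simp: indicator_def cube_def inner_sum_left inner_Basis if_distrib sum.If_cases cong: if_cong)
  have "box_mass L Basis \<omega> x = (\<integral>\<^sup>+z. indicator \<omega> (x + z) * indicator (cube L) z \<partial>lborel)"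
    unfolding box_mass_def ind lborel_eq[where 'a='a]
    by (subst nn_integral_distr[OF T]) auto
  also have "\<dots> = (\<integral>\<^sup>+z. indicator \<omega> z * indicator (cube L) (z - x) \<partial>lborel)"
    by (subst (2) lborel_distr_plus[symmetric, of x]) (simp add: nn_integral_distr)
  also have "\<dots> = (\<integral>\<^sup>+z. indicator (\<omega> \<inter> {z. z - x \<in> cube L}) z \<partial>lborel)"
    by (intro nn_integral_cong) (auto simp: indicator_def)
  also have "{z. z - x \<in> cube L} = (+) x ` cube L" by (force simp: image_iff algebra_simps)
  also have "(\<integral>\<^sup>+z. indicator (\<omega> \<inter> (+) x ` cube L) z \<partial>lborel) = emeasure lborel (\<omega> \<inter> (+) x ` cube L)"
  proof (rule nn_integral_indicator)
    have "(+) x ` cube L = {z. z - x \<in> cube L}" by (force simp: image_iff algebra_simps)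
    also have "\<dots> \<in> sets borel" by measurable
    finally show "\<omega> \<inter> (+) x ` cube L \<in> sets lborel" by simp
  qed
  finally show ?thesis .
qed

text \<open>
  The inequality of Logvinenko, Sereda and Kovrijkine, with an unspecified constant. The set is first
  replaced by a Borel subset of full measure in it, since slices along lines of a Lebesgue measurable
  set may fail to be measurable.
\<close>

theorem spectral_inequality:
  fixes \<omega> :: "'a::euclidean_space set"
  assumes \<omega>: "\<omega> \<in> sets lebesgue" and \<kappa>: "0 < \<kappa>" and L: "0 < L"
    and thick: "\<And>x. \<kappa> \<le> measure lebesgue (\<omega> \<inter> (+) x ` cube L)" and l: "0 \<le> \<Lambda>"
  shows "\<exists>c>0. \<forall>u. (AE \<xi> in lebesgue. \<Lambda> < norm \<xi> \<longrightarrow> L2_fun (fourier_L2 u) \<xi> = 0) \<longrightarrow> c * norm u \<le> norm (indicator_L2 \<omega> u)"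
proof -
  define \<omega>0 where "\<omega>0 = main_part lborel \<omega>"
  have \<omega>0 [measurable]: "\<omega>0 \<in> sets borel" using main_part_sets[OF \<omega>] by (simp add: \<omega>0_def)
  have sub: "\<omega>0 \<subseteq> \<omega>" using main_part_null_part_Un[OF \<omega>] by (auto simp: \<omega>0_def)
  have "ennreal \<kappa> \<le> box_mass L Basis \<omega>0 x" for x
  proof -
    let ?Q = "(+) x ` cube L"
    have eq: "?Q = cbox (x + 0) (x + (\<Sum>i\<in>Basis. L *\<^sub>R i))"
      unfolding cube_eq_cbox by (rule cbox_translation[symmetric])
    have Q: "?Q \<in> sets borel" unfolding eq by (intro borel_closed closed_cbox)
    then have Q: "?Q \<in> sets borel" "emeasure lebesgue ?Q < \<infinity>"
      using emeasure_lborel_cbox_finite[of "x + 0" "x + (\<Sum>i\<in>Basis. L *\<^sub>R i)"] unfolding eq[symmetric] by auto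
    have N: "null_part lborel \<omega> \<in> null_sets lebesgue" by (rule null_part_null_sets[OF \<omega>])
    have "emeasure lebesgue (\<omega> \<inter> ?Q) \<le> emeasure lebesgue ((\<omega>0 \<inter> ?Q) \<union> null_part lborel \<omega>)"
    proof (rule emeasure_mono)
      show "\<omega> \<inter> ?Q \<subseteq> (\<omega>0 \<inter> ?Q) \<union> null_part lborel \<omega>"
        using main_part_null_part_Un[OF \<omega>] by (auto simp: \<omega>0_def)
      have "\<omega>0 \<inter> ?Q \<in> sets borel" using Q by simp
      then show "(\<omega>0 \<inter> ?Q) \<union> null_part lborel \<omega> \<in> sets lebesgue" using N by (intro sets.Un) auto
    qed
    also have "\<dots> = emeasure lborel (\<omega>0 \<inter> ?Q)"
      using N Q by (subst emeasure_Un_null_set) (auto simp: emeasure_completion)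
    finally have "emeasure lebesgue (\<omega> \<inter> ?Q) \<le> box_mass L Basis \<omega>0 x" by (simp add: box_mass_Basis[OF \<omega>0])
    moreover have "ennreal \<kappa> \<le> emeasure lebesgue (\<omega> \<inter> ?Q)"
    proof -
      have "emeasure lebesgue (\<omega> \<inter> ?Q) \<le> emeasure lebesgue ?Q" using Q by (intro emeasure_mono) auto
      then have "emeasure lebesgue (\<omega> \<inter> ?Q) \<noteq> \<infinity>" using Q(2) by (auto simp: top_unique)
      then show ?thesis using thick[of x] \<kappa> by (simp add: emeasure_eq_ennreal_measure ennreal_leI)
    qed
    ultimately show ?thesis by (rule order_trans[rotated])
  qed
  then have "observable_from \<Lambda> \<omega>0"
    using observable_from_box_mass[OF finite_Basis order_refl \<omega>0 \<kappa> _ L l] by blast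
  then obtain C where C: "0 \<le> C" "\<And>v. supported_in_ball \<Lambda> v \<Longrightarrow> FT_mass UNIV v \<le> ennreal C * FT_mass \<omega>0 v"
    by (auto simp: observable_from_def)
  define d where "d = sqrt (C + 1)"
  have d: "0 < d" using C by (simp add: d_def)
  have main: "norm u \<le> d * norm (indicator_L2 \<omega> u)"
    if u: "AE \<xi> in lebesgue. \<Lambda> < norm \<xi> \<longrightarrow> L2_fun (fourier_L2 u) \<xi> = 0" for u :: "'a L2"
  proof -
    define g where "g \<xi> = indicator (cball 0 \<Lambda>) \<xi> * L2_fun (fourier_L2 u) \<xi>" for \<xi>
    have g: "square_integrable g" "integrable lebesgue g"
      unfolding g_def by (auto intro!: square_integrable_Mul integrable_indicator_mult)
    have "L2_of g = L2_of (L2_fun (fourier_L2 u))"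
    proof (rule L2_of_cong_AE[OF g(1)])
      show "AE \<xi> in lebesgue. g \<xi> = L2_fun (fourier_L2 u) \<xi>"
        using u by eventually_elim (auto simp: g_def indicator_def not_le)
    qed simp
    then have Wu: "fourier_L2 u = L2_of g" by simp
    define v where "v \<xi> = cnj (g \<xi>)" for \<xi>
    have v: "supported_in_ball \<Lambda> v"
      unfolding supported_in_ball_def v_def using square_integrable_cnj[OF g(1)] by (auto simp: g_def indicator_def)
    define k where "k = 1 / (2 * pi) ^ DIM('a)"
    have k: "0 < k" by (simp add: k_def)
    have FTs: "square_integrable (FT v)" using v by (intro Plancherel supported_in_ball_integrable[OF v]) (simp add: supported_in_ball_def)
    have cFTs: "square_integrable (\<lambda>x. cnj (FT v x))" by (rule square_integrable_cnj[OF FTs])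
    have [measurable]: "FT v \<in> borel_measurable lebesgue" using FTs by (simp add: square_integrable_def)
    have "u = inv fourier_L2 (L2_of g)" using Wu by (metis inv_fourier_fourier)
    also have "\<dots> = k *\<^sub>R L2_of (\<lambda>x. cnj (FT v x))"
      unfolding inv_fourier_L2 k_def adj_fourier_L2_of[OF g(2,1)] v_def ..
    finally have u_eq: "u = k *\<^sub>R L2_of (\<lambda>x. cnj (FT v x))" .
    have n1: "ennreal ((norm u)\<^sup>2) = ennreal (k\<^sup>2) * FT_mass UNIV v"
    proof -
      have "ennreal ((norm (L2_of (\<lambda>x. cnj (FT v x))))\<^sup>2) = FT_mass UNIV v"
        unfolding norm_L2_of_nn[OF cFTs] FT_mass_def by (simp add: nn_integral_completion)
      then show ?thesis unfolding u_eq by (simp add: power_mult_distrib ennreal_mult)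
    qed
    have n2: "ennreal (k\<^sup>2) * FT_mass \<omega>0 v \<le> ennreal ((norm (indicator_L2 \<omega> u))\<^sup>2)"
    proof -
      have bs: "bounded_symbol (indicator \<omega>)" by (rule bounded_symbol_indicator[OF \<omega>])
      have eq: "indicator_L2 \<omega> u = k *\<^sub>R L2_of (\<lambda>x. indicator \<omega> x * cnj (FT v x))"
        unfolding u_eq indicator_L2_Mul Mul_scaleR[OF bs] Mul_L2_of[OF bs cFTs] ..
      have "FT_mass \<omega>0 v = (\<integral>\<^sup>+x. indicator \<omega>0 x * ennreal ((cmod (FT v x))\<^sup>2) \<partial>lebesgue)"
        by (simp add: FT_mass_def nn_integral_completion)
      also have "\<dots> \<le> (\<integral>\<^sup>+x. ennreal ((cmod (indicator \<omega> x * cnj (FT v x)))\<^sup>2) \<partial>lebesgue)"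
        using sub by (intro nn_integral_mono) (auto simp: indicator_def)
      also have "\<dots> = ennreal ((norm (L2_of (\<lambda>x. indicator \<omega> x * cnj (FT v x))))\<^sup>2)"
        by (rule norm_L2_of_nn[symmetric, OF square_integrable_Mul[OF bs cFTs]])
      finally have "ennreal (k\<^sup>2) * FT_mass \<omega>0 v \<le> ennreal (k\<^sup>2) * \<dots>" by (rule mult_left_mono) simp
      then show ?thesis unfolding eq by (simp add: power_mult_distrib ennreal_mult)
    qed
    have "ennreal ((norm u)\<^sup>2) \<le> ennreal (k\<^sup>2) * (ennreal C * FT_mass \<omega>0 v)"
      unfolding n1 by (intro mult_left_mono C v) simp
    also have "\<dots> = ennreal C * (ennreal (k\<^sup>2) * FT_mass \<omega>0 v)" by (rule mult.left_commute)
    also have "\<dots> \<le> ennreal C * ennreal ((norm (indicator_L2 \<omega> u))\<^sup>2)" by (rule mult_left_mono[OF n2]) simp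
    finally have "(norm u)\<^sup>2 \<le> C * (norm (indicator_L2 \<omega> u))\<^sup>2"
      using C(1) by (simp add: ennreal_mult[symmetric] ennreal_le_iff)
    also have "\<dots> \<le> (d * norm (indicator_L2 \<omega> u))\<^sup>2"
      using C(1) by (simp add: d_def power_mult_distrib mult_right_mono)
    finally show ?thesis using d by (intro power2_le_imp_le[of "norm u"]) auto
  qed
  show ?thesis
  proof (intro exI[of _ "1 / d"] conjI allI impI)
    fix u :: "'a L2" assume "AE \<xi> in lebesgue. \<Lambda> < norm \<xi> \<longrightarrow> L2_fun (fourier_L2 u) \<xi> = 0"
    from main[OF this] show "1 / d * norm u \<le> norm (indicator_L2 \<omega> u)" using d by (simp add: field_simps)
  qed (use d in simp)
qed

section \<open>Fourier multipliers and their semigroups\<close>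

text \<open>
  The operator \<open>m(D)\<close> for a bounded symbol. The variants \<open>unbounded_fmult\<close> and \<open>unbounded_dom\<close>
  below treat real symbols without a bound, of which \<open>F(|D|)\<close> is an instance.
\<close>

definition fmult :: "('a::euclidean_space \<Rightarrow> complex) \<Rightarrow> 'a L2 \<Rightarrow> 'a L2" where
  "fmult m u = inv fourier_L2 (Mul m (fourier_L2 u))"

lemma fourier_fmult [simp]: "fourier_L2 (fmult m u) = Mul m (fourier_L2 u)"
  by (simp add: fmult_def)

lemma bounded_clinear_fmult: "bounded_symbol m \<Longrightarrow> bounded_clinear_L2 (fmult m)"
  unfolding fmult_def[abs_def]
  by (intro bounded_clinear_L2_compose[OF bounded_clinear_inv_fourier] bounded_clinear_L2_compose[OF bounded_clinear_L2_Mul]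
      bounded_clinear_fourier_L2)

lemma fmult_fmult: "bounded_symbol m \<Longrightarrow> bounded_symbol m' \<Longrightarrow> fmult m (fmult m' u) = fmult (\<lambda>\<xi>. m \<xi> * m' \<xi>) u"
  unfolding fmult_def[of m] by (simp add: Mul_Mul) (simp add: fmult_def)

lemma Mul_cong: "(\<And>x. m x = m' x) \<Longrightarrow> Mul m u = Mul m' u"
  by (simp add: Mul_def)

lemma Mul_one [simp]: "Mul (\<lambda>_. 1) u = u"
  by (simp add: Mul_def)

lemma Mul_zero [simp]: "Mul (\<lambda>_. 0) u = 0"
  by (simp add: Mul_def)

lemma linear_inv_fourier: "linear (inv fourier_L2 :: 'a::euclidean_space L2 \<Rightarrow> 'a L2)"
  using bounded_clinear_inv_fourier[where 'a='a] bounded_linear.linear unfolding bounded_clinear_L2_def by blast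

lemma bounded_linear_inv_fourier: "bounded_linear (inv fourier_L2 :: 'a::euclidean_space L2 \<Rightarrow> 'a L2)"
  using bounded_clinear_inv_fourier[where 'a='a] unfolding bounded_clinear_L2_def by blast

lemma linear_fourier: "linear (fourier_L2 :: 'a::euclidean_space L2 \<Rightarrow> 'a L2)"
  by (rule bounded_linear.linear[OF bounded_linear_fourier_L2])

lemma fmult_one [simp]: "fmult (\<lambda>_. 1) u = u"
  by (simp add: fmult_def)

lemma fmult_zero [simp]: "fmult (\<lambda>_. 0) u = 0"
  by (simp add: fmult_def linear_0[OF linear_inv_fourier])

lemma fmult_const: "fmult (\<lambda>_. complex_of_real r) u = r *\<^sub>R u"
  by (simp add: fmult_def linear_scale[OF linear_inv_fourier] flip: scaleC_L2_Mul scaleR_scaleC_L2)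

lemma Mul_symbol_add:
  assumes "bounded_symbol m" "bounded_symbol m'"
  shows "Mul (\<lambda>x. m x + m' x) u = Mul m u + Mul m' u"
  using assms unfolding Mul_def
  by (subst L2_of_add[symmetric]) (auto simp: square_integrable_Mul distrib_right)

lemma bounded_symbol_add: "bounded_symbol m \<Longrightarrow> bounded_symbol m' \<Longrightarrow> bounded_symbol (\<lambda>x. m x + m' x)"
  unfolding bounded_symbol_def
proof safe
  fix C C' assume "\<forall>x. cmod (m x) \<le> C" "\<forall>x. cmod (m' x) \<le> C'"
  then show "\<exists>C. \<forall>x. cmod (m x + m' x) \<le> C"
    by (intro exI[of _ "C + C'"]) (blast intro: norm_triangle_le add_mono)
qed auto

lemma fmult_symbol_add:
  "bounded_symbol m \<Longrightarrow> bounded_symbol m' \<Longrightarrow> fmult (\<lambda>x. m x + m' x) u = fmult m u + fmult m' u"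
  by (simp add: fmult_def Mul_symbol_add linear_add[OF linear_inv_fourier])

lemma norm_fourier_cancel: "norm (fourier_L2 u) \<le> C * norm (fourier_L2 v) \<Longrightarrow> norm u \<le> C * norm v"
  for u v :: "'a::euclidean_space L2"
proof -
  assume "norm (fourier_L2 u) \<le> C * norm (fourier_L2 v)"
  then have "sqrt (2 * pi) ^ DIM('a) * norm u \<le> sqrt (2 * pi) ^ DIM('a) * (C * norm v)"
    by (simp add: norm_fourier_L2 mult.left_commute)
  then show ?thesis by (rule mult_left_le_imp_le) simp
qed

lemma norm_fmult_le:
  assumes "bounded_symbol m" "\<And>\<xi>. cmod (m \<xi>) \<le> C"
  shows "norm (fmult m u) \<le> C * norm u"
proof (rule norm_fourier_cancel)
  have "0 \<le> C" using assms(2)[of undefined] norm_ge_zero order_trans by blast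
  then show "norm (fourier_L2 (fmult m u)) \<le> C * norm (fourier_L2 u)"
    using assms by (simp add: norm_Mul_le)
qed

subsection \<open>Unbounded multipliers\<close>

definition unbounded_fmult :: "('a::euclidean_space \<Rightarrow> real) \<Rightarrow> 'a L2 \<Rightarrow> 'a L2" where
  "unbounded_fmult g u = inv fourier_L2 (L2_of (\<lambda>\<xi>. complex_of_real (g \<xi>) * L2_fun (fourier_L2 u) \<xi>))"

definition unbounded_dom :: "('a::euclidean_space \<Rightarrow> real) \<Rightarrow> 'a L2 set" where
  "unbounded_dom g = {u. square_integrable (\<lambda>\<xi>. complex_of_real (g \<xi>) * L2_fun (fourier_L2 u) \<xi>)}"

lemma multiplier_eq: "multiplier F = unbounded_fmult (\<lambda>\<xi>. F (norm \<xi>))"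
  by (simp add: multiplier_def[abs_def] unbounded_fmult_def[abs_def])

lemma multiplier_dom_eq: "multiplier_dom F = unbounded_dom (\<lambda>\<xi>. F (norm \<xi>))"
  by (simp add: multiplier_dom_def unbounded_dom_def)

lemma unbounded_dom_iff_square_integrable:
  assumes "square_integrable f" "fourier_L2 u = L2_of f" and [measurable]: "g \<in> borel_measurable lebesgue"
  shows "u \<in> unbounded_dom g \<longleftrightarrow> square_integrable (\<lambda>\<xi>. complex_of_real (g \<xi>) * f \<xi>)"
    and "u \<in> unbounded_dom g \<Longrightarrow> fourier_L2 (unbounded_fmult g u) = L2_of (\<lambda>\<xi>. complex_of_real (g \<xi>) * f \<xi>)"
proof -
  have [measurable]: "f \<in> borel_measurable lebesgue" using assms(1) by (simp add: square_integrable_def)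
  have ae: "AE \<xi> in lebesgue. complex_of_real (g \<xi>) * L2_fun (fourier_L2 u) \<xi> = complex_of_real (g \<xi>) * f \<xi>"
    using L2_fun_L2_of[OF assms(1)] unfolding assms(2) by eventually_elim simp
  have ae': "AE \<xi> in lebesgue. complex_of_real (g \<xi>) * f \<xi> = complex_of_real (g \<xi>) * L2_fun (fourier_L2 u) \<xi>"
    using ae by eventually_elim (rule sym)
  have m: "(\<lambda>\<xi>. complex_of_real (g \<xi>) * f \<xi>) \<in> borel_measurable lebesgue"
    "(\<lambda>\<xi>. complex_of_real (g \<xi>) * L2_fun (fourier_L2 u) \<xi>) \<in> borel_measurable lebesgue" by measurable
  show 1: "u \<in> unbounded_dom g \<longleftrightarrow> square_integrable (\<lambda>\<xi>. complex_of_real (g \<xi>) * f \<xi>)"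
    unfolding unbounded_dom_def using square_integrable_cong_AE[OF _ m(1) ae] square_integrable_cong_AE[OF _ m(2) ae'] by blast
  show "fourier_L2 (unbounded_fmult g u) = L2_of (\<lambda>\<xi>. complex_of_real (g \<xi>) * f \<xi>)" if "u \<in> unbounded_dom g"
    using that 1 unfolding unbounded_fmult_def fourier_inv_fourier
    by (intro L2_of_cong_AE[OF _ _ ae]) (auto simp: unbounded_dom_def)
qed

text \<open>
  If the product of the symbols is bounded, then the bounded multiplier maps everything into the domain
  of the unbounded one; this is how a resolvent smoothes.
\<close>

lemma unbounded_fmult_fmult:
  assumes m: "bounded_symbol m" and g: "g \<in> borel_measurable lebesgue"
    and gm: "bounded_symbol (\<lambda>\<xi>. complex_of_real (g \<xi>) * m \<xi>)"
  shows "fmult m u \<in> unbounded_dom g" "unbounded_fmult g (fmult m u) = fmult (\<lambda>\<xi>. complex_of_real (g \<xi>) * m \<xi>) u"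
proof -
  let ?f = "\<lambda>\<xi>. m \<xi> * L2_fun (fourier_L2 u) \<xi>"
  have f: "square_integrable ?f" "fourier_L2 (fmult m u) = L2_of ?f"
    using m by (simp_all add: square_integrable_Mul Mul_def)
  have "square_integrable (\<lambda>\<xi>. (complex_of_real (g \<xi>) * m \<xi>) * L2_fun (fourier_L2 u) \<xi>)"
    by (rule square_integrable_Mul[OF gm]) simp
  then show *: "fmult m u \<in> unbounded_dom g"
    using unbounded_dom_iff_square_integrable(1)[OF f g] by (simp add: mult.assoc)
  have "fourier_L2 (unbounded_fmult g (fmult m u)) = fourier_L2 (fmult (\<lambda>\<xi>. complex_of_real (g \<xi>) * m \<xi>) u)"
    using unbounded_dom_iff_square_integrable(2)[OF f g *] by (simp add: Mul_def mult.assoc)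
  then show "unbounded_fmult g (fmult m u) = fmult (\<lambda>\<xi>. complex_of_real (g \<xi>) * m \<xi>) u"
    by (rule injD[OF inj_fourier_L2])
qed

lemma fmult_unbounded_fmult:
  assumes m: "bounded_symbol m" and g: "g \<in> borel_measurable lebesgue" and u: "u \<in> unbounded_dom g"
    and gm: "\<And>\<xi>. m \<xi> * complex_of_real (g \<xi>) = m' \<xi>"
  shows "fmult m (unbounded_fmult g u) = fmult m' u"
proof -
  have sq: "square_integrable (\<lambda>\<xi>. complex_of_real (g \<xi>) * L2_fun (fourier_L2 u) \<xi>)"
    using u by (simp add: unbounded_dom_def)
  have "fourier_L2 (fmult m (unbounded_fmult g u)) = Mul m (L2_of (\<lambda>\<xi>. complex_of_real (g \<xi>) * L2_fun (fourier_L2 u) \<xi>))"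
    by (simp add: unbounded_fmult_def)
  also have "\<dots> = fourier_L2 (fmult m' u)"
    unfolding Mul_L2_of[OF m sq] by (simp add: Mul_def gm[symmetric] mult.assoc)
  finally show ?thesis by (rule injD[OF inj_fourier_L2])
qed

lemma unbounded_fmult_add:
  assumes g: "g \<in> borel_measurable lebesgue" and u: "u \<in> unbounded_dom g" and v: "v \<in> unbounded_dom g"
  shows "u + v \<in> unbounded_dom g" "unbounded_fmult g (u + v) = unbounded_fmult g u + unbounded_fmult g v"
proof -
  let ?a = "L2_fun (fourier_L2 u)" and ?b = "L2_fun (fourier_L2 v)"
  have f: "square_integrable (\<lambda>x. ?a x + ?b x)" "fourier_L2 (u + v) = L2_of (\<lambda>x. ?a x + ?b x)"
    by (simp_all add: square_integrable_add L2_of_add fourier_L2_add)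
  have sq: "square_integrable (\<lambda>\<xi>. complex_of_real (g \<xi>) * ?a \<xi>)" "square_integrable (\<lambda>\<xi>. complex_of_real (g \<xi>) * ?b \<xi>)"
    using u v by (simp_all add: unbounded_dom_def)
  show *: "u + v \<in> unbounded_dom g"
    using unbounded_dom_iff_square_integrable(1)[OF f g] square_integrable_add[OF sq] by (simp add: distrib_left)
  have "fourier_L2 (unbounded_fmult g (u + v)) = fourier_L2 (unbounded_fmult g u + unbounded_fmult g v)"
    unfolding unbounded_dom_iff_square_integrable(2)[OF f g *] fourier_L2_add
    using L2_of_add[OF sq] by (simp add: distrib_left unbounded_fmult_def)
  then show "unbounded_fmult g (u + v) = unbounded_fmult g u + unbounded_fmult g v"
    by (rule injD[OF inj_fourier_L2])
qed

lemma unbounded_fmult_perturb: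
  assumes g: "g \<in> borel_measurable lebesgue" and m: "bounded_symbol (\<lambda>\<xi>. complex_of_real (m \<xi>))"
  shows "unbounded_dom (\<lambda>\<xi>. g \<xi> + m \<xi>) = unbounded_dom g"
    and "u \<in> unbounded_dom g \<Longrightarrow> unbounded_fmult (\<lambda>\<xi>. g \<xi> + m \<xi>) u = unbounded_fmult g u + fmult (\<lambda>\<xi>. complex_of_real (m \<xi>)) u"
proof -
  let ?a = "\<lambda>u. L2_fun (fourier_L2 u)"
  have sq: "square_integrable (\<lambda>\<xi>. complex_of_real (m \<xi>) * ?a u \<xi>)" for u
    by (rule square_integrable_Mul[OF m]) simp
  have "square_integrable (\<lambda>\<xi>. complex_of_real (g \<xi> + m \<xi>) * ?a u \<xi>) \<longleftrightarrow> square_integrable (\<lambda>\<xi>. complex_of_real (g \<xi>) * ?a u \<xi>)" for u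
    using square_integrable_add[OF _ sq[of u], of "\<lambda>\<xi>. complex_of_real (g \<xi>) * ?a u \<xi>"]
      square_integrable_diff[OF _ sq[of u], of "\<lambda>\<xi>. complex_of_real (g \<xi> + m \<xi>) * ?a u \<xi>"]
    by (auto simp: algebra_simps)
  then show "unbounded_dom (\<lambda>\<xi>. g \<xi> + m \<xi>) = unbounded_dom g" by (simp add: unbounded_dom_def)
  show "unbounded_fmult (\<lambda>\<xi>. g \<xi> + m \<xi>) u = unbounded_fmult g u + fmult (\<lambda>\<xi>. complex_of_real (m \<xi>)) u" if "u \<in> unbounded_dom g"
  proof -
    have "L2_of (\<lambda>\<xi>. complex_of_real (g \<xi> + m \<xi>) * ?a u \<xi>)
      = L2_of (\<lambda>\<xi>. complex_of_real (g \<xi>) * ?a u \<xi>) + L2_of (\<lambda>\<xi>. complex_of_real (m \<xi>) * ?a u \<xi>)"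
      using that sq[of u] by (subst L2_of_add[symmetric]) (auto simp: unbounded_dom_def distrib_right)
    then show ?thesis by (simp add: unbounded_fmult_def fmult_def Mul_def linear_add[OF linear_inv_fourier])
  qed
qed

subsection \<open>The semigroup of a nonnegative multiplier\<close>

lemma exp_difference_quotient_tendsto:
  fixes a :: real
  assumes S: "\<And>n. 0 < S n" "S \<longlonglongrightarrow> 0"
  shows "(\<lambda>n. (exp (- (S n * a)) - 1) / S n) \<longlonglongrightarrow> - a"
proof -
  have "((\<lambda>t. exp (- (t * a))) has_real_derivative - a) (at 0)"
    by (auto intro!: derivative_eq_intros)
  then have "(\<lambda>t. (exp (- (t * a)) - 1) / t) \<midarrow>0\<rightarrow> - a"
    by (simp add: has_field_derivative_iff)
  moreover have "S n \<noteq> 0" for n using S(1)[of n] by simp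
  then have "filterlim S (at 0) sequentially" using S(2) by (simp add: filterlim_at)
  ultimately show ?thesis by (rule filterlim_compose)
qed

context
  fixes g :: "'a::euclidean_space \<Rightarrow> real"
  assumes g_meas [measurable]: "g \<in> borel_measurable lebesgue" and g_nonneg: "\<And>\<xi>. 0 \<le> g \<xi>"
begin

definition heat_symbol :: "real \<Rightarrow> 'a \<Rightarrow> complex" where
  "heat_symbol t \<xi> = complex_of_real (exp (- (t * g \<xi>)))"

lemma heat_symbol_measurable [measurable]: "heat_symbol t \<in> borel_measurable lebesgue"
  unfolding heat_symbol_def[abs_def] by measurable

lemma bounded_symbol_heat: "0 \<le> t \<Longrightarrow> bounded_symbol (heat_symbol t)"
  unfolding bounded_symbol_def using g_nonneg
  by (auto simp: heat_symbol_def intro!: exI[of _ 1])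

lemma heat_tendsto: "((\<lambda>t. fmult (heat_symbol t) u) \<longlongrightarrow> u) (at_right 0)"
proof (rule tendsto_at_right_sequentially[of 0 1])
  fix S :: "nat \<Rightarrow> real" assume S: "\<And>n. 0 < S n" "S \<longlonglongrightarrow> 0"
  let ?f = "L2_fun (fourier_L2 u)"
  have "(\<lambda>n. L2_of (\<lambda>\<xi>. (heat_symbol (S n) \<xi> - 1) * ?f \<xi>)) \<longlonglongrightarrow> 0"
  proof (rule L2_dominated_convergence[where w="?f"])
    show "AE \<xi> in lebesgue. (\<lambda>n. (heat_symbol (S n) \<xi> - 1) * ?f \<xi>) \<longlonglongrightarrow> 0"
    proof (intro AE_I2)
      fix \<xi>
      have "(\<lambda>n. (heat_symbol (S n) \<xi> - 1) * ?f \<xi>) \<longlonglongrightarrow> (complex_of_real (exp (- (0 * g \<xi>))) - 1) * ?f \<xi>"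
        unfolding heat_symbol_def by (intro tendsto_intros S)
      then show "(\<lambda>n. (heat_symbol (S n) \<xi> - 1) * ?f \<xi>) \<longlonglongrightarrow> 0" by simp
    qed
    show "AE \<xi> in lebesgue. cmod ((heat_symbol (S n) \<xi> - 1) * ?f \<xi>) \<le> cmod (?f \<xi>)" for n
    proof (intro AE_I2)
      fix \<xi>
      have "cmod (heat_symbol (S n) \<xi> - 1) = \<bar>exp (- (S n * g \<xi>)) - 1\<bar>"
        unfolding heat_symbol_def by (metis norm_of_real of_real_1 of_real_diff real_norm_def)
      also have "\<dots> \<le> 1" using S(1)[of n] g_nonneg[of \<xi>] by simp
      finally show "cmod ((heat_symbol (S n) \<xi> - 1) * ?f \<xi>) \<le> cmod (?f \<xi>)"
        by (simp add: norm_mult mult_left_le_one_le)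
    qed
    show "(\<lambda>\<xi>. (heat_symbol (S n) \<xi> - 1) * ?f \<xi>) \<in> borel_measurable lebesgue" for n by measurable
  qed simp
  moreover have "L2_of (\<lambda>\<xi>. (heat_symbol (S n) \<xi> - 1) * ?f \<xi>) = fourier_L2 (fmult (heat_symbol (S n)) u - u)" for n
  proof -
    have "square_integrable (\<lambda>\<xi>. heat_symbol (S n) \<xi> * ?f \<xi>)"
      using S(1)[of n] by (intro square_integrable_Mul bounded_symbol_heat) auto
    then show ?thesis
      by (simp add: left_diff_distrib L2_of_diff linear_diff[OF linear_fourier] Mul_def)
  qed
  ultimately have "(\<lambda>n. inv fourier_L2 (fourier_L2 (fmult (heat_symbol (S n)) u - u))) \<longlonglongrightarrow> inv fourier_L2 0"
    by (intro bounded_linear.tendsto[OF bounded_linear_inv_fourier]) simp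
  then show "(\<lambda>n. fmult (heat_symbol (S n)) u) \<longlonglongrightarrow> u"
    by (simp add: linear_0[OF linear_inv_fourier] LIM_zero_iff)
qed simp

lemma heat_difference_quotient:
  assumes "0 < t"
  shows "(fmult (heat_symbol t) u - u) /\<^sub>R t
    = inv fourier_L2 (L2_of (\<lambda>\<xi>. complex_of_real ((exp (- (t * g \<xi>)) - 1) / t) * L2_fun (fourier_L2 u) \<xi>))"
    and "square_integrable (\<lambda>\<xi>. complex_of_real ((exp (- (t * g \<xi>)) - 1) / t) * L2_fun (fourier_L2 u) \<xi>)"
proof -
  let ?f = "L2_fun (fourier_L2 u)"
  have sq: "square_integrable (\<lambda>\<xi>. heat_symbol t \<xi> * ?f \<xi>)"
    using assms by (intro square_integrable_Mul bounded_symbol_heat) auto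
  have sq2: "square_integrable (\<lambda>\<xi>. heat_symbol t \<xi> * ?f \<xi> - ?f \<xi>)" using sq by (rule square_integrable_diff) simp
  have eq: "complex_of_real ((exp (- (t * g \<xi>)) - 1) / t) * ?f \<xi> = complex_of_real (inverse t) * (heat_symbol t \<xi> * ?f \<xi> - ?f \<xi>)" for \<xi>
    using assms by (simp add: heat_symbol_def field_simps)
  show "square_integrable (\<lambda>\<xi>. complex_of_real ((exp (- (t * g \<xi>)) - 1) / t) * ?f \<xi>)"
    unfolding eq by (rule square_integrable_cmult[OF sq2])
  have "L2_of (\<lambda>\<xi>. complex_of_real ((exp (- (t * g \<xi>)) - 1) / t) * ?f \<xi>) = fourier_L2 ((fmult (heat_symbol t) u - u) /\<^sub>R t)"
    unfolding eq L2_of_scaleR[OF sq2] fourier_L2_scaleR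
    using sq by (simp add: L2_of_diff linear_diff[OF linear_fourier] Mul_def)
  then show "(fmult (heat_symbol t) u - u) /\<^sub>R t
    = inv fourier_L2 (L2_of (\<lambda>\<xi>. complex_of_real ((exp (- (t * g \<xi>)) - 1) / t) * ?f \<xi>))" by simp
qed

lemma heat_generator:
  assumes "u \<in> unbounded_dom g"
  shows "((\<lambda>t. (fmult (heat_symbol t) u - u) /\<^sub>R t) \<longlongrightarrow> - unbounded_fmult g u) (at_right 0)"
proof (rule tendsto_at_right_sequentially[of 0 1])
  fix S :: "nat \<Rightarrow> real" assume S: "\<And>n. 0 < S n" "S \<longlonglongrightarrow> 0"
  let ?f = "L2_fun (fourier_L2 u)"
  have sq: "square_integrable (\<lambda>\<xi>. complex_of_real (g \<xi>) * ?f \<xi>)" using assms by (simp add: unbounded_dom_def)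
  let ?d = "\<lambda>n \<xi>. complex_of_real ((exp (- (S n * g \<xi>)) - 1) / S n) * ?f \<xi> + complex_of_real (g \<xi>) * ?f \<xi>"
  have "(\<lambda>n. L2_of (?d n)) \<longlonglongrightarrow> 0"
  proof (rule L2_dominated_convergence[where w="\<lambda>\<xi>. 2 * (complex_of_real (g \<xi>) * ?f \<xi>)"])
    show "square_integrable (\<lambda>\<xi>. 2 * (complex_of_real (g \<xi>) * ?f \<xi>))" by (rule square_integrable_cmult[OF sq])
    show "AE \<xi> in lebesgue. (\<lambda>n. ?d n \<xi>) \<longlonglongrightarrow> 0"
    proof (intro AE_I2)
      fix \<xi>
      have "(\<lambda>n. (exp (- (S n * g \<xi>)) - 1) / S n) \<longlonglongrightarrow> - g \<xi>"
        by (rule exp_difference_quotient_tendsto[OF S])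
      then have "(\<lambda>n. ?d n \<xi>) \<longlonglongrightarrow> complex_of_real (- g \<xi>) * ?f \<xi> + complex_of_real (g \<xi>) * ?f \<xi>"
        by (intro tendsto_intros)
      then show "(\<lambda>n. ?d n \<xi>) \<longlonglongrightarrow> 0" by simp
    qed
    show "AE \<xi> in lebesgue. cmod (?d n \<xi>) \<le> cmod (2 * (complex_of_real (g \<xi>) * ?f \<xi>))" for n
    proof (intro AE_I2)
      fix \<xi>
      let ?x = "S n * g \<xi>"
      have x: "0 \<le> ?x" using S(1)[of n] g_nonneg[of \<xi>] by simp
      have "1 - ?x \<le> exp (- ?x)" using exp_ge_add_one_self[of "- ?x"] by simp
      then have "\<bar>exp (- ?x) - 1\<bar> \<le> ?x" using x by (simp add: abs_le_iff)
      then have "\<bar>(exp (- ?x) - 1) / S n\<bar> \<le> g \<xi>" using S(1)[of n] by (simp add: pos_divide_le_eq mult.commute)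
      then have "\<bar>(exp (- ?x) - 1) / S n + g \<xi>\<bar> \<le> 2 * g \<xi>" using g_nonneg[of \<xi>] by linarith
      then have "\<bar>(exp (- ?x) - 1) / S n + g \<xi>\<bar> * cmod (?f \<xi>) \<le> (2 * g \<xi>) * cmod (?f \<xi>)" by (rule mult_right_mono) simp
      moreover have "?d n \<xi> = complex_of_real ((exp (- ?x) - 1) / S n + g \<xi>) * ?f \<xi>" by (simp add: distrib_right)
      ultimately show "cmod (?d n \<xi>) \<le> cmod (2 * (complex_of_real (g \<xi>) * ?f \<xi>))"
        using g_nonneg[of \<xi>] by (simp only: norm_mult norm_of_real norm_numeral)
    qed
    show "?d n \<in> borel_measurable lebesgue" for n by measurable
  qed
  moreover have "inv fourier_L2 (L2_of (?d n)) = (fmult (heat_symbol (S n)) u - u) /\<^sub>R S n + unbounded_fmult g u" for n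
    unfolding L2_of_add[OF heat_difference_quotient(2)[OF S(1)] sq] heat_difference_quotient(1)[OF S(1)] unbounded_fmult_def
    by (rule linear_add[OF linear_inv_fourier])
  ultimately have "(\<lambda>n. (fmult (heat_symbol (S n)) u - u) /\<^sub>R S n + unbounded_fmult g u) \<longlonglongrightarrow> 0"
    using bounded_linear.tendsto[OF bounded_linear_inv_fourier, of "\<lambda>n. L2_of (?d n)" 0 sequentially]
    by (simp add: linear_0[OF linear_inv_fourier])
  then have "(\<lambda>n. ((fmult (heat_symbol (S n)) u - u) /\<^sub>R S n + unbounded_fmult g u) - unbounded_fmult g u) \<longlonglongrightarrow> 0 - unbounded_fmult g u"
    by (intro tendsto_intros)
  then show "(\<lambda>n. (fmult (heat_symbol (S n)) u - u) /\<^sub>R S n) \<longlonglongrightarrow> - unbounded_fmult g u" by simp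
qed simp

text \<open>
  If the difference quotients converge they are bounded in norm, and their transforms converge
  pointwise to \<open>- g\<close> times the transform of \<open>u\<close>; Fatou's lemma then puts \<open>u\<close> into the domain.
\<close>

lemma heat_generator_domain:
  assumes "((\<lambda>t. (fmult (heat_symbol t) u - u) /\<^sub>R t) \<longlongrightarrow> v) (at_right 0)"
  shows "u \<in> unbounded_dom g"
proof -
  let ?f = "L2_fun (fourier_L2 u)"
  define S where "S n = 1 / real (Suc n)" for n
  have S: "0 < S n" for n by (simp add: S_def)
  have S0: "S \<longlonglongrightarrow> 0" unfolding S_def[abs_def] by (rule LIMSEQ_inverse_real_of_nat[unfolded inverse_eq_divide])
  have Sr: "filterlim S (at_right 0) sequentially"
  proof -
    have "S n \<noteq> 0" for n using S[of n] by simp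
    then show ?thesis using S S0 by (simp add: filterlim_at)
  qed
  let ?q = "\<lambda>n \<xi>. complex_of_real ((exp (- (S n * g \<xi>)) - 1) / S n) * ?f \<xi>"
  have "(\<lambda>n. (fmult (heat_symbol (S n)) u - u) /\<^sub>R S n) \<longlonglongrightarrow> v" by (rule filterlim_compose[OF assms Sr])
  then have "(\<lambda>n. fourier_L2 ((fmult (heat_symbol (S n)) u - u) /\<^sub>R S n)) \<longlonglongrightarrow> fourier_L2 v"
    by (rule bounded_linear.tendsto[OF bounded_linear_fourier_L2])
  then have lim: "(\<lambda>n. L2_of (?q n)) \<longlonglongrightarrow> fourier_L2 v" by (simp add: heat_difference_quotient(1)[OF S])
  then obtain B where B: "\<And>n. norm (L2_of (?q n)) \<le> B"
    using convergent_imp_Bseq[of "\<lambda>n. L2_of (?q n)"] by (auto simp: convergent_def Bseq_def)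
  have "square_integrable (\<lambda>\<xi>. complex_of_real (- g \<xi>) * ?f \<xi>)"
  proof (rule L2_Fatou(1)[where s="?q" and B=B])
    show "square_integrable (?q n)" for n by (rule heat_difference_quotient(2)[OF S])
    show "AE \<xi> in lebesgue. (\<lambda>n. ?q n \<xi>) \<longlonglongrightarrow> complex_of_real (- g \<xi>) * ?f \<xi>"
    proof (intro AE_I2)
      fix \<xi>
      have "(\<lambda>n. (exp (- (S n * g \<xi>)) - 1) / S n) \<longlonglongrightarrow> - g \<xi>"
        by (rule exp_difference_quotient_tendsto[OF S S0])
      then show "(\<lambda>n. ?q n \<xi>) \<longlonglongrightarrow> complex_of_real (- g \<xi>) * ?f \<xi>" by (intro tendsto_intros)
    qed
    show "\<forall>\<^sub>F n in sequentially. norm (L2_of (?q n)) \<le> B" using B by simp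
    show "(\<lambda>\<xi>. complex_of_real (- g \<xi>) * ?f \<xi>) \<in> borel_measurable lebesgue" by measurable
  qed
  from square_integrable_uminus[OF this] show ?thesis by (simp add: unbounded_dom_def)
qed

lemma heat_semigroup: "0 \<le> s \<Longrightarrow> 0 \<le> t \<Longrightarrow> fmult (heat_symbol (s + t)) u = fmult (heat_symbol s) (fmult (heat_symbol t) u)"
  by (simp add: fmult_fmult bounded_symbol_heat) (simp add: heat_symbol_def[abs_def] exp_add[symmetric] distrib_right add.commute flip: of_real_mult)

end

section \<open>Thick sets stabilize\<close>

text \<open>
  The resolvent \<open>R = (1 - H)\<^sup>-\<^sup>1\<close> from Banach's fixed point theorem; its linearity follows from the
  uniqueness of the fixed point.
\<close>

lemma contraction_resolvent:
  fixes H :: "'a::euclidean_space L2 \<Rightarrow> 'a L2"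
  assumes H: "bounded_clinear_L2 H" and \<rho>: "0 \<le> \<rho>" "\<rho> < 1" "\<And>u. norm (H u) \<le> \<rho> * norm u"
  shows "\<exists>R. bounded_clinear_L2 R \<and> (\<forall>y. R y = H (R y) + y)"
proof -
  have lin: "linear H" using H bounded_linear.linear by (auto simp: bounded_clinear_L2_def)
  have "\<exists>!k. H k + y = k" for y
  proof -
    have "dist (H k + y) (H l + y) \<le> \<rho> * dist k l" for k l
      using \<rho>(3)[of "k - l"] by (simp add: dist_norm linear_diff[OF lin])
    then show ?thesis using banach_fix_type[OF \<rho>(1,2), of "\<lambda>k. H k + y"] by blast
  qed
  then obtain R where R: "\<And>y. H (R y) + y = R y" and uniq: "\<And>y k. H k + y = k \<Longrightarrow> k = R y" by metis
  have bound: "norm (R y) \<le> (1 / (1 - \<rho>)) * norm y" for y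
  proof -
    have "norm (R y) \<le> norm (H (R y)) + norm y" using norm_triangle_ineq[of "H (R y)" y] R[of y] by simp
    then have "(1 - \<rho>) * norm (R y) \<le> norm y" using \<rho>(3)[of "R y"] by (simp add: algebra_simps)
    then show ?thesis using \<rho> by (simp add: field_simps)
  qed
  have "bounded_linear R"
  proof (rule bounded_linear_intro[where K="1 / (1 - \<rho>)"])
    show "R (x + y) = R x + R y" for x y
      using R[of x] R[of y] by (intro uniq[symmetric]) (simp add: linear_add[OF lin], metis add.commute add.left_commute)
    show "R (r *\<^sub>R x) = r *\<^sub>R R x" for r x
      using R[of x] by (intro uniq[symmetric]) (metis linear_scale[OF lin] scaleR_add_right)
    show "norm (R x) \<le> norm x * (1 / (1 - \<rho>))" for x using bound[of x] by (simp add: mult.commute)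
  qed
  moreover have "R (scaleC_L2 c y) = scaleC_L2 c (R y)" for c y
    using R[of y] H by (intro uniq[symmetric]) (metis bounded_clinear_L2_def scaleC_L2_add)
  ultimately show ?thesis using R by (intro exI[of _ R]) (auto simp: bounded_clinear_L2_def)
qed

text \<open>
  The feedback is \<open>K = R (\<alpha> - F(|D|)) P\<close> with \<open>R = (1 - H)\<^sup>-\<^sup>1\<close> and
  \<open>H = P 1\<^bsub>- \<omega>\<^esub> P\<close>. The spectral inequality makes \<open>H\<close> a strict contraction: of the mass of
  \<open>P u\<close>, at least the fraction \<open>c\<^sup>2\<close> lies in \<open>\<omega>\<close>. On the range of \<open>P\<close> the operator \<open>1 - H\<close> is
  \<open>P 1\<^bsub>\<omega>\<^esub> P\<close>, whence \<open>P 1\<^bsub>\<omega>\<^esub> K = (\<alpha> - F(|D|)) P\<close>.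

  In the proof \<open>p\<close>, \<open>q\<close>, \<open>n\<close>, \<open>a\<close> and \<open>g\<close> are the symbols of \<open>P\<close>, \<open>1 - P\<close>,
  \<open>(F(|D|) - \<alpha>)\<^sup>-\<^sup>1 (1 - P)\<close>, \<open>(\<alpha> - F(|D|)) P\<close>, and of the operator that the closed loop is
  conjugate to: it is \<open>\<alpha>\<close> on low and \<open>F(|\<xi>|)\<close> on high frequencies. The conjugation is by
  \<open>J = 1 + N\<close>, whose inverse is \<open>J' = 1 - N\<close> because \<open>N\<close> maps low to high frequencies and
  kills the high ones.
\<close>

theorem stabilizable_if_spectral_inequality:
  fixes \<omega> :: "'a::euclidean_space set"
  assumes F: "continuous_on {0..} F" "filterlim F at_top at_top" and \<omega>: "\<omega> \<in> sets lebesgue" and \<alpha>: "0 < \<alpha>"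
    and spectral: "\<And>\<Lambda>. 0 \<le> \<Lambda> \<Longrightarrow> \<exists>c>0. \<forall>u. (AE \<xi> in lebesgue. \<Lambda> < norm \<xi> \<longrightarrow> L2_fun (fourier_L2 u) \<xi> = 0) \<longrightarrow> c * norm u \<le> norm (indicator_L2 \<omega> u)"
  shows "exponentially_stabilizable F \<omega> \<alpha>"
proof -
  define \<Phi> where "\<Phi> \<xi> = F (norm \<xi>)" for \<xi> :: 'a
  have \<Phi>_cont: "continuous_on UNIV \<Phi>"
    unfolding \<Phi>_def[abs_def] by (rule continuous_on_compose2[OF F(1)]) (auto intro: continuous_intros)
  have [measurable]: "\<Phi> \<in> borel_measurable borel" by (rule borel_measurable_continuous_onI[OF \<Phi>_cont])
  then have \<Phi>_meas: "\<Phi> \<in> borel_measurable lebesgue" by (auto intro: measurable_completion)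
  (* The margin 1 bounds the symbol 1 / (F - alpha) on high frequencies. *)
  have "\<forall>\<^sub>F r in at_top. \<alpha> + 1 \<le> F r" using F(2) by (simp add: filterlim_at_top)
  then obtain \<Lambda>0 where \<Lambda>0: "\<And>r. \<Lambda>0 \<le> r \<Longrightarrow> \<alpha> + 1 \<le> F r" by (auto simp: eventually_at_top_linorder)
  define \<Lambda> where "\<Lambda> = max 0 \<Lambda>0"
  have \<Lambda>: "0 \<le> \<Lambda>" by (simp add: \<Lambda>_def)
  have \<Phi>_ge: "\<alpha> + 1 \<le> \<Phi> \<xi>" if "\<not> norm \<xi> \<le> \<Lambda>" for \<xi> using \<Lambda>0[of "norm \<xi>"] that by (simp add: \<Phi>_def \<Lambda>_def)
  have "bounded (\<Phi> ` cball 0 \<Lambda>)"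
    by (intro compact_imp_bounded compact_continuous_image continuous_on_subset[OF \<Phi>_cont]) auto
  then obtain B where B: "\<And>\<xi>. norm \<xi> \<le> \<Lambda> \<Longrightarrow> \<bar>\<Phi> \<xi>\<bar> \<le> B" by (force simp: bounded_iff)
  define p where "p = (indicator (cball 0 \<Lambda>) :: 'a \<Rightarrow> complex)"
  define q where "q = (indicator (- cball 0 \<Lambda>) :: 'a \<Rightarrow> complex)"
  define n where "n \<xi> = (if norm \<xi> \<le> \<Lambda> then 0 else 1 / (\<Phi> \<xi> - \<alpha>))" for \<xi>
  define a where "a \<xi> = (if norm \<xi> \<le> \<Lambda> then \<alpha> - \<Phi> \<xi> else 0)" for \<xi>
  define g where "g \<xi> = \<Phi> \<xi> + a \<xi>" for \<xi>
  let ?n = "\<lambda>\<xi>. complex_of_real (n \<xi>)" and ?a = "\<lambda>\<xi>. complex_of_real (a \<xi>)"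
  have n_borel [measurable]: "n \<in> borel_measurable borel" unfolding n_def[abs_def] by measurable
  have a_borel [measurable]: "a \<in> borel_measurable borel" unfolding a_def[abs_def] by measurable
  have "g \<in> borel_measurable borel" unfolding g_def[abs_def] by measurable
  then have g_meas: "g \<in> borel_measurable lebesgue" by (auto intro: measurable_completion)
  have n_meas: "?n \<in> borel_measurable lebesgue" and a_meas: "?a \<in> borel_measurable lebesgue"
    by (intro lebesgue_measurable_if_borel; measurable)+
  have g_ge: "\<alpha> \<le> g \<xi>" for \<xi> using \<Phi>_ge[of \<xi>] by (cases "norm \<xi> \<le> \<Lambda>") (simp_all add: g_def a_def)
  then have g_nonneg: "0 \<le> g \<xi>" for \<xi> using \<alpha> order_trans less_imp_le by meson
  have p: "bounded_symbol p" and q: "bounded_symbol q" unfolding p_def q_def by auto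
  have n: "bounded_symbol ?n"
  proof -
    have "\<bar>n \<xi>\<bar> \<le> 1" for \<xi> using \<Phi>_ge[of \<xi>] by (auto simp: n_def divide_le_eq_1)
    then show ?thesis using n_meas by (auto simp: bounded_symbol_def intro!: exI[of _ 1])
  qed
  have a: "bounded_symbol ?a"
  proof -
    have "\<bar>a \<xi>\<bar> \<le> \<alpha> + max 0 B" for \<xi> using B[of \<xi>] \<alpha> by (auto simp: a_def)
    then show ?thesis using a_meas by (auto simp: bounded_symbol_def intro!: exI[of _ "\<alpha> + max 0 B"])
  qed
  have n1: "bounded_symbol (\<lambda>\<xi>. complex_of_real \<alpha> * ?n \<xi>)" by (intro bounded_symbol_mult n) simp
  have gn_eq: "complex_of_real (g \<xi>) * ?n \<xi> = q \<xi> + complex_of_real \<alpha> * ?n \<xi>" for \<xi>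
  proof (cases "norm \<xi> \<le> \<Lambda>")
    case False
    then have "g \<xi> * n \<xi> = 1 + \<alpha> * n \<xi>" using \<Phi>_ge[OF False] by (simp add: g_def a_def n_def field_simps)
    then have "complex_of_real (g \<xi> * n \<xi>) = complex_of_real (1 + \<alpha> * n \<xi>)" by simp
    then show ?thesis using False by (simp add: q_def)
  qed (simp add: q_def n_def)
  have gn: "bounded_symbol (\<lambda>\<xi>. complex_of_real (g \<xi>) * ?n \<xi>)" unfolding gn_eq by (intro bounded_symbol_add q n1)
  have ag: "?a \<xi> * complex_of_real (g \<xi>) = complex_of_real \<alpha> * ?a \<xi>" for \<xi> by (simp add: a_def g_def)
  have \<omega>': "- \<omega> \<in> sets lebesgue" using sets.compl_sets[OF \<omega>] by (simp add: Compl_eq_Diff_UNIV)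
  have i: "bounded_symbol (indicator \<omega> :: 'a \<Rightarrow> complex)" and i': "bounded_symbol (indicator (- \<omega>) :: 'a \<Rightarrow> complex)"
    using \<omega> \<omega>' by auto
  let ?I = "indicator_L2 \<omega>" and ?I' = "indicator_L2 (- \<omega>)"
  have I: "bounded_clinear_L2 ?I" and I': "bounded_clinear_L2 ?I'"
    unfolding indicator_L2_Mul using i i' by (auto intro: bounded_clinear_L2_Mul)
  have II: "?I u + ?I' u = u" for u
  proof -
    have "?I u + ?I' u = Mul (\<lambda>x. indicator \<omega> x + indicator (- \<omega>) x) u"
      unfolding indicator_L2_Mul by (rule Mul_symbol_add[OF i i', symmetric])
    also have "\<dots> = Mul (\<lambda>_. 1) u" by (rule Mul_cong) (simp add: indicator_def)
    finally show ?thesis by simp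
  qed
  define P where "P = fmult p"
  define A where "A = fmult ?a"
  have P: "bounded_clinear_L2 P" and A: "bounded_clinear_L2 A" and N0: "bounded_clinear_L2 (fmult ?n)"
    unfolding P_def A_def using p a n by (auto intro: bounded_clinear_fmult)
  have lin: "linear B" if "bounded_clinear_L2 B" for B :: "'a L2 \<Rightarrow> 'a L2"
    using that bounded_linear.linear by (auto simp: bounded_clinear_L2_def)
  have PP: "P (P u) = P u" for u
    unfolding P_def fmult_fmult[OF p p] by (simp add: p_def flip: indicator_inter_arith)
  have PA: "P (A u) = A u" for u
  proof -
    have "(\<lambda>\<xi>. p \<xi> * ?a \<xi>) = ?a" by (auto simp: p_def a_def fun_eq_iff)
    then show ?thesis unfolding P_def A_def fmult_fmult[OF p a] by (simp only:)
  qed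
  have An: "A (fmult ?n u) = 0" for u
  proof -
    have "(\<lambda>\<xi>. ?a \<xi> * ?n \<xi>) = (\<lambda>_. 0)" by (simp add: a_def n_def fun_eq_iff)
    then show ?thesis unfolding A_def fmult_fmult[OF a n] by simp
  qed
  have norm_P: "norm (P u) \<le> norm u" for u
    using norm_fmult_le[OF p, of 1 u] by (simp add: P_def p_def indicator_def)
  obtain c where c: "0 < c" "\<And>u. (AE \<xi> in lebesgue. \<Lambda> < norm \<xi> \<longrightarrow> L2_fun (fourier_L2 u) \<xi> = 0) \<Longrightarrow> c * norm u \<le> norm (?I u)"
    using spectral[OF \<Lambda>] by blast
  have cP: "c * norm (P u) \<le> norm (?I (P u))" for u
  proof (rule c(2))
    show "AE \<xi> in lebesgue. \<Lambda> < norm \<xi> \<longrightarrow> L2_fun (fourier_L2 (P u)) \<xi> = 0"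
      using L2_fun_Mul[OF p, of "fourier_L2 u"] unfolding P_def fourier_fmult
      by eventually_elim (simp add: p_def)
  qed
  define H where "H u = P (?I' (P u))" for u
  (* The constant c of the spectral inequality is not known to be at most 1, hence the maximum. *)
  define \<rho> where "\<rho> = sqrt (max 0 (1 - c\<^sup>2))"
  have \<rho>: "0 \<le> \<rho>" "\<rho> < 1" using c(1) by (auto simp: \<rho>_def max_def)
  have pyth: "(norm (?I' u))\<^sup>2 = (norm u)\<^sup>2 - (norm (?I u))\<^sup>2" for u
  proof -
    have "inner (?I u) (?I' u) = inner u (Mul (\<lambda>x. cnj (indicator \<omega> x)) (Mul (indicator (- \<omega>)) u))"
      unfolding indicator_L2_Mul by (rule inner_Mul[OF i])
    also have "Mul (\<lambda>x. cnj (indicator \<omega> x)) (Mul (indicator (- \<omega>)) u) = Mul (\<lambda>x. cnj (indicator \<omega> x) * indicator (- \<omega>) x) u"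
      by (rule Mul_Mul) (use i i' in \<open>auto simp: bounded_symbol_def\<close>)
    also have "\<dots> = Mul (\<lambda>_. 0) u" by (rule Mul_cong) (simp add: indicator_def)
    finally have "inner (?I u) (?I' u) = 0" by simp
    then have "(norm (?I u + ?I' u))\<^sup>2 = (norm (?I u))\<^sup>2 + (norm (?I' u))\<^sup>2"
      by (rule norm_add_Pythagorean[unfolded orthogonal_def])
    then show ?thesis by (simp add: II)
  qed
  have H_le: "norm (H u) \<le> \<rho> * norm u" for u
  proof -
    have "(norm (?I' (P u)))\<^sup>2 \<le> (norm (P u))\<^sup>2 - (c * norm (P u))\<^sup>2"
      unfolding pyth using cP[of u] c(1) by (intro diff_left_mono power_mono) auto
    also have "\<dots> = (1 - c\<^sup>2) * (norm (P u))\<^sup>2" by (simp add: algebra_simps power_mult_distrib)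
    also have "\<dots> \<le> \<rho>\<^sup>2 * (norm (P u))\<^sup>2" by (intro mult_right_mono) (auto simp: \<rho>_def)
    also have "\<dots> \<le> \<rho>\<^sup>2 * (norm u)\<^sup>2" by (intro mult_left_mono power_mono norm_P) auto
    finally have "(norm (?I' (P u)))\<^sup>2 \<le> (\<rho> * norm u)\<^sup>2" by (simp add: power_mult_distrib)
    then have "norm (?I' (P u)) \<le> \<rho> * norm u" by (rule power2_le_imp_le) (use \<rho> in auto)
    then show ?thesis unfolding H_def using norm_P order_trans by blast
  qed
  have "bounded_clinear_L2 H" unfolding H_def[abs_def] by (intro bounded_clinear_L2_compose[OF P] bounded_clinear_L2_compose[OF I'] P)
  then obtain R where R: "bounded_clinear_L2 R" and R_eq: "\<And>y. R y = H (R y) + y"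
    using contraction_resolvent[OF _ \<rho> H_le] by blast
  define K where "K u = R (A u)" for u
  have K: "bounded_clinear_L2 K" unfolding K_def[abs_def] by (rule bounded_clinear_L2_compose[OF R A])
  have PIK: "P (?I (K u)) = A u" for u
  proof -
    have k: "K u = H (K u) + A u" unfolding K_def by (rule R_eq)
    have Pk: "P (K u) = K u"
    proof -
      have "P (K u) = P (H (K u)) + P (A u)" by (subst k) (rule linear_add[OF lin[OF P]])
      also have "P (H (K u)) = H (K u)" unfolding H_def by (rule PP)
      finally show ?thesis using k PA by simp
    qed
    have "P (?I (K u)) + P (?I' (K u)) = P (K u)"
      by (subst (3) II[of "K u", symmetric]) (rule linear_add[OF lin[OF P], symmetric])
    moreover have "P (?I' (K u)) = H (K u)" unfolding H_def Pk ..
    ultimately show ?thesis using k Pk by (metis add.commute add_right_imp_eq)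
  qed
  define N where "N u = fmult ?n (?I (K u))" for u
  have N: "bounded_clinear_L2 N" unfolding N_def[abs_def]
    by (intro bounded_clinear_L2_compose[OF N0] bounded_clinear_L2_compose[OF I] K)
  have KN: "K (N u) = 0" for u unfolding K_def N_def An by (rule linear_0[OF lin[OF R]])
  have NN: "N (N u) = 0" for u unfolding N_def[of "N u"] KN
    by (simp add: linear_0[OF lin[OF I]] linear_0[OF lin[OF N0]])
  define J where "J u = u + N u" for u
  define J' where "J' u = u - N u" for u
  have J: "bounded_clinear_L2 J" unfolding J_def[abs_def] by (intro bounded_clinear_L2_add bounded_clinear_L2_id N)
  have J': "bounded_clinear_L2 J'" unfolding J'_def[abs_def] by (intro bounded_clinear_L2_diff bounded_clinear_L2_id N)
  have JJ': "J (J' u) = u" and J'J: "J' (J u) = u" for u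
    by (simp_all add: J_def J'_def linear_add[OF lin[OF N]] linear_diff[OF lin[OF N]] NN)
  define E where "E t = fmult (heat_symbol g t)" for t
  have E: "bounded_clinear_L2 (E t)" if "0 \<le> t" for t
    unfolding E_def using bounded_symbol_heat[OF g_meas g_nonneg that] by (rule bounded_clinear_fmult)
  have E_norm: "norm (E t u) \<le> exp (- \<alpha> * t) * norm u" if "0 \<le> t" for t u
    unfolding E_def
  proof (rule norm_fmult_le[OF bounded_symbol_heat[OF g_meas g_nonneg that]])
    fix \<xi> show "cmod (heat_symbol g t \<xi>) \<le> exp (- \<alpha> * t)"
      using mult_left_mono[OF g_ge[of \<xi>] that] by (simp add: heat_symbol_def[OF g_meas g_nonneg] mult.commute)
  qed
  define T where "T t u = J' (E t (J u))" for t u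
  have T: "bounded_clinear_L2 (T t)" if "0 \<le> t" for t
    unfolding T_def[abs_def] by (intro bounded_clinear_L2_compose[OF J'] bounded_clinear_L2_compose[OF E[OF that]] J)
  have blin: "bounded_linear B" if "bounded_clinear_L2 B" for B :: "'a L2 \<Rightarrow> 'a L2"
    using that by (auto simp: bounded_clinear_L2_def)
  have quotient: "(T t u - u) /\<^sub>R t = J' ((E t (J u) - J u) /\<^sub>R t)" for t u
    unfolding T_def linear_scale[OF lin[OF J']] linear_diff[OF lin[OF J']] J'J ..
  have quotient': "(E t (J u) - J u) /\<^sub>R t = J ((T t u - u) /\<^sub>R t)" for t u
    unfolding quotient JJ' ..
  have dom: "unbounded_dom g = unbounded_dom \<Phi>"
    unfolding g_def[abs_def] by (rule unbounded_fmult_perturb(1)[OF \<Phi>_meas a])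
  have Ndom: "N u \<in> unbounded_dom g" for u unfolding N_def by (rule unbounded_fmult_fmult(1)[OF n g_meas gn])
  have Ndom': "- N u \<in> unbounded_dom g" for u
    using Ndom[of "- u"] by (simp add: linear_neg[OF lin[OF N]])
  have Jdom: "J u \<in> unbounded_dom g \<longleftrightarrow> u \<in> unbounded_dom g" for u
    using unbounded_fmult_add(1)[OF g_meas _ Ndom, of u u] unbounded_fmult_add(1)[OF g_meas _ Ndom', of "J u" u]
    by (auto simp: J_def)
  (* The conjugated generator is the closed-loop one: on low frequencies the feedback replaces F by alpha,
     and the commutator with N produces exactly the part of the feedback that acts on high frequencies. *)
  have GJ: "- J' (unbounded_fmult g (J u)) = - (multiplier F u + ?I (K u))" if u: "u \<in> unbounded_dom g" for u
  proof -
    have Gu: "unbounded_fmult g u = multiplier F u + A u"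
      unfolding g_def[abs_def] multiplier_eq A_def \<Phi>_def[symmetric]
      using u unfolding dom by (intro unbounded_fmult_perturb(2)[OF \<Phi>_meas a])
    have GN: "unbounded_fmult g (N u) = fmult q (?I (K u)) + \<alpha> *\<^sub>R N u"
    proof -
      have "unbounded_fmult g (N u) = fmult (\<lambda>\<xi>. q \<xi> + complex_of_real \<alpha> * ?n \<xi>) (?I (K u))"
        unfolding N_def unbounded_fmult_fmult(2)[OF n g_meas gn] gn_eq ..
      also have "\<dots> = fmult q (?I (K u)) + fmult (\<lambda>\<xi>. complex_of_real \<alpha> * ?n \<xi>) (?I (K u))"
        by (rule fmult_symbol_add[OF q n1])
      also have "fmult (\<lambda>\<xi>. complex_of_real \<alpha> * ?n \<xi>) (?I (K u)) = fmult (\<lambda>_. complex_of_real \<alpha>) (N u)"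
        unfolding N_def by (rule fmult_fmult[symmetric]) (use n in auto)
      also have "\<dots> = \<alpha> *\<^sub>R N u" by (rule fmult_const)
      finally show ?thesis .
    qed
    have NG: "N (unbounded_fmult g w) = \<alpha> *\<^sub>R N w" if "w \<in> unbounded_dom g" for w
    proof -
      have "A (unbounded_fmult g w) = fmult (\<lambda>\<xi>. complex_of_real \<alpha> * ?a \<xi>) w"
        unfolding A_def by (rule fmult_unbounded_fmult[OF a g_meas that ag])
      also have "\<dots> = fmult (\<lambda>_. complex_of_real \<alpha>) (A w)" unfolding A_def by (rule fmult_fmult[symmetric]) (use a in auto)
      also have "\<dots> = \<alpha> *\<^sub>R A w" by (rule fmult_const)
      finally show ?thesis unfolding N_def K_def
        by (simp add: linear_scale[OF lin[OF R]] linear_scale[OF lin[OF I]] linear_scale[OF lin[OF N0]])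
    qed
    have "unbounded_fmult g (J u) = unbounded_fmult g u + unbounded_fmult g (N u)"
      unfolding J_def by (rule unbounded_fmult_add(2)[OF g_meas u Ndom])
    moreover have "N (unbounded_fmult g (J u)) = \<alpha> *\<^sub>R N u"
      using NG[of "J u"] u by (simp add: Jdom) (simp add: J_def linear_add[OF lin[OF N]] NN)
    moreover have "?I (K u) = A u + fmult q (?I (K u))"
    proof -
      have "?I (K u) = fmult (\<lambda>_. 1) (?I (K u))" by simp
      also have "(\<lambda>_. 1) = (\<lambda>\<xi>. p \<xi> + q \<xi>)" by (auto simp: p_def q_def indicator_def)
      also have "fmult \<dots> (?I (K u)) = P (?I (K u)) + fmult q (?I (K u))"
        unfolding P_def by (rule fmult_symbol_add[OF p q])
      finally show ?thesis by (simp add: PIK)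
    qed
    ultimately show ?thesis unfolding J'_def Gu GN by (simp add: algebra_simps)
  qed
  have "strongly_continuous_semigroup T"
    unfolding strongly_continuous_semigroup_def
  proof (intro conjI allI impI)
    have "heat_symbol g 0 = (\<lambda>_. 1)" by (rule ext) (simp add: heat_symbol_def[OF g_meas g_nonneg])
    then show "T 0 u = u" for u by (simp add: T_def E_def J'J)
    show "T (s + t) u = T s (T t u)" if "0 \<le> s" "0 \<le> t" for s t u
      unfolding T_def JJ' E_def heat_semigroup[OF g_meas g_nonneg that] ..
    show "((\<lambda>t. T t u) \<longlongrightarrow> u) (at_right 0)" for u
    proof -
      have "((\<lambda>t. J' (E t (J u))) \<longlongrightarrow> J' (J u)) (at_right 0)"
        unfolding E_def by (intro bounded_linear.tendsto[OF blin[OF J']] heat_tendsto[OF g_meas g_nonneg])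
      then show ?thesis by (simp add: T_def J'J)
    qed
  qed (rule T)
  moreover have gen: "((\<lambda>t. (T t u - u) /\<^sub>R t) \<longlongrightarrow> - (multiplier F u + ?I (K u))) (at_right 0)" if "u \<in> unbounded_dom g" for u
  proof -
    have "((\<lambda>t. J' ((E t (J u) - J u) /\<^sub>R t)) \<longlongrightarrow> J' (- unbounded_fmult g (J u))) (at_right 0)"
      unfolding E_def using that by (intro bounded_linear.tendsto[OF blin[OF J']] heat_generator[OF g_meas g_nonneg]) (simp add: Jdom)
    then show ?thesis unfolding quotient by (simp only: linear_neg[OF lin[OF J']] GJ[OF that])
  qed
  moreover have "u \<in> unbounded_dom g" if "((\<lambda>t. (T t u - u) /\<^sub>R t) \<longlongrightarrow> v) (at_right 0)" for u v
  proof -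
    have "((\<lambda>t. J ((T t u - u) /\<^sub>R t)) \<longlongrightarrow> J v) (at_right 0)"
      by (intro bounded_linear.tendsto[OF blin[OF J]] that)
    then have "J u \<in> unbounded_dom g"
      unfolding quotient'[symmetric] E_def by (rule heat_generator_domain[OF g_meas g_nonneg])
    then show ?thesis by (simp add: Jdom)
  qed
  moreover have domF: "multiplier_dom F = unbounded_dom g"
    unfolding multiplier_dom_eq dom \<Phi>_def[abs_def] ..
  ultimately have gens: "generates_semigroup (multiplier_dom F) (\<lambda>u. - (multiplier F u + ?I (K u))) T"
    unfolding generates_semigroup_def domF by blast
  obtain C where C: "\<And>u. norm (J u) \<le> norm u * C" using bounded_linear.pos_bounded[OF blin[OF J]] by blast
  obtain C' where C': "0 < C'" "\<And>u. norm (J' u) \<le> norm u * C'" using bounded_linear.pos_bounded[OF blin[OF J']] by blast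
  define M where "M = max 1 (C * C')"
  have decay: "onorm (T t) \<le> M * exp (- \<alpha> * t)" if "0 \<le> t" for t
  proof (rule onorm_bound)
    show "0 \<le> M * exp (- \<alpha> * t)" by (simp add: M_def)
    fix u
    have "norm (T t u) \<le> norm (E t (J u)) * C'" unfolding T_def by (rule C')
    also have "\<dots> \<le> (exp (- \<alpha> * t) * norm (J u)) * C'" using C'(1) by (intro mult_right_mono E_norm[OF that]) auto
    also have "\<dots> \<le> (exp (- \<alpha> * t) * (norm u * C)) * C'" using C'(1) by (intro mult_right_mono mult_left_mono C) auto
    also have "\<dots> = (C * C') * (exp (- \<alpha> * t) * norm u)" by simp
    also have "\<dots> \<le> M * (exp (- \<alpha> * t) * norm u)" by (intro mult_right_mono) (auto simp: M_def)
    finally show "norm (T t u) \<le> M * exp (- \<alpha> * t) * norm u" by simp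
  qed
  show ?thesis unfolding exponentially_stabilizable_def
    using gens decay K by (intro exI[of _ M] conjI exI[of _ K] exI[of _ T]) (auto simp: M_def)
qed

section \<open>Stabilizable systems have thick control sets\<close>

lemma inner_unbounded_fmult:
  fixes u v :: "'a::euclidean_space L2"
  assumes u: "u \<in> unbounded_dom g" and v: "v \<in> unbounded_dom g"
  shows "inner (unbounded_fmult g u) v = inner u (unbounded_fmult g v)"
proof -
  let ?a = "L2_fun (fourier_L2 u)" and ?b = "L2_fun (fourier_L2 v)"
  have sq: "square_integrable (\<lambda>\<xi>. complex_of_real (g \<xi>) * ?a \<xi>)" "square_integrable (\<lambda>\<xi>. complex_of_real (g \<xi>) * ?b \<xi>)"
    using u v by (simp_all add: unbounded_dom_def)
  have "inner (L2_of (\<lambda>\<xi>. complex_of_real (g \<xi>) * ?a \<xi>)) (L2_of ?b) = inner (L2_of ?a) (L2_of (\<lambda>\<xi>. complex_of_real (g \<xi>) * ?b \<xi>))"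
    using sq by (subst (1 2) inner_L2_of) (auto simp: mult_ac)
  then have "inner (fourier_L2 (unbounded_fmult g u)) (fourier_L2 v) = inner (fourier_L2 u) (fourier_L2 (unbounded_fmult g v))"
    by (simp add: unbounded_fmult_def)
  then show ?thesis by (simp add: inner_fourier_fourier)
qed

text \<open>
  From the right the derivative is immediate from the semigroup law. From the left,
  \<open>T s u - T (s - h) u = T (s - h) (T h u - u)\<close>, and the operator in front varies with \<open>h\<close>; uniform
  boundedness and strong continuity compensate for this. Both cases are bounded by the same \<open>H h\<close>.
\<close>

lemma semigroup_orbit_derivative:
  fixes T :: "real \<Rightarrow> 'a::euclidean_space L2 \<Rightarrow> 'a L2"
  assumes gen: "generates_semigroup D A T" and M: "\<And>t u. 0 \<le> t \<Longrightarrow> norm (T t u) \<le> M * norm u"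
    and M0: "0 \<le> M" and u: "u \<in> D" and s: "0 < s"
  shows "T s u \<in> D" and "((\<lambda>t. T t u) has_vector_derivative A (T s u)) (at s)"
proof -
  have sg: "strongly_continuous_semigroup T"
    and D: "D = {u. \<exists>v. ((\<lambda>t. (T t u - u) /\<^sub>R t) \<longlongrightarrow> v) (at_right 0)}"
    and Au: "\<And>u. u \<in> D \<Longrightarrow> ((\<lambda>t. (T t u - u) /\<^sub>R t) \<longlongrightarrow> A u) (at_right 0)"
    using gen by (auto simp: generates_semigroup_def)
  have bl: "bounded_linear (T t)" if "0 \<le> t" for t
    using sg that by (auto simp: strongly_continuous_semigroup_def bounded_clinear_L2_def)
  have lin: "linear (T t)" if "0 \<le> t" for t using bl[OF that] bounded_linear.linear by blast
  have add: "T (r + t) w = T r (T t w)" if "0 \<le> r" "0 \<le> t" for r t w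
    using sg that by (auto simp: strongly_continuous_semigroup_def)
  have cont: "((\<lambda>t. T t w) \<longlongrightarrow> w) (at_right 0)" for w
    using sg by (auto simp: strongly_continuous_semigroup_def)
  have lim: "((\<lambda>t. (T t (T s u) - T s u) /\<^sub>R t) \<longlongrightarrow> T s (A u)) (at_right 0)"
  proof (rule Lim_transform_eventually)
    show "((\<lambda>t. T s ((T t u - u) /\<^sub>R t)) \<longlongrightarrow> T s (A u)) (at_right 0)"
      using s by (intro bounded_linear.tendsto[OF bl] Au u) simp
    show "\<forall>\<^sub>F t in at_right 0. T s ((T t u - u) /\<^sub>R t) = (T t (T s u) - T s u) /\<^sub>R t"
      using eventually_at_right_less[of 0]
    proof eventually_elim
      case (elim t)
      then have "T t (T s u) = T s (T t u)" using add[of t s u] add[of s t u] s by (simp add: add.commute)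
      then show ?case using s by (simp add: linear_scale[OF lin] linear_diff[OF lin])
    qed
  qed
  then show TsD: "T s u \<in> D" unfolding D by blast
  have ATs: "A (T s u) = T s (A u)"
    using tendsto_unique[OF _ Au[OF TsD] lim] by simp
  define R where "R t = (T t u - u) /\<^sub>R t - A u" for t
  have R: "(R \<longlongrightarrow> 0) (at_right 0)" unfolding R_def[abs_def] using Au[OF u] by (simp add: LIM_zero_iff)
  show "((\<lambda>t. T t u) has_vector_derivative A (T s u)) (at s)"
    unfolding has_vector_derivative_def ATs
  proof (rule has_derivativeI_sandwich[where e=s])
    show "0 < s" by (rule s)
    show "bounded_linear (\<lambda>t. t *\<^sub>R T s (A u))" by (rule bounded_linear_scaleR_left)
    define H where "H h = M * norm (R h) + M * norm (T h (A u) - A u)" for h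
    show "norm (T t u - T s u - (t - s) *\<^sub>R T s (A u)) / norm (t - s) \<le> H \<bar>t - s\<bar>" if t: "t \<noteq> s" "dist t s < s" for t
    proof (cases "s < t")
      case True
      define h where "h = t - s"
      have h: "0 < h" using True by (simp add: h_def)
      have "T t u = T s (T h u)" using add[of s h u] s h by (simp add: h_def)
      moreover have "T h u = u + h *\<^sub>R (R h + A u)" using h by (simp add: R_def)
      ultimately have "T t u - T s u - h *\<^sub>R T s (A u) = h *\<^sub>R T s (R h)"
        using s by (simp add: linear_add[OF lin] linear_scale[OF lin] scaleR_add_right)
      then have "norm (T t u - T s u - (t - s) *\<^sub>R T s (A u)) / norm (t - s) = norm (T s (R h))"
        using h by (simp add: h_def[symmetric])
      also have "\<dots> \<le> M * norm (R h)" using M s by simp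
      also have "\<dots> \<le> H h" using M0 by (simp add: H_def)
      finally show ?thesis using h by (simp add: h_def)
    next
      case False
      define h where "h = s - t"
      have h: "0 < h" "0 < t" using False t by (auto simp: h_def dist_real_def)
      have Ts: "T s w = T t (T h w)" for w using add[of t h w] h by (simp add: h_def)
      have Thu: "T h u = u + h *\<^sub>R (R h + A u)" using h by (simp add: R_def)
      have "T t u - T s u + h *\<^sub>R T s (A u) = h *\<^sub>R (T t (T h (A u) - A u) - T t (R h))"
        unfolding Ts Thu using h by (simp add: linear_add[OF lin] linear_scale[OF lin] linear_diff[OF lin] scaleR_add_right scaleR_diff_right)
      moreover have "- ((t - s) *\<^sub>R T s (A u)) = h *\<^sub>R T s (A u)" by (simp add: h_def flip: scaleR_minus_left)
      ultimately have "norm (T t u - T s u - (t - s) *\<^sub>R T s (A u)) = norm (h *\<^sub>R (T t (T h (A u) - A u) - T t (R h)))"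
        by (metis diff_conv_add_uminus)
      then have "norm (T t u - T s u - (t - s) *\<^sub>R T s (A u)) / norm (t - s) = norm (T t (T h (A u) - A u) - T t (R h))"
        using h by (simp add: h_def abs_minus_commute)
      also have "\<dots> \<le> norm (T t (T h (A u) - A u)) + norm (T t (R h))" by (rule norm_triangle_ineq4)
      also have "\<dots> \<le> M * norm (T h (A u) - A u) + M * norm (R h)" using M h by (intro add_mono) auto
      also have "\<dots> = H h" by (simp add: H_def)
      finally show ?thesis using h by (simp add: h_def abs_minus_commute)
    qed
    have "(H \<longlongrightarrow> M * norm (0::'a L2) + M * norm (A u - A u)) (at_right 0)"
      unfolding H_def[abs_def] by (intro tendsto_intros R cont)
    then have H0: "(H \<longlongrightarrow> 0) (at_right 0)" by simp
    have "filterlim (\<lambda>t. \<bar>t - s\<bar>) (at_right 0) (at s)"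
    proof -
      have "((\<lambda>t. \<bar>t - s\<bar>) \<longlongrightarrow> \<bar>s - s\<bar>) (at s)" by (intro tendsto_intros)
      moreover have "\<forall>\<^sub>F t in at s. t \<noteq> s" by (simp add: eventually_at_filter)
      ultimately show ?thesis by (simp add: filterlim_at eventually_conj_iff)
    qed
    then show "((\<lambda>t. H \<bar>t - s\<bar>) \<longlongrightarrow> 0) (at s)" by (rule filterlim_compose[OF H0])
  qed
qed

text \<open>
  The identity used is
  \<open>d/ds \<langle>T s g, g\<rangle> = - \<langle>T s g, F(|D|) g\<rangle> - \<langle>K (T s g), 1\<^bsub>\<omega>\<^esub> g\<rangle>\<close>, in which
  \<open>F(|D|) g\<close> differs from \<open>c g\<close>, \<open>c = F 0\<close>, by \<open>e\<close> of norm at most \<open>\<delta> |g|\<close>. After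
  multiplication with \<open>exp (c s)\<close>, both terms decay like \<open>exp (- \<mu> s)\<close> with
  \<open>\<mu> = \<alpha> - c > 0\<close>. The choice \<open>\<delta> = \<mu> / (2 M)\<close> makes the term with \<open>e\<close> cost half of the left
  side.
\<close>

lemma weak_observability:
  fixes \<omega> :: "'a::euclidean_space set"
  assumes stab: "exponentially_stabilizable F \<omega> \<alpha>" and F: "continuous_on {0..} F" and \<omega>: "\<omega> \<in> sets lebesgue"
    and \<alpha>: "F 0 < \<alpha>" "0 \<le> \<alpha>"
  shows "\<exists>r>0. \<exists>C. \<forall>v. supported_in_ball r v \<longrightarrow>
    norm (inv fourier_L2 (L2_of v)) \<le> C * norm (indicator_L2 \<omega> (inv fourier_L2 (L2_of v)) :: 'a L2)"
proof -
  obtain M K T where M: "1 \<le> M" and K: "bounded_clinear_L2 K"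
    and gen: "generates_semigroup (multiplier_dom F) (\<lambda>u. - (multiplier F u + indicator_L2 \<omega> (K u))) T"
    and decay: "\<And>t. 0 \<le> t \<Longrightarrow> onorm (T t) \<le> M * exp (- \<alpha> * t)"
    using stab unfolding exponentially_stabilizable_def by blast
  define \<Phi> where "\<Phi> \<xi> = F (norm \<xi>)" for \<xi> :: 'a
  have \<Phi>_cont: "continuous_on UNIV \<Phi>"
    unfolding \<Phi>_def[abs_def] by (rule continuous_on_compose2[OF F(1)]) (auto intro: continuous_intros)
  have "\<Phi> \<in> borel_measurable borel" by (rule borel_measurable_continuous_onI[OF \<Phi>_cont])
  then have \<Phi>_meas: "\<Phi> \<in> borel_measurable lebesgue" by (auto intro: measurable_completion)
  have dom: "multiplier_dom F = unbounded_dom \<Phi>" and mult: "multiplier F = unbounded_fmult \<Phi>"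
    by (simp_all add: multiplier_dom_eq multiplier_eq \<Phi>_def[abs_def])
  define c where "c = F 0"
  define \<mu> where "\<mu> = \<alpha> - c"
  have \<mu>: "0 < \<mu>" using \<alpha> by (simp add: \<mu>_def c_def)
  define \<delta> where "\<delta> = \<mu> / (2 * M)"
  have \<delta>: "0 < \<delta>" using \<mu> M by (simp add: \<delta>_def)
  have "isCont \<Phi> 0" using \<Phi>_cont by (simp add: continuous_on_eq_continuous_at)
  then obtain d where d: "0 < d" "\<And>\<xi>. norm \<xi> < d \<Longrightarrow> \<bar>\<Phi> \<xi> - \<Phi> 0\<bar> < \<delta>"
    using \<delta> unfolding continuous_at_eps_delta by (metis dist_norm diff_zero real_norm_def)
  define r where "r = d / 2"
  have r: "0 < r" "\<And>\<xi>. norm \<xi> \<le> r \<Longrightarrow> \<bar>\<Phi> \<xi> - c\<bar> \<le> \<delta>"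
    using d(1) d(2) by (auto simp: r_def \<Phi>_def c_def intro!: less_imp_le)
  have sg: "strongly_continuous_semigroup T" using gen by (simp add: generates_semigroup_def)
  have bl: "bounded_linear (T t)" if "0 \<le> t" for t
    using sg that by (auto simp: strongly_continuous_semigroup_def bounded_clinear_L2_def)
  have T_le: "norm (T t u) \<le> M * exp (- \<alpha> * t) * norm u" if "0 \<le> t" for t u
  proof -
    have "norm (T t u) \<le> onorm (T t) * norm u" by (rule onorm[OF bl[OF that]])
    also have "\<dots> \<le> M * exp (- \<alpha> * t) * norm u" by (rule mult_right_mono[OF decay[OF that]]) simp
    finally show ?thesis .
  qed
  have T_bound: "norm (T t u) \<le> M * norm u" if "0 \<le> t" for t u
  proof -
    have "M * exp (- \<alpha> * t) * norm u \<le> M * 1 * norm u"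
      using \<alpha>(2) that M by (intro mult_right_mono mult_left_mono) auto
    then show ?thesis using T_le[OF that, of u] by simp
  qed
  obtain k where k: "0 < k" "\<And>u. norm (K u) \<le> norm u * k"
    using K bounded_linear.pos_bounded unfolding bounded_clinear_L2_def by blast
  let ?I = "indicator_L2 \<omega> :: 'a L2 \<Rightarrow> 'a L2"
  have i: "bounded_symbol (indicator \<omega> :: 'a \<Rightarrow> complex)" using \<omega> by simp
  have inner_I: "inner (?I u) v = inner u (?I v)" for u v
  proof -
    have "(\<lambda>x. cnj (indicator \<omega> x)) = (indicator \<omega> :: 'a \<Rightarrow> complex)" by (auto simp: indicator_def)
    then show ?thesis unfolding indicator_L2_Mul using inner_Mul[OF i, of u v] by (simp only:)
  qed
  have main: "norm g \<le> (2 * M * k / \<mu>) * norm (?I g)" if v: "supported_in_ball r v" and g_def: "g = inv fourier_L2 (L2_of v)" for v g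
  proof (cases "g = 0")
    case False
    have sqv: "square_integrable v" using v by (simp add: supported_in_ball_def)
    have [measurable]: "v \<in> borel_measurable lebesgue" using sqv by (simp add: square_integrable_def)
    note [measurable] = \<Phi>_meas
    have Wg: "fourier_L2 g = L2_of v" by (simp add: g_def)
    have le: "cmod (complex_of_real (\<Phi> \<xi> - c) * v \<xi>) \<le> cmod (complex_of_real \<delta> * v \<xi>)" for \<xi>
    proof (cases "v \<xi> = 0")
      case False
      then have "norm \<xi> \<le> r" using v by (force simp: supported_in_ball_def not_le)
      then have "\<bar>\<Phi> \<xi> - c\<bar> * cmod (v \<xi>) \<le> \<delta> * cmod (v \<xi>)" using r(2) by (intro mult_right_mono) auto
      then show ?thesis using \<delta> by (simp only: norm_mult norm_of_real)
    qed simp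
    have sq_rem: "square_integrable (\<lambda>\<xi>. complex_of_real (\<Phi> \<xi> - c) * v \<xi>)"
      and norm_rem: "norm (L2_of (\<lambda>\<xi>. complex_of_real (\<Phi> \<xi> - c) * v \<xi>)) \<le> norm (L2_of (\<lambda>\<xi>. complex_of_real \<delta> * v \<xi>))"
      using square_integrable_mono[OF square_integrable_cmult[OF sqv], of "\<lambda>\<xi>. complex_of_real (\<Phi> \<xi> - c) * v \<xi>" "complex_of_real \<delta>"] le
      by auto
    have split: "complex_of_real (\<Phi> \<xi>) * v \<xi> = complex_of_real (\<Phi> \<xi> - c) * v \<xi> + complex_of_real c * v \<xi>" for \<xi>
      by (simp add: algebra_simps)
    have sq\<Phi>: "square_integrable (\<lambda>\<xi>. complex_of_real (\<Phi> \<xi>) * v \<xi>)"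
      unfolding split by (intro square_integrable_add sq_rem square_integrable_cmult sqv)
    have gD: "g \<in> unbounded_dom \<Phi>"
      using unbounded_dom_iff_square_integrable(1)[OF sqv Wg \<Phi>_meas] sq\<Phi> by blast
    define e where "e = unbounded_fmult \<Phi> g - c *\<^sub>R g"
    have We: "fourier_L2 e = L2_of (\<lambda>\<xi>. complex_of_real (\<Phi> \<xi> - c) * v \<xi>)"
    proof -
      have "fourier_L2 e = L2_of (\<lambda>\<xi>. complex_of_real (\<Phi> \<xi>) * v \<xi>) - c *\<^sub>R L2_of v"
        unfolding e_def linear_diff[OF linear_fourier] unbounded_dom_iff_square_integrable(2)[OF sqv Wg \<Phi>_meas gD] fourier_L2_scaleR Wg ..
      also have "L2_of (\<lambda>\<xi>. complex_of_real (\<Phi> \<xi>) * v \<xi>) = L2_of (\<lambda>\<xi>. complex_of_real (\<Phi> \<xi> - c) * v \<xi>) + c *\<^sub>R L2_of v"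
        unfolding split L2_of_scaleR[OF sqv, symmetric] by (rule L2_of_add[OF sq_rem square_integrable_cmult[OF sqv]])
      finally show ?thesis by simp
    qed
    have e_le: "norm e \<le> \<delta> * norm g"
    proof (rule norm_fourier_cancel)
      show "norm (fourier_L2 e) \<le> \<delta> * norm (fourier_L2 g)"
        using norm_rem \<delta> unfolding We Wg L2_of_scaleR[OF sqv] by simp
    qed
    define B where "B = M * norm g * (\<delta> * norm g + k * norm (?I g))"
    define \<phi> where "\<phi> s = exp (c * s) * inner (T s g) g" for s
    (* psi is nondecreasing and tends to 0 at infinity, so its limit at 0 is at most 0; this replaces the
       integration of the derivative of phi. *)
    define \<psi> where "\<psi> s = \<phi> s - B / \<mu> * exp (- \<mu> * s)" for s
    have \<phi>_deriv: "\<exists>y. (\<phi> has_real_derivative y) (at s) \<and> - (B * exp (- \<mu> * s)) \<le> y" if s: "0 < s" for s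
    proof -
      let ?A = "\<lambda>u. - (multiplier F u + ?I (K u))"
      have gD': "g \<in> multiplier_dom F" using gD dom by simp
      note orb = semigroup_orbit_derivative[OF gen T_bound _ gD' s]
      have M0: "0 \<le> M" using M by simp
      have TD: "T s g \<in> unbounded_dom \<Phi>" using orb(1)[OF _ M0] dom by simp
      have "((\<lambda>t. inner (T t g) g) has_vector_derivative inner (?A (T s g)) g) (at s)"
        by (rule bounded_linear.has_vector_derivative[OF bounded_linear_inner_left orb(2)[OF _ M0]])
      then have "((\<lambda>t. inner (T t g) g) has_real_derivative inner (?A (T s g)) g) (at s)"
        by (simp add: has_real_derivative_iff_has_vector_derivative)
      then have d: "(\<phi> has_real_derivative (c * exp (c * s) * inner (T s g) g + exp (c * s) * inner (?A (T s g)) g)) (at s)"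
        unfolding \<phi>_def[abs_def] by (auto intro!: derivative_eq_intros)
      have "inner (?A (T s g)) g = - (inner (T s g) (unbounded_fmult \<Phi> g) + inner (K (T s g)) (?I g))"
        unfolding mult inner_I[symmetric] inner_unbounded_fmult[OF TD gD, symmetric] by (simp add: inner_add_left inner_diff_left inner_minus_left)
      moreover have "inner (T s g) (unbounded_fmult \<Phi> g) = inner (T s g) e + c * inner (T s g) g"
        by (simp add: e_def inner_diff_right)
      ultimately have A: "inner (?A (T s g)) g = - (inner (T s g) e + c * inner (T s g) g + inner (K (T s g)) (?I g))"
        by (simp only:)
      have y: "c * exp (c * s) * inner (T s g) g + exp (c * s) * inner (?A (T s g)) g
        = - (exp (c * s) * (inner (T s g) e + inner (K (T s g)) (?I g)))"
        unfolding A by (simp add: algebra_simps)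
      have s0: "0 \<le> s" using s by simp
      have "inner (T s g) e + inner (K (T s g)) (?I g) \<le> norm (T s g) * norm e + norm (K (T s g)) * norm (?I g)"
        by (intro add_mono norm_cauchy_schwarz)
      also have "\<dots> \<le> norm (T s g) * (\<delta> * norm g) + (norm (T s g) * k) * norm (?I g)"
        by (intro add_mono mult_left_mono mult_right_mono e_le k) auto
      also have "\<dots> = norm (T s g) * (\<delta> * norm g + k * norm (?I g))" by (simp add: algebra_simps)
      also have "\<dots> \<le> (M * exp (- \<alpha> * s) * norm g) * (\<delta> * norm g + k * norm (?I g))"
        using \<delta> k by (intro mult_right_mono T_le[OF s0]) auto
      also have "\<dots> = exp (- \<alpha> * s) * B" by (simp add: B_def)
      finally have "exp (c * s) * (inner (T s g) e + inner (K (T s g)) (?I g)) \<le> exp (c * s) * (exp (- \<alpha> * s) * B)"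
        by (rule mult_left_mono) simp
      also have "\<dots> = B * exp (- \<mu> * s)" by (simp add: \<mu>_def exp_add[symmetric] algebra_simps flip: mult.assoc)
      finally show ?thesis using d unfolding y by (intro exI conjI) auto
    qed
    have \<psi>_mono: "\<psi> a \<le> \<psi> b" if "0 < a" "a \<le> b" for a b
    proof (rule DERIV_nonneg_imp_nondecreasing[OF that(2)])
      fix s assume "a \<le> s" "s \<le> b"
      then have "0 < s" using that by simp
      then obtain y where y: "(\<phi> has_real_derivative y) (at s)" "- (B * exp (- \<mu> * s)) \<le> y" using \<phi>_deriv by blast
      have "(\<psi> has_real_derivative (y - B / \<mu> * (exp (- \<mu> * s) * (- \<mu>)))) (at s)"
        unfolding \<psi>_def[abs_def] by (auto intro!: derivative_eq_intros y(1))
      moreover have "0 \<le> y - B / \<mu> * (exp (- \<mu> * s) * (- \<mu>))" using y(2) \<mu> by simp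
      ultimately show "\<exists>y. (\<psi> has_real_derivative y) (at s) \<and> 0 \<le> y" by blast
    qed
    have exp_lim: "((\<lambda>s. exp (- \<mu> * s)) \<longlongrightarrow> 0) at_top"
    proof -
      have "filterlim (\<lambda>s. \<mu> * s) at_top at_top"
        by (rule filterlim_tendsto_pos_mult_at_top[OF tendsto_const \<mu> filterlim_ident])
      then have "filterlim (\<lambda>s. - (\<mu> * s)) at_bot at_top" by (simp add: filterlim_uminus_at_top)
      from filterlim_compose[OF exp_at_bot this] show ?thesis by simp
    qed
    have \<phi>_lim: "(\<phi> \<longlongrightarrow> 0) at_top"
    proof (rule Lim_null_comparison)
      show "\<forall>\<^sub>F s in at_top. norm (\<phi> s) \<le> M * (norm g)\<^sup>2 * exp (- \<mu> * s)"
        using eventually_ge_at_top[of 0]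
      proof eventually_elim
        case (elim s)
        have "\<bar>inner (T s g) g\<bar> \<le> norm (T s g) * norm g" by (rule Cauchy_Schwarz_ineq2)
        also have "\<dots> \<le> (M * exp (- \<alpha> * s) * norm g) * norm g" by (rule mult_right_mono[OF T_le[OF elim]]) simp
        finally have "exp (c * s) * \<bar>inner (T s g) g\<bar> \<le> exp (c * s) * ((M * exp (- \<alpha> * s) * norm g) * norm g)"
          by (rule mult_left_mono) simp
        also have "\<dots> = M * (norm g)\<^sup>2 * (exp (c * s) * exp (- \<alpha> * s))" by (simp add: power2_eq_square)
        also have "exp (c * s) * exp (- \<alpha> * s) = exp (- \<mu> * s)" by (simp add: \<mu>_def exp_add[symmetric] algebra_simps)
        finally show ?case by (simp add: \<phi>_def abs_mult)
      qed
      show "((\<lambda>s. M * (norm g)\<^sup>2 * exp (- \<mu> * s)) \<longlongrightarrow> 0) at_top"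
        using tendsto_mult_left[OF exp_lim, of "M * (norm g)\<^sup>2"] by simp
    qed
    have \<psi>_lim: "(\<psi> \<longlongrightarrow> 0) at_top"
      unfolding \<psi>_def[abs_def] using tendsto_diff[OF \<phi>_lim tendsto_mult_left[OF exp_lim, of "B / \<mu>"]] by simp
    have \<psi>_le: "\<psi> a \<le> 0" if "0 < a" for a
    proof (rule tendsto_lowerbound[OF \<psi>_lim])
      show "\<forall>\<^sub>F s in at_top. \<psi> a \<le> \<psi> s" using eventually_ge_at_top[of a] by eventually_elim (rule \<psi>_mono[OF that])
    qed simp
    have "((\<lambda>s. T s g) \<longlongrightarrow> g) (at_right 0)" using sg by (simp add: strongly_continuous_semigroup_def)
    then have "(\<psi> \<longlongrightarrow> exp (c * 0) * inner g g - B / \<mu> * exp (- \<mu> * 0)) (at_right 0)"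
      unfolding \<psi>_def[abs_def] \<phi>_def by (intro tendsto_intros)
    then have "exp (c * 0) * inner g g - B / \<mu> * exp (- \<mu> * 0) \<le> 0"
      by (rule tendsto_upperbound) (auto intro!: eventually_mono[OF eventually_at_right_less[of 0]] \<psi>_le)
    then have "(norm g)\<^sup>2 \<le> B / \<mu>" by (simp add: power2_norm_eq_inner)
    then have "\<mu> * (norm g)\<^sup>2 \<le> B" using \<mu> by (simp add: field_simps)
    then have "\<mu> * norm g * norm g \<le> (M * (\<delta> * norm g + k * norm (?I g))) * norm g" by (simp add: B_def power2_eq_square mult_ac)
    then have "\<mu> * norm g \<le> M * (\<delta> * norm g + k * norm (?I g))" by (rule mult_right_le_imp_le) (use False in simp)
    also have "\<dots> = \<mu> / 2 * norm g + M * k * norm (?I g)" using M by (simp add: \<delta>_def field_simps)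
    finally show ?thesis using \<mu> by (simp add: field_simps)
  qed (use M k(1) \<mu> in simp)
  show ?thesis using r(1) main by blast
qed

text \<open>
  Take for \<open>v\<close> the indicator of the ball of radius \<open>r\<close>, modulated by a plane wave; the inverse
  transforms are, up to a factor, the translates of one bounded function \<open>G\<close>. Choose \<open>R\<close> such that
  \<open>G\<close> has only a small part outside the ball of radius \<open>R\<close>. Observability of the translate by \<open>y\<close>
  then bounds, up to a factor, the norm of \<open>G\<close> by its bound \<open>B\<close> times the square root of the measure of \<open>\<omega>\<close> in
  the ball around \<open>y\<close>, and the cube with side \<open>2 R\<close> and centre \<open>y\<close> contains this ball.
\<close>

lemma thick_if_weak_observability:
  fixes \<omega> :: "'a::euclidean_space set"
  assumes \<omega>: "\<omega> \<in> sets lebesgue" and r: "0 < r"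
    and obs: "\<And>v. supported_in_ball r v \<Longrightarrow>
      norm (inv fourier_L2 (L2_of v)) \<le> C * norm (indicator_L2 \<omega> (inv fourier_L2 (L2_of v)) :: 'a L2)"
  shows "\<exists>L>0. \<exists>\<kappa>>0. \<forall>x. \<kappa> \<le> measure lebesgue (\<omega> \<inter> (+) x ` cube L)"
proof -
  define b where "b = (indicator (cball 0 r) :: 'a \<Rightarrow> complex)"
  have b_int: "integrable lebesgue b" and b_sq: "square_integrable b" and b_norm: "norm (L2_of b) \<noteq> 0"
  proof -
    have m: "cball (0::'a) r \<in> lmeasurable" by simp
    have eq: "b = (\<lambda>x. complex_of_real (indicator (cball 0 r) x))" by (auto simp: b_def indicator_def)
    have i: "integrable lebesgue (indicator (cball (0::'a) r) :: 'a \<Rightarrow> real)"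
      using m by (intro integrable_real_indicator) (auto simp: fmeasurable_def)
    then show "integrable lebesgue b" unfolding eq by (simp add: complex_of_real_integrable_eq)
    have eq2: "(cmod (b x))\<^sup>2 = indicator (cball 0 r) x" for x by (simp add: b_def indicator_def)
    show sq: "square_integrable b" unfolding square_integrable_def eq2 using i by (simp add: b_def borel_measurable_indicator)
    have "(norm (L2_of b))\<^sup>2 = measure lebesgue (cball (0::'a) r)"
      unfolding norm_L2_of[OF sq] eq2 by simp
    moreover have "measure lebesgue (cball (0::'a) r) > 0" using content_cball_pos[OF r, of "0::'a"] by simp
    ultimately show "norm (L2_of b) \<noteq> 0" by auto
  qed
  define G where "G x = cnj (FT b x)" for x
  have [measurable]: "FT b \<in> borel_measurable borel" by (rule FT_measurable) (use b_int in simp)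
  have G_meas [measurable]: "G \<in> borel_measurable borel" unfolding G_def[abs_def] by measurable
  have G_sq: "square_integrable G" unfolding G_def[abs_def] by (intro square_integrable_cnj Plancherel(1) b_int b_sq)
  define a where "a = norm (L2_of G)"
  have a: "0 < a"
  proof -
    have "L2_of G = conj_L2 (L2_of (FT b))" unfolding G_def[abs_def] by (rule conj_L2_of[symmetric]) (rule Plancherel(1)[OF b_int b_sq])
    then have "a = sqrt (2 * pi) ^ DIM('a) * norm (L2_of b)" by (simp add: a_def norm_conj_L2 Plancherel(2)[OF b_int b_sq])
    then show ?thesis using b_norm by simp
  qed
  define B where "B = (\<integral>x. cmod (b x) \<partial>lebesgue) + 1"
  have B: "0 < B" "\<And>x. cmod (G x) \<le> B"
  proof -
    show "0 < B" by (simp add: B_def add_nonneg_pos)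
    show "cmod (G x) \<le> B" for x using cmod_FT_le[OF b_int, of x] by (simp add: B_def G_def)
  qed
  define C' where "C' = max C 1"
  have C': "0 < C'" by (simp add: C'_def)
  have G_y_sq: "square_integrable (\<lambda>x. G (x + - y))" for y by (rule L2_translate(1)[OF G_meas G_sq])
  have i: "bounded_symbol (indicator \<omega> :: 'a \<Rightarrow> complex)" using \<omega> by simp
  have obs_G: "a \<le> C' * norm (L2_of (\<lambda>x. indicator \<omega> x * G (x + - y)))" for y
  proof -
    define v where "v \<xi> = wave \<xi> y * b \<xi>" for \<xi>
    have e: "bounded_symbol (\<lambda>\<xi>. wave \<xi> y)"
      unfolding bounded_symbol_def by (auto intro!: exI[of _ 1] lebesgue_measurable_if_borel character_measurable[simplified])
    have v_sq: "square_integrable v" unfolding v_def by (rule square_integrable_Mul[OF e b_sq])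
    have v_int: "integrable lebesgue v" unfolding v_def by (rule integrable_FT_integrand[OF b_int])
    have v: "supported_in_ball r v" using v_sq by (simp add: supported_in_ball_def v_def b_def)
    have FTv: "FT (\<lambda>\<xi>. cnj (v \<xi>)) x = FT b (x + - y)" for x
      unfolding FT_def
    proof (rule Bochner_Integration.integral_cong[OF refl])
      fix \<xi>
      have "cnj (b \<xi>) = b \<xi>" by (simp add: b_def indicator_def)
      moreover have "wave \<xi> x * cnj (wave \<xi> y) = exp (- \<i> * complex_of_real (\<xi> \<bullet> (x + - y)))"
        by (simp add: exp_cnj exp_add[symmetric] inner_diff_right algebra_simps)
      ultimately show "wave \<xi> x * cnj (v \<xi>) = exp (- \<i> * complex_of_real (\<xi> \<bullet> (x + - y))) * b \<xi>"
        unfolding v_def by (metis complex_cnj_mult mult.assoc)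
    qed
    define k where "k = 1 / (2 * pi) ^ DIM('a)"
    have k: "0 < k" by (simp add: k_def)
    have u: "inv fourier_L2 (L2_of v) = k *\<^sub>R L2_of (\<lambda>x. G (x + - y))"
      unfolding inv_fourier_L2 adj_fourier_L2_of[OF v_int v_sq] FTv G_def k_def ..
    have Iu: "indicator_L2 \<omega> (inv fourier_L2 (L2_of v)) = k *\<^sub>R L2_of (\<lambda>x. indicator \<omega> x * G (x + - y))"
      unfolding u indicator_L2_Mul Mul_scaleR[OF i] Mul_L2_of[OF i G_y_sq] ..
    have "k * norm (L2_of (\<lambda>x. G (x + - y))) \<le> C * (k * norm (L2_of (\<lambda>x. indicator \<omega> x * G (x + - y))))"
      using obs[OF v] k unfolding Iu unfolding u by simp
    also have "\<dots> \<le> C' * (k * norm (L2_of (\<lambda>x. indicator \<omega> x * G (x + - y))))"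
      using k by (intro mult_right_mono) (auto simp: C'_def)
    finally have "k * norm (L2_of (\<lambda>x. G (x + - y))) \<le> k * (C' * norm (L2_of (\<lambda>x. indicator \<omega> x * G (x + - y))))"
      by (simp only: mult.left_commute)
    then have "norm (L2_of (\<lambda>x. G (x + - y))) \<le> C' * norm (L2_of (\<lambda>x. indicator \<omega> x * G (x + - y)))"
      by (rule mult_left_le_imp_le[OF _ k])
    then show ?thesis by (simp only: L2_translate(2)[OF G_meas G_sq] a_def)
  qed
  have "((\<lambda>R. norm (L2_of G - cut R (L2_of G))) \<longlongrightarrow> norm (L2_of G - L2_of G)) at_top"
    by (intro tendsto_intros cut_tendsto)
  then have "\<forall>\<^sub>F R in at_top. norm (L2_of G - cut R (L2_of G)) < a / (2 * C')"
    by (rule order_tendstoD(2)) (use a C' in simp)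
  then have "\<forall>\<^sub>F R in at_top. norm (L2_of G - cut R (L2_of G)) < a / (2 * C') \<and> 0 < R"
    using eventually_gt_at_top[of 0] by (rule eventually_conj)
  then obtain R where R: "norm (L2_of G - cut R (L2_of G)) < a / (2 * C')" "0 < R"
    using eventually_happens'[OF trivial_limit_at_top_linorder] by blast
  define \<kappa> where "\<kappa> = (a / (2 * C' * B))\<^sup>2"
  have \<kappa>: "0 < \<kappa>" using a C' B by (simp add: \<kappa>_def)
  have ball: "\<kappa> \<le> measure lebesgue (\<omega> \<inter> cball y R)" for y
  proof -
    let ?S = "\<omega> \<inter> cball y R"
    let ?G = "\<lambda>x. G (x + - y)"
    have S: "?S \<in> lmeasurable" unfolding Int_commute[of \<omega>] using \<omega> by (intro fmeasurable_Int_fmeasurable) auto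
    have S': "?S \<in> sets lebesgue" "\<omega> - cball y R \<in> sets lebesgue" using \<omega> by auto
    note sq1 = square_integrable_Mul[OF bounded_symbol_indicator[OF S'(1)] G_y_sq[of y]]
    note sq2 = square_integrable_Mul[OF bounded_symbol_indicator[OF S'(2)] G_y_sq[of y]]
    have out: "norm (L2_of (\<lambda>x. indicator (\<omega> - cball y R) x * ?G x)) \<le> a / (2 * C')"
    proof -
      define D where "D x = indicator (- cball 0 R) x * G x" for x
      have D_meas: "D \<in> borel_measurable borel" unfolding D_def[abs_def] by (intro borel_measurable_times borel_measurable_indicator G_meas) auto
      have D_sq: "square_integrable D" unfolding D_def by (intro square_integrable_Mul G_sq bounded_symbol_indicator) auto
      have "norm (L2_of (\<lambda>x. indicator (\<omega> - cball y R) x * ?G x)) \<le> norm (L2_of (\<lambda>x. D (x + - y)))"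
      proof (rule square_integrable_mono(2)[OF L2_translate(1)[OF D_meas D_sq]])
        show "(\<lambda>x. indicator (\<omega> - cball y R) x * ?G x) \<in> borel_measurable lebesgue"
          using sq2 by (simp add: square_integrable_def)
        show "AE x in lebesgue. cmod (indicator (\<omega> - cball y R) x * ?G x) \<le> cmod (D (x + - y))"
          by (intro AE_I2) (auto simp: D_def indicator_def dist_norm norm_minus_commute)
      qed
      also have "\<dots> = norm (L2_of D)" by (rule L2_translate(2)[OF D_meas D_sq])
      also have "L2_of D = L2_of G - cut R (L2_of G)"
      proof -
        have c: "bounded_symbol (indicator (cball 0 R) :: 'a \<Rightarrow> complex)" by simp
        have "D = (\<lambda>x. G x - indicator (cball 0 R) x * G x)" by (auto simp: D_def indicator_def)
        then show ?thesis unfolding Mul_L2_of[OF c G_sq] using L2_of_diff[OF G_sq square_integrable_Mul[OF c G_sq]] by simp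
      qed
      finally show ?thesis using R(1) by simp
    qed
    have inn: "norm (L2_of (\<lambda>x. indicator ?S x * ?G x)) \<le> B * sqrt (measure lebesgue ?S)"
    proof (rule square_integrableI_nn(2))
      show "(\<lambda>x. indicator ?S x * ?G x) \<in> borel_measurable lebesgue" using sq1 by (simp add: square_integrable_def)
      have "(\<integral>\<^sup>+x. ennreal ((cmod (indicator ?S x * ?G x))\<^sup>2) \<partial>lebesgue) \<le> (\<integral>\<^sup>+x. ennreal (B\<^sup>2) * indicator ?S x \<partial>lebesgue)"
        using B by (intro nn_integral_mono) (auto simp: indicator_def intro!: ennreal_leI power_mono)
      also have "\<dots> = ennreal (B\<^sup>2) * emeasure lebesgue ?S" using S' by (simp add: nn_integral_cmult)
      also have "\<dots> = ennreal ((B * sqrt (measure lebesgue ?S))\<^sup>2)"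
        using S by (simp add: emeasure_eq_measure2 power_mult_distrib ennreal_mult)
      finally show "(\<integral>\<^sup>+x. ennreal ((cmod (indicator ?S x * ?G x))\<^sup>2) \<partial>lebesgue) \<le> ennreal ((B * sqrt (measure lebesgue ?S))\<^sup>2)" .
    qed (use B in simp)
    have "(\<lambda>x. indicator \<omega> x * ?G x) = (\<lambda>x. indicator ?S x * ?G x + indicator (\<omega> - cball y R) x * ?G x)"
      by (auto simp: indicator_def)
    then have "norm (L2_of (\<lambda>x. indicator \<omega> x * ?G x)) \<le> B * sqrt (measure lebesgue ?S) + a / (2 * C')"
      using L2_of_add[OF sq1 sq2] norm_triangle_ineq[of "L2_of (\<lambda>x. indicator ?S x * ?G x)" "L2_of (\<lambda>x. indicator (\<omega> - cball y R) x * ?G x)"] inn out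
      by simp
    then have "a \<le> C' * (B * sqrt (measure lebesgue ?S) + a / (2 * C'))"
      using obs_G[of y] C' by (meson less_imp_le mult_left_mono order_trans)
    then have "a / (2 * C' * B) \<le> sqrt (measure lebesgue ?S)" using C' B(1) by (simp add: field_simps)
    then have "\<kappa> \<le> (sqrt (measure lebesgue ?S))\<^sup>2" unfolding \<kappa>_def using a C' B by (intro power_mono) auto
    then show ?thesis by simp
  qed
  have "\<kappa> \<le> measure lebesgue (\<omega> \<inter> (+) x ` cube (2 * R))" for x
  proof -
    (* x is a corner of the cube, y its centre. *)
    define y where "y = x + (\<Sum>i\<in>Basis. R *\<^sub>R i)"
    have eq: "(+) x ` cube (2 * R) = cbox (x + 0) (x + (\<Sum>i\<in>Basis. (2 * R) *\<^sub>R i))"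
      unfolding cube_eq_cbox by (rule cbox_translation[symmetric])
    have sub: "cball y R \<subseteq> (+) x ` cube (2 * R)"
      unfolding eq
    proof
      fix z assume z: "z \<in> cball y R"
      show "z \<in> cbox (x + 0) (x + (\<Sum>i\<in>Basis. (2 * R) *\<^sub>R i))"
        unfolding mem_box
      proof
        fix i :: 'a assume i: "i \<in> Basis"
        have "\<bar>(z - y) \<bullet> i\<bar> \<le> R" using Basis_le_norm[OF i, of "z - y"] z by (simp add: dist_norm norm_minus_commute)
        then show "(x + 0) \<bullet> i \<le> z \<bullet> i \<and> z \<bullet> i \<le> (x + (\<Sum>i\<in>Basis. (2 * R) *\<^sub>R i)) \<bullet> i"
          using i by (auto simp: y_def inner_diff_left inner_add_left abs_le_iff)
      qed
    qed
    have "\<kappa> \<le> measure lebesgue (\<omega> \<inter> cball y R)" by (rule ball)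
    also have "\<dots> \<le> measure lebesgue (\<omega> \<inter> (+) x ` cube (2 * R))"
    proof (rule measure_mono_fmeasurable)
      show "\<omega> \<inter> (+) x ` cube (2 * R) \<in> lmeasurable"
        unfolding eq Int_commute[of \<omega>] using \<omega> by (intro fmeasurable_Int_fmeasurable) auto
    qed (use sub \<omega> in auto)
    finally show ?thesis .
  qed
  then show ?thesis using R(2) \<kappa> by (intro exI[of _ "2 * R"] conjI exI[of _ \<kappa>]) auto
qed

lemma cube_vec: "cube L = {y :: real ^ 'n. \<forall>i. y $ i \<in> {0..L}}"
  by (auto simp: cube_def Basis_vec_def inner_axis)

text \<open>
  Any positive rate above \<open>F 0\<close> already forces thickness, so a single rate is used for that direction.
\<close>

theorem corollary2p3:
  fixes F :: "real \<Rightarrow> real" and \<omega> :: "(real ^ 'n) set"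
  assumes "continuous_on {0..} F"
    and "bdd_below (F ` {0..})"
    and "filterlim F at_top at_top"
    and "\<omega> \<in> sets lebesgue"
  shows "rapidly_stabilizable F \<omega> \<longleftrightarrow> thick \<omega>"
proof
  assume "rapidly_stabilizable F \<omega>"
  moreover have "0 < \<bar>F 0\<bar> + 1" by simp
  ultimately have "exponentially_stabilizable F \<omega> (\<bar>F 0\<bar> + 1)"
    unfolding rapidly_stabilizable_def by blast
  moreover have "F 0 < \<bar>F 0\<bar> + 1" "0 \<le> \<bar>F 0\<bar> + 1" by linarith+
  ultimately obtain r C where "0 < r" "\<And>v. supported_in_ball r v \<Longrightarrow>
      norm (inv fourier_L2 (L2_of v)) \<le> C * norm (indicator_L2 \<omega> (inv fourier_L2 (L2_of v)))"
    using weak_observability[OF _ assms(1,4), of "\<bar>F 0\<bar> + 1"] by blast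
  then obtain L \<kappa> where L: "0 < L" and \<kappa>: "0 < \<kappa>" "\<And>x. \<kappa> \<le> measure lebesgue (\<omega> \<inter> (+) x ` cube L)"
    using thick_if_weak_observability[OF assms(4)] by blast
  (* The minimum keeps gamma strictly below 1. *)
  define \<gamma> where "\<gamma> = min (1 / 2) (\<kappa> / L ^ CARD('n))"
  have \<gamma>: "\<gamma> \<in> {0<..<1}" using L \<kappa>(1) by (simp add: \<gamma>_def)
  have "\<gamma> * L ^ CARD('n) \<le> \<kappa> / L ^ CARD('n) * L ^ CARD('n)"
    using L by (intro mult_right_mono) (auto simp: \<gamma>_def)
  also have "\<dots> = \<kappa>" using L by simp
  finally have "thick_at_scale \<gamma> L \<omega>"
    unfolding thick_at_scale_def cube_vec[symmetric] using assms(4) \<kappa>(2) order_trans by blast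
  then show "thick \<omega>" using \<gamma> L unfolding thick_def by blast
next
  assume "thick \<omega>"
  then obtain \<gamma> L where \<gamma>: "0 < \<gamma>" "0 < L" "thick_at_scale \<gamma> L \<omega>"
    unfolding thick_def by auto
  then have le: "\<And>x. \<gamma> * L ^ CARD('n) \<le> measure lebesgue (\<omega> \<inter> (+) x ` cube L)"
    unfolding thick_at_scale_def cube_vec[symmetric] by blast
  have pos: "0 < \<gamma> * L ^ CARD('n)" using \<gamma> by simp
  show "rapidly_stabilizable F \<omega>"
    unfolding rapidly_stabilizable_def
    using stabilizable_if_spectral_inequality[OF assms(1,3,4)] spectral_inequality[OF assms(4) pos \<gamma>(2) le]
    by blast
qed

end
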